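(* Let $I$ be a bounded open interval of $\mathbb{R}$ on which $\varphi=\inf_{x\in I}f(x)>0$. Assume: (i) $K:\mathbb{R}\to\mathbb{R}$ is nonnegative, continuous and bounded, with $\int_{\mathbb{R}}K(z)\,dz=1$, $\int_{\mathbb{R}}zK(z)\,dz=0$ and $\int_{\mathbb{R}}z^2K(z)\,dz<\infty$; (ii) $(\gamma_n)\in\mathcal{GS}(-\alpha)$ with $\alpha\in(\tfrac34,1]$, and the limit of $(n\gamma_n)^{-1}$ as $n\to\infty$ exists; $(h_n)\in\mathcal{GS}(-a)$ with $a\in(\tfrac{1-\alpha}{4},\tfrac{\alpha}{3})$; (iii) $g(s,t)$ is two times continuously differentiable with respect to $s$, and for all $x\in I$: for $q\in\{0,1,2\}$, $s\mapsto\int_{\mathbb{R}}t^q g(s,t)\,dt$ is a bounded function continuous at $s=x$; for $q\in[2,3]$, $s\mapsto\int_{\mathbb{R}}|t|^q g(s,t)\,dt$ is bounded; for $q\in\{0,1\}$, $\int_{\mathbb{R}}|t|^q\left|\frac{\partial g}{\partial s}(x,t)\right|dt<\infty$ and $s\mapsto\int_{\mathbb{R}}t^q\frac{\partial^2 g}{\partial s^2}(s,t)\,dt$ is a bounded function continuous at $s=x$; (iv) $K$ is Lipschitz-continuous; there exists $t^*>0$ such that $\mathbb{E}\left(\exp(t^*|Y|)\right)<\infty$; $a\in(1-\alpha,\alpha-\tfrac23)$; for $q\in\{0,1\}$, $x\mapsto\int_{\mathbb{R}}|t|^q\left|\frac{\partial g}{\partial s}(x,t)\right|dt$ is bounded on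 the set $\{x: f(x)>0\}$. 1. If the sequence $\left(\gamma_n^{-1}h_n^5/[\ln n]^2\right)$ is bounded and if $\lim_{n\to\infty}(n\gamma_n)>(1-a)/(2\varphi)$, then $$\sup_{x\in I}|r_n(x)-r(x)|=O\left(\sqrt{\gamma_nh_n^{-1}}\,\ln n\right)\quad\text{a.s.}$$ 2. If $\lim_{n\to\infty}\left(\gamma_n^{-1}h_n^5/[\ln n]^2\right)=\infty$ and if $\lim_{n\to\infty}(n\gamma_n)>2a/\varphi$, then $$\sup_{x\in I}|r_n(x)-r(x)|=O\left(h_n^2\right)\quad\text{a.s.}$$
   Context: $(X,Y),(X_1,Y_1),(X_2,Y_2),\ldots$ are independent, identically distributed pairs of real random variables with joint density $g(s,t)$; $f(s)=\int_{\mathbb{R}}g(s,t)\,dt$ is the density of $X$ and $r(x)=\mathbb{E}(Y\mid X=x)$ (that is, $r(x)=f(x)^{-1}\int_{\mathbb{R}}t\,g(x,t)\,dt$ when $f(x)\neq0$). $K$ is a kernel; the stepsize $(\gamma_n)$ and the bandwidth $(h_n)$ are nonrandom sequences of positive reals going to zero. For $n\ge1$ set $Z_n(x)=h_n^{-1}K\left(\frac{x-X_n}{h_n}\right)$ and $W_n(x)=h_n^{-1}Y_nK\left(\frac{x-X_n}{h_n}\right)$. The generalized Révész estimator is defined by setting $r_0(x)\in\mathbb{R}$ and, for $n\geq1$, $r_n(x)=r_{n-1}(x)+\gamma_n\left[W_n(x)-Z_n(x)r_{n-1}(x)\right]$. For $\gamma\in\mathbb{R}$, a nonrandom positive sequence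 $(v_n)_{n\ge1}$ belongs to $\mathcal{GS}(\gamma)$ if $\lim_{n\to\infty}n\left[1-\frac{v_{n-1}}{v_n}\right]=\gamma$. The case $\lim n\gamma_n=\infty$ is allowed.
   Formalization: Two hypotheses are added, without which the claim is false: the initial function r_0 is bounded on I, and for q in {0,1} the function t^q times the second s-derivative of g is jointly integrable over [-b,b] x R for every b. *)

theory Defs
  imports "HOL-Probability.Probability" "HOL-Library.Landau_Symbols"
begin

definition GS :: "real \<Rightarrow> (nat \<Rightarrow> real) set" where
  "GS c = {v. (\<forall>n\<ge>1. 0 < v n) \<and> (\<lambda>n. real n * (1 - v (n - 1) / v n)) \<longlonglongrightarrow> c}"

text \<open>In the following, \<open>g s t\<close> is the joint density of the pair \<open>(X, Y)\<close>.\<close>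

definition dens_X :: "(real \<Rightarrow> real \<Rightarrow> real) \<Rightarrow> real \<Rightarrow> real" where
  "dens_X g s = (\<integral>t. g s t \<partial>lborel)"

text \<open>The version of \<open>E(Y | X = x)\<close> given by the joint density. Where \<open>dens_X g x = 0\<close> the
  conditional expectation is not determined, and the value here is \<open>0\<close>.\<close>

definition regr :: "(real \<Rightarrow> real \<Rightarrow> real) \<Rightarrow> real \<Rightarrow> real" where
  "regr g x = (\<integral>t. t * g x t \<partial>lborel) / dens_X g x"

definition D1 :: "(real \<Rightarrow> real \<Rightarrow> real) \<Rightarrow> real \<Rightarrow> real \<Rightarrow> real" where
  "D1 g s t = deriv (\<lambda>u. g u t) s"

definition D2 :: "(real \<Rightarrow> real \<Rightarrow> real) \<Rightarrow> real \<Rightarrow> real \<Rightarrow> real" where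
  "D2 g = D1 (D1 g)"

text \<open>Continuity of the second derivative is in \<open>s\<close> only, for each fixed \<open>t\<close>.\<close>

definition twice_cont_diff_fst :: "(real \<Rightarrow> real \<Rightarrow> real) \<Rightarrow> bool" where
  "twice_cont_diff_fst g \<longleftrightarrow>
     (\<forall>t s. (\<lambda>u. g u t) field_differentiable (at s)) \<and>
     (\<forall>t s. (\<lambda>u. D1 g u t) field_differentiable (at s)) \<and>
     (\<forall>t. continuous_on UNIV (\<lambda>u. D2 g u t))"

definition Zk :: "(real \<Rightarrow> real) \<Rightarrow> (nat \<Rightarrow> real) \<Rightarrow> (nat \<Rightarrow> 'w \<Rightarrow> real) \<Rightarrow> nat \<Rightarrow> 'w \<Rightarrow> real \<Rightarrow> real" where
  "Zk K h X n \<omega> x = inverse (h n) * K ((x - X n \<omega>) / h n)"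

definition Wk :: "(real \<Rightarrow> real) \<Rightarrow> (nat \<Rightarrow> real) \<Rightarrow> (nat \<Rightarrow> 'w \<Rightarrow> real) \<Rightarrow> (nat \<Rightarrow> 'w \<Rightarrow> real)
    \<Rightarrow> nat \<Rightarrow> 'w \<Rightarrow> real \<Rightarrow> real" where
  "Wk K h X Y n \<omega> x = inverse (h n) * Y n \<omega> * K ((x - X n \<omega>) / h n)"

text \<open>The generalized Revesz estimator with initial value \<open>r0\<close>. Only the observations
  \<open>X n, Y n\<close> with \<open>n \<ge> 1\<close> are used; index \<open>0\<close> is left for the generic pair \<open>(X, Y)\<close>.\<close>

primrec revesz :: "(real \<Rightarrow> real) \<Rightarrow> (nat \<Rightarrow> real) \<Rightarrow> (nat \<Rightarrow> real) \<Rightarrow> (nat \<Rightarrow> 'w \<Rightarrow> real)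
    \<Rightarrow> (nat \<Rightarrow> 'w \<Rightarrow> real) \<Rightarrow> (real \<Rightarrow> real) \<Rightarrow> nat \<Rightarrow> 'w \<Rightarrow> real \<Rightarrow> real" where
  "revesz K \<gamma> h X Y r0 0 \<omega> x = r0 x"
| "revesz K \<gamma> h X Y r0 (Suc n) \<omega> x = revesz K \<gamma> h X Y r0 n \<omega> x
     + \<gamma> (Suc n) * (Wk K h X Y (Suc n) \<omega> x - Zk K h X (Suc n) \<omega> x * revesz K \<gamma> h X Y r0 n \<omega> x)"

text \<open>Almost surely, \<open>sup {\<bar>D n \<omega> x\<bar> | x \<in> I} = O(\<rho> n)\<close>. The first conjunct is needed because a
  real-valued \<open>SUP\<close> over a set that is not bounded above is a junk value.\<close>

definition as_sup_bigo ::
  "'w measure \<Rightarrow> real set \<Rightarrow> (nat \<Rightarrow> 'w \<Rightarrow> real \<Rightarrow> real) \<Rightarrow> (nat \<Rightarrow> real) \<Rightarrow> bool" where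
  "as_sup_bigo M I D \<rho> \<longleftrightarrow>
     (AE \<omega> in M. (\<forall>n. bdd_above ((\<lambda>x. \<bar>D n \<omega> x\<bar>) ` I)) \<and>
                 (\<lambda>n. SUP x\<in>I. \<bar>D n \<omega> x\<bar>) \<in> O(\<rho>))"

text \<open>Local joint integrability of \<open>t ^ q\<close> times the second partial derivative, for \<open>q = 0, 1\<close>.
  It makes Fubini's theorem applicable to the integrated Taylor remainder
  \<open>\<integral> t ^ q * (\<integral> u = x..s. (s - u) * D2 g u t) dt\<close>. Integrability in \<open>t\<close> for each fixed \<open>s\<close>,
  with integrals bounded and continuous in \<open>s\<close>, does not suffice for that: mass escaping to
  \<open>t = \<infinity>\<close> as \<open>s\<close> tends to a point \<open>x\<close> may give \<open>regr g\<close> a kink at \<open>x\<close>, and then the bias of the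
  estimator at \<open>x\<close> is of order \<open>h n\<close> instead of \<open>(h n)\<^sup>2\<close>.\<close>

definition D2_loc_integrable :: "(real \<Rightarrow> real \<Rightarrow> real) \<Rightarrow> bool" where
  "D2_loc_integrable g \<longleftrightarrow>
     (\<forall>q\<in>{0, 1::nat}. \<forall>b::real.
        set_integrable lborel ({-b..b} \<times> UNIV) (\<lambda>(s::real, t::real). t ^ q * D2 g s t))"

end

theory Submission
  imports Defs "HOL-Real_Asymp.Real_Asymp"
begin

text \<open>
  The recursion is a relaxed average: \<open>r\<^sub>n = (1 - w\<^sub>n) * r\<^sub>n\<^sub>-\<^sub>1 + w\<^sub>n * Y\<^sub>n\<close> with the random
  weight \<open>w\<^sub>n = \<gamma>\<^sub>n * Z\<^sub>n(x)\<close>, which lies in \<open>[0, 1]\<close> for all large \<open>n\<close>. Let \<open>e\<^sub>n\<close> be the error at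
  a fixed point \<open>x\<close> and \<open>v\<^sub>n\<close> the claimed rate. Given the past, the mean of \<open>e\<^sub>n - e\<^sub>n\<^sub>-\<^sub>1\<close> is
  \<open>- \<gamma>\<^sub>n * (f(x) + o(1)) * e\<^sub>n\<^sub>-\<^sub>1 + O(\<gamma>\<^sub>n * h\<^sub>n\<^sup>2)\<close>, and the variance is \<open>O(\<gamma>\<^sub>n\<^sup>2 / h\<^sub>n)\<close> times
  \<open>1 + e\<^sub>n\<^sub>-\<^sub>1\<^sup>2\<close>. The errors \<open>O(h\<^sub>n\<^sup>2)\<close> come from a second order Taylor expansion of
  \<open>s \<mapsto> \<integral> t ^ q * g s t dt\<close> (\<open>partial_moment_taylor\<close>) integrated against a kernel of mean zero
  (\<open>kernel_smoothing\<close>).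

  Both cases of the theorem are one statement about a rate with \<open>v\<^sub>n \<ge> c * h\<^sub>n\<^sup>2\<close> and
  \<open>v\<^sub>n \<ge> c * sqrt (\<gamma>\<^sub>n / h\<^sub>n) * ln n\<close>. Put \<open>\<theta>\<^sub>n = ln n / v\<^sub>n\<close>. Then, for responses of
  size \<open>O(ln n)\<close>, the jumps of \<open>\<theta>\<^sub>n * e\<^sub>n\<close> tend to \<open>0\<close>. Bias and variance add at most \<open>O(\<gamma>\<^sub>n * ln n)\<close> to the
  exponent of \<open>exp (\<theta>\<^sub>n * \<bar>e\<^sub>n\<bar>)\<close>, apart from a term quadratic in the error that is negligible against the drift.
  The condition on \<open>lim n * \<gamma>\<^sub>n\<close> makes the contraction \<open>1 - \<gamma>\<^sub>n * \<phi>\<close> stronger than the growth \<open>\<theta>\<^sub>n / \<theta>\<^sub>n\<^sub>-\<^sub>1\<close> (\<open>gain_beats_decay\<close>). Hence \<open>exp (\<theta>\<^sub>n * \<bar>e\<^sub>n\<bar>)\<close> decreases in mean whenever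
  \<open>\<theta>\<^sub>n * \<bar>e\<^sub>n\<bar>\<close> exceeds a large multiple of \<open>ln n\<close>, and below that level it is at most a power of \<open>n\<close>
  (\<open>drift_step\<close>, \<open>eventually_drift\<close>). This drift condition of Foster-Lyapunov type makes the
  expectation of \<open>exp (\<theta>\<^sub>n * \<bar>e\<^sub>n\<bar>)\<close> grow at most polynomially (\<open>exp_moment\<close>), and Markov's inequality bounds the
  probability of \<open>\<bar>e\<^sub>n\<bar> > D * v\<^sub>n\<close> by any negative power of \<open>n\<close>, for suitable \<open>D\<close>. A union bound over
  a grid of polynomial size, the Lipschitz dependence of \<open>r\<^sub>n\<close> on \<open>x\<close> with a polynomial constant, and the
  Borel-Cantelli lemma give the uniform almost sure bound (\<open>trec_sup_of_moment\<close>).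

  Two obstacles are removed beforehand. Bounded jumps need bounded responses, so \<open>Y\<^sub>n\<close> is truncated
  at a multiple of \<open>ln n\<close>; by the exponential moment of \<open>Y\<close> this changes nothing from a random
  index \<open>m\<close> on. Moreover the starting function \<open>r0\<close> is only bounded, so that \<open>r\<^sub>n\<close> itself need not be continuous in
  \<open>x\<close>. Since a relaxed average is affine in its starting value, both problems
  disappear if the truncated recursion is controlled for every deterministic starting index \<open>m\<close> and
  the two constant starting values \<open>0\<close> and \<open>1\<close> (\<open>revesz_as_sup_bigo\<close>).
\<close>

section \<open>Sequences with a given relative growth\<close>

text \<open>The additive form of the class \<open>GS\<close>: membership passes to products and powers by linearity, and a
  finite number of nonpositive terms is harmless, as is needed for \<open>n \<mapsto> ln n\<close>.\<close>

definition log_rate :: "real \<Rightarrow> (nat \<Rightarrow> real) \<Rightarrow> bool" where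
  "log_rate c v \<longleftrightarrow> (\<forall>\<^sub>F n in sequentially. 0 < v n) \<and>
     (\<lambda>n. real n * (ln (v n) - ln (v (n - 1)))) \<longlonglongrightarrow> c"

lemma eventually_shift_pred:
  assumes "eventually P sequentially"
  shows "\<forall>\<^sub>F n in sequentially. P (n - 1)"
  using filterlim_minus_const_nat_at_top[of 1] assms by (auto simp: filterlim_iff)

text \<open>With \<open>u\<^sub>n = 1 - v\<^sub>n\<^sub>-\<^sub>1 / v\<^sub>n\<close> the increment of \<open>ln v\<close> is \<open>- ln (1 - u\<^sub>n)\<close>, which differs from \<open>u\<^sub>n\<close> by
  \<open>O(u\<^sub>n\<^sup>2) = o(1 / n)\<close>.\<close>

lemma GS_imp_log_rate:
  assumes "v \<in> GS c"
  shows "log_rate c v"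
proof -
  have pos: "0 < v n" if "n \<ge> 1" for n using assms that by (auto simp: GS_def)
  define u where "u n = 1 - v (n - 1) / v n" for n
  have nu: "(\<lambda>n. real n * u n) \<longlonglongrightarrow> c" using assms by (auto simp: GS_def u_def)
  have "(\<lambda>n. real n * u n * (1 / real n)) \<longlonglongrightarrow> c * 0"
    by (intro tendsto_mult nu) (real_asymp)
  moreover have "\<forall>\<^sub>F n in sequentially. real n * u n * (1 / real n) = u n"
    using eventually_gt_at_top[of 0] by eventually_elim auto
  ultimately have u0: "u \<longlonglongrightarrow> 0" by (simp add: tendsto_cong)
  have ev: "\<forall>\<^sub>F n in sequentially. \<bar>u n\<bar> < 1/2"
    using order_tendstoD(2)[OF tendsto_rabs[OF u0], of "1/2"] by simp
  have "(\<lambda>n. 2 * (\<bar>real n * u n\<bar> * \<bar>u n\<bar>)) \<longlonglongrightarrow> 2 * (\<bar>c\<bar> * \<bar>0\<bar>)"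
    by (intro tendsto_intros nu u0)
  hence z: "(\<lambda>n. 2 * (\<bar>real n * u n\<bar> * \<bar>u n\<bar>)) \<longlonglongrightarrow> 0" by simp
  have d: "(\<lambda>n. real n * (ln (v n) - ln (v (n - 1))) - real n * u n) \<longlonglongrightarrow> 0"
  proof (rule Lim_null_comparison[OF _ z])
    show "\<forall>\<^sub>F n in sequentially. norm (real n * (ln (v n) - ln (v (n - 1))) - real n * u n)
            \<le> 2 * (\<bar>real n * u n\<bar> * \<bar>u n\<bar>)"
      using ev eventually_gt_at_top[of 1]
    proof eventually_elim
      case (elim n)
      have p: "0 < v n" "0 < v (n - 1)" using elim by (auto intro: pos)
      have "ln (v n) - ln (v (n - 1)) = - ln (1 + - u n)"
        using p by (simp add: u_def ln_div)
      moreover have "\<bar>ln (1 + - u n) - (- u n)\<bar> \<le> 2 * (- u n)\<^sup>2"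
        using elim by (intro abs_ln_one_plus_x_minus_x_bound) auto
      ultimately have "\<bar>(ln (v n) - ln (v (n - 1))) - u n\<bar> \<le> 2 * (u n)\<^sup>2" by simp
      hence "real n * \<bar>(ln (v n) - ln (v (n - 1))) - u n\<bar> \<le> real n * (2 * (u n)\<^sup>2)"
        by (intro mult_left_mono) auto
      also have "real n * (2 * (u n)\<^sup>2) = 2 * (\<bar>real n * u n\<bar> * \<bar>u n\<bar>)"
        by (simp add: abs_mult power2_eq_square[of "u n"] mult.assoc)
      also have "real n * \<bar>(ln (v n) - ln (v (n - 1))) - u n\<bar>
          = norm (real n * (ln (v n) - ln (v (n - 1))) - real n * u n)"
        by (simp add: abs_mult right_diff_distrib[symmetric])
      finally show ?case .
    qed
  qed
  have "(\<lambda>n. real n * (ln (v n) - ln (v (n - 1)))) \<longlonglongrightarrow> c"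
    using tendsto_add[OF d nu] by simp
  moreover have "\<forall>\<^sub>F n in sequentially. 0 < v n"
    using eventually_ge_at_top[of 1] by eventually_elim (rule pos)
  ultimately show ?thesis by (simp add: log_rate_def)
qed

lemma log_rate_combine:
  assumes v: "log_rate c v" and u: "log_rate d u"
    and w: "\<forall>\<^sub>F n in sequentially. 0 < w n \<and> ln (w n) = p * ln (v n) + q * ln (u n)"
  shows "log_rate (p * c + q * d) w"
proof -
  have "(\<lambda>n. p * (real n * (ln (v n) - ln (v (n - 1)))) + q * (real n * (ln (u n) - ln (u (n - 1)))))
      \<longlonglongrightarrow> p * c + q * d"
    using u v by (intro tendsto_intros) (auto simp: log_rate_def)
  moreover have "\<forall>\<^sub>F n in sequentially. p * (real n * (ln (v n) - ln (v (n - 1)))) +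
      q * (real n * (ln (u n) - ln (u (n - 1)))) = real n * (ln (w n) - ln (w (n - 1)))"
    using w eventually_shift_pred[OF w] by eventually_elim (auto simp: algebra_simps)
  ultimately have "(\<lambda>n. real n * (ln (w n) - ln (w (n - 1)))) \<longlonglongrightarrow> p * c + q * d"
    by (rule Lim_transform_eventually)
  moreover have "\<forall>\<^sub>F n in sequentially. 0 < w n" using w by eventually_elim auto
  ultimately show ?thesis by (simp add: log_rate_def)
qed

lemma log_rate_real: "log_rate 1 real"
proof -
  have "(\<lambda>n::nat. real n * (ln (real n) - ln (real n - 1))) \<longlonglongrightarrow> 1" by real_asymp
  moreover have "\<forall>\<^sub>F n in sequentially. real n * (ln (real n) - ln (real n - 1)) =
      real n * (ln (real n) - ln (real (n - 1)))"
    using eventually_ge_at_top[of 1] by eventually_elim (auto simp: of_nat_diff)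
  ultimately have "(\<lambda>n. real n * (ln (real n) - ln (real (n - 1)))) \<longlonglongrightarrow> 1"
    by (rule Lim_transform_eventually)
  moreover have "\<forall>\<^sub>F n in sequentially. 0 < real n" by real_asymp
  ultimately show ?thesis by (auto simp: log_rate_def)
qed

lemma log_rate_ln: "log_rate 0 (\<lambda>n. ln (real n))"
proof -
  have "(\<lambda>n::nat. real n * (ln (ln (real n)) - ln (ln (real n - 1)))) \<longlonglongrightarrow> 0" by real_asymp
  moreover have "\<forall>\<^sub>F n in sequentially. real n * (ln (ln (real n)) - ln (ln (real n - 1))) =
      real n * (ln (ln (real n)) - ln (ln (real (n - 1))))"
    using eventually_ge_at_top[of 1] by eventually_elim (auto simp: of_nat_diff)
  ultimately have "(\<lambda>n. real n * (ln (ln (real n)) - ln (ln (real (n - 1))))) \<longlonglongrightarrow> 0"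
    by (rule Lim_transform_eventually)
  moreover have "\<forall>\<^sub>F n in sequentially. 0 < ln (real n)" by real_asymp
  ultimately show ?thesis by (auto simp: log_rate_def)
qed

text \<open>A sequence of positive rate is eventually increasing.\<close>

lemma log_rate_pos_bounded_below:
  assumes "log_rate c v" "0 < c"
  shows "\<exists>\<epsilon>>0. \<forall>\<^sub>F n in sequentially. \<epsilon> \<le> v n"
proof -
  have "\<forall>\<^sub>F n in sequentially. 0 < real n * (ln (v n) - ln (v (n - 1)))"
    using assms order_tendstoD(1) by (fastforce simp: log_rate_def)
  moreover have pos: "\<forall>\<^sub>F n in sequentially. 0 < v n" using assms by (simp add: log_rate_def)
  ultimately have "\<forall>\<^sub>F n in sequentially. 0 < v n \<and> 0 < v (n - 1) \<and> 0 < real n * (ln (v n) - ln (v (n - 1)))"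
    using eventually_shift_pred[OF pos] by eventually_elim auto
  then obtain N where N: "\<And>n. n \<ge> N \<Longrightarrow> 0 < v n \<and> 0 < v (n - 1) \<and> 0 < real n * (ln (v n) - ln (v (n - 1)))"
    by (auto simp: eventually_sequentially)
  have step: "v n \<le> v (Suc n)" if "n \<ge> N" for n
  proof -
    have "0 < ln (v (Suc n)) - ln (v n)" using N[of "Suc n"] that by (auto simp: zero_less_mult_iff)
    thus ?thesis using N[of "Suc n"] that by (auto simp: ln_less_cancel_iff)
  qed
  have "v N \<le> v n" if "n \<ge> N" for n
    using that by (induction n rule: dec_induct) (auto intro: step order.trans)
  thus ?thesis using N[of N] by (auto simp: eventually_sequentially)
qed

text \<open>Half of the decay is split off as a power of \<open>n\<close>; what remains stays bounded.\<close>

lemma log_rate_neg_tendsto_0: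
  assumes v: "log_rate c v" "c < 0"
  shows "v \<longlonglongrightarrow> 0"
proof -
  define w where "w n = inverse (v n) * real n powr (c / 2)" for n
  have pos: "\<forall>\<^sub>F n in sequentially. 0 < v n" using v by (simp add: log_rate_def)
  have "log_rate ((-1) * c + (c / 2) * 1) w"
  proof (rule log_rate_combine[OF v(1) log_rate_real])
    show "\<forall>\<^sub>F n in sequentially. 0 < w n \<and> ln (w n) = -1 * ln (v n) + c / 2 * ln (real n)"
      using pos eventually_gt_at_top[of 0]
      by eventually_elim (auto simp: w_def ln_mult ln_inverse ln_powr)
  qed
  then obtain \<epsilon> where "\<epsilon> > 0" and \<epsilon>: "\<forall>\<^sub>F n in sequentially. \<epsilon> \<le> w n"
    using log_rate_pos_bounded_below[of _ w] v(2) by force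
  have lim: "(\<lambda>n. real n powr (c / 2) / \<epsilon>) \<longlonglongrightarrow> 0 / \<epsilon>"
    using v(2) \<open>\<epsilon> > 0\<close>
    by (intro tendsto_divide tendsto_neg_powr filterlim_real_sequentially) auto
  show ?thesis
  proof (rule Lim_null_comparison)
    show "(\<lambda>n. real n powr (c / 2) / \<epsilon>) \<longlonglongrightarrow> 0" using lim by simp
    show "\<forall>\<^sub>F n in sequentially. norm (v n) \<le> real n powr (c / 2) / \<epsilon>"
      using pos \<epsilon>
    proof eventually_elim
      case (elim n)
      have "\<epsilon> * v n \<le> w n * v n" using elim by (intro mult_right_mono) auto
      also have "\<dots> = real n powr (c / 2)" using elim by (simp add: w_def)
      finally show ?case using elim \<open>\<epsilon> > 0\<close> by (simp add: field_simps)
    qed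
  qed
qed

text \<open>The role of the lower bound on \<open>lim n * \<gamma> n\<close>: a contraction by \<open>1 - \<phi>2 * \<gamma> n\<close>, with \<open>\<phi>2\<close> still below
  \<open>\<phi>\<close>, absorbs the growth of a sequence of rate \<open>s\<close>. The limit may be infinite.\<close>

lemma gain_beats_decay:
  assumes u: "log_rate s u" and s: "0 < s" and \<phi>: "0 < \<phi>"
    and L: "(\<lambda>n. ereal (real n * \<gamma> n)) \<longlonglongrightarrow> L" "ereal (s / \<phi>) < L"
  shows "\<exists>\<phi>2<\<phi>. (\<forall>\<^sub>F n in sequentially. ln (u n) - ln (u (n - 1)) \<le> \<phi>2 * \<gamma> n)"
proof -
  obtain l where l: "s / \<phi> < l" "ereal l < L" using ereal_dense2[OF L(2)] by auto
  have l0: "0 < l" using l(1) s \<phi> by (meson divide_pos_pos order.strict_trans)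
  have sl: "s / l < \<phi>" using l(1) l0 \<phi> by (simp add: field_simps)
  obtain \<phi>2 where \<phi>2: "s / l < \<phi>2" "\<phi>2 < \<phi>" using dense[OF sl] by blast
  have \<phi>20: "0 < \<phi>2" using \<phi>2(1) s l0 by (meson divide_pos_pos order.strict_trans)
  have s': "s < \<phi>2 * l" using \<phi>2(1) l0 by (simp add: field_simps)
  have "\<forall>\<^sub>F n in sequentially. real n * (ln (u n) - ln (u (n - 1))) < \<phi>2 * l"
    by (rule order_tendstoD(2)[OF _ s']) (use u in \<open>simp add: log_rate_def\<close>)
  moreover have "\<forall>\<^sub>F n in sequentially. ereal l < ereal (real n * \<gamma> n)"
    using order_tendstoD(1)[OF L(1) l(2)] .
  ultimately have "\<forall>\<^sub>F n in sequentially. ln (u n) - ln (u (n - 1)) \<le> \<phi>2 * \<gamma> n"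
    using eventually_gt_at_top[of 0]
  proof eventually_elim
    case (elim n)
    have "real n * (ln (u n) - ln (u (n - 1))) \<le> \<phi>2 * (real n * \<gamma> n)"
    proof -
      have "\<phi>2 * l \<le> \<phi>2 * (real n * \<gamma> n)" using elim \<phi>20 by (intro mult_left_mono) auto
      thus ?thesis using elim(1) by linarith
    qed
    also have "\<dots> = real n * (\<phi>2 * \<gamma> n)" by simp
    finally show ?case using elim(3) by (simp only: mult_le_cancel_left_pos of_nat_0_less_iff)
  qed
  thus ?thesis using \<phi>2 by blast
qed

section \<open>Taylor expansion of partial moments and kernel smoothing\<close>

text \<open>The absolute value \<open>\<bar>s - u\<bar>\<close> serves both orders of \<open>s\<close> and \<open>x\<close>: for \<open>s < x\<close> the sign of
  \<open>s - u\<close> compensates for the reversed orientation of the integral.\<close>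

lemma taylor_integral_remainder_fst:
  assumes g: "twice_cont_diff_fst g"
  shows "g s t = g x t + (s - x) * D1 g x t +
    (\<integral>u. indicator {min s x..max s x} u * \<bar>s - u\<bar> * D2 g u t \<partial>lborel)"
proof -
  define F where "F u = (s - u) * D1 g u t + g u t" for u
  have d1: "((\<lambda>u. g u t) has_real_derivative D1 g u t) (at u)" for u
    using g unfolding twice_cont_diff_fst_def D1_def by (metis DERIV_deriv_iff_field_differentiable)
  have d2: "((\<lambda>u. D1 g u t) has_real_derivative D2 g u t) (at u)" for u
    using g unfolding twice_cont_diff_fst_def D2_def D1_def[of "D1 g"]
    by (metis DERIV_deriv_iff_field_differentiable)
  have F: "(F has_real_derivative (s - u) * D2 g u t) (at u)" for u
    unfolding F_def by (rule derivative_eq_intros d1 d2 refl | simp)+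
  have c: "isCont (\<lambda>u. (s - u) * D2 g u t) u" for u
    using g by (intro continuous_intros) (auto simp: twice_cont_diff_fst_def continuous_on_eq_continuous_at)
  show ?thesis
  proof (cases "x \<le> s")
    case True
    have "(\<integral>u. (s - u) * D2 g u t * indicator {x..s} u \<partial>lborel) = F s - F x"
      by (rule integral_FTC_Icc_real[OF True F c])
    moreover have "(\<integral>u. indicator {min s x..max s x} u * \<bar>s - u\<bar> * D2 g u t \<partial>lborel) =
        (\<integral>u. (s - u) * D2 g u t * indicator {x..s} u \<partial>lborel)"
      using True by (intro Bochner_Integration.integral_cong) (auto simp: indicator_def)
    ultimately show ?thesis by (simp add: F_def algebra_simps)
  next
    case False
    hence le: "s \<le> x" by simp
    have "(\<integral>u. (s - u) * D2 g u t * indicator {s..x} u \<partial>lborel) = F x - F s"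
      by (rule integral_FTC_Icc_real[OF le F c])
    moreover have "(\<integral>u. indicator {min s x..max s x} u * \<bar>s - u\<bar> * D2 g u t \<partial>lborel) =
        - (\<integral>u. (s - u) * D2 g u t * indicator {s..x} u \<partial>lborel)"
      unfolding Bochner_Integration.integral_minus[symmetric]
      using le by (intro Bochner_Integration.integral_cong) (auto simp: indicator_def algebra_simps)
    ultimately show ?thesis by (simp add: F_def algebra_simps)
  qed
qed

text \<open>The remainder at fixed \<open>t\<close> is integrated over \<open>t\<close>, and by Fubini's theorem the integral over \<open>t\<close>
  may be taken first. So the constant is the bound on \<open>\<integral> t ^ q * D2 g u t dt\<close>; absolute
  moments of \<open>D2 g\<close> serve only to justify the exchange.\<close>

lemma partial_moment_taylor:
  fixes q :: nat
  assumes g: "twice_cont_diff_fst g"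
    and q: "q \<in> {0, 1}"
    and g0: "\<And>s. integrable lborel (\<lambda>t. t ^ q * g s t)"
    and g1: "integrable lborel (\<lambda>t. t ^ q * D1 g x t)"
    and g2: "\<And>s. \<bar>\<integral>t. t ^ q * D2 g s t \<partial>lborel\<bar> \<le> C"
    and loc: "D2_loc_integrable g"
  shows "\<bar>(\<integral>t. t ^ q * g s t \<partial>lborel) - (\<integral>t. t ^ q * g x t \<partial>lborel)
            - (s - x) * (\<integral>t. t ^ q * D1 g x t \<partial>lborel)\<bar> \<le> C * (s - x)\<^sup>2"
proof -
  define l r b where "l = min s x" and "r = max s x" and "b = max \<bar>s\<bar> \<bar>x\<bar>"
  have lr: "l \<le> r" "r - l = \<bar>s - x\<bar>" by (auto simp: l_def r_def)
  have lb: "{l..r} \<subseteq> {-b..b}" by (auto simp: l_def r_def b_def)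
  define H where "H = (\<lambda>p::real\<times>real. indicator ({-b..b} \<times> UNIV) p * (snd p ^ q * D2 g (fst p) (snd p)))"
  have H: "integrable lborel H"
    using loc[unfolded D2_loc_integrable_def, rule_format, OF q, of b]
    by (simp add: set_integrable_def H_def case_prod_beta)
  have Hm[measurable]: "H \<in> borel_measurable (lborel \<Otimes>\<^sub>M lborel)"
    using H by (simp add: lborel_prod borel_measurable_integrable)
  define f where "f = (\<lambda>u t. indicator {l..r} u * \<bar>s - u\<bar> * H (u, t))"
  have f_eq: "f u t = indicator {l..r} u * \<bar>s - u\<bar> * (t ^ q * D2 g u t)" for u t
    using lb by (auto simp: f_def H_def indicator_def)
  have f_int: "integrable (lborel \<Otimes>\<^sub>M lborel) (case_prod f)"
  proof (rule Bochner_Integration.integrable_bound)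
    show "integrable (lborel \<Otimes>\<^sub>M lborel) (\<lambda>p. (r - l) * H p)" using H by (simp add: lborel_prod)
    show "case_prod f \<in> borel_measurable (lborel \<Otimes>\<^sub>M lborel)"
      unfolding f_def by measurable
    have "norm (f u t) \<le> norm ((r - l) * H (u, t))" for u t
    proof (cases "u \<in> {l..r}")
      case True
      hence "\<bar>s - u\<bar> \<le> r - l" by (auto simp: l_def r_def)
      thus ?thesis using True lr by (auto simp: f_def abs_mult intro!: mult_right_mono)
    qed (auto simp: f_def)
    thus "AE p in lborel \<Otimes>\<^sub>M lborel. norm (case_prod f p) \<le> norm ((r - l) * H p)"
      by (auto simp: case_prod_beta)
  qed
  have inner: "(\<integral>t. f u t \<partial>lborel) = indicator {l..r} u * \<bar>s - u\<bar> * (\<integral>t. t ^ q * D2 g u t \<partial>lborel)" for u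
    by (simp add: f_eq)
  have sw: "(\<integral>t. (\<integral>u. f u t \<partial>lborel) \<partial>lborel) = (\<integral>u. (\<integral>t. f u t \<partial>lborel) \<partial>lborel)"
    by (rule lborel_pair.Fubini_integral[OF f_int])
  have ptw: "(\<integral>u. f u t \<partial>lborel) = t ^ q * g s t - t ^ q * g x t - (s - x) * (t ^ q * D1 g x t)" for t
  proof -
    have "(\<integral>u. f u t \<partial>lborel) = (\<integral>u. t ^ q * (indicator {l..r} u * \<bar>s - u\<bar> * D2 g u t) \<partial>lborel)"
      by (intro Bochner_Integration.integral_cong) (auto simp: f_eq)
    also have "\<dots> = t ^ q * (\<integral>u. indicator {l..r} u * \<bar>s - u\<bar> * D2 g u t \<partial>lborel)" by simp
    also have "(\<integral>u. indicator {l..r} u * \<bar>s - u\<bar> * D2 g u t \<partial>lborel) = g s t - g x t - (s - x) * D1 g x t"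
      using taylor_integral_remainder_fst[OF g, of s t x] by (simp add: l_def r_def)
    finally show ?thesis by (simp add: algebra_simps)
  qed
  have "(\<integral>t. t ^ q * g s t \<partial>lborel) - (\<integral>t. t ^ q * g x t \<partial>lborel)
      - (s - x) * (\<integral>t. t ^ q * D1 g x t \<partial>lborel) = (\<integral>t. (\<integral>u. f u t \<partial>lborel) \<partial>lborel)"
    unfolding ptw using g0[of s] g0[of x] g1 by simp
  also have "\<dots> = (\<integral>u. (\<integral>t. f u t \<partial>lborel) \<partial>lborel)" by (rule sw)
  finally have eq: "(\<integral>t. t ^ q * g s t \<partial>lborel) - (\<integral>t. t ^ q * g x t \<partial>lborel)
      - (s - x) * (\<integral>t. t ^ q * D1 g x t \<partial>lborel) = (\<integral>u. (\<integral>t. f u t \<partial>lborel) \<partial>lborel)" .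
  have C: "0 \<le> C" using g2[of 0] by linarith
  have "norm (\<integral>u. (\<integral>t. f u t \<partial>lborel) \<partial>lborel) \<le> (\<integral>u. indicator {l..r} u * ((r - l) * C) \<partial>lborel)"
  proof (rule Bochner_Integration.integral_norm_bound_integral)
    show "integrable lborel (\<lambda>u. \<integral>t. f u t \<partial>lborel)" by (rule lborel_pair.integrable_fst[OF f_int])
    show "integrable lborel (\<lambda>u. indicator {l..r} u * ((r - l) * C))"
      using lr by (intro integrable_mult_left integrable_real_indicator) auto
    fix u :: real
    show "norm (\<integral>t. f u t \<partial>lborel) \<le> indicator {l..r} u * ((r - l) * C)"
    proof (cases "u \<in> {l..r}")
      case True
      hence "\<bar>s - u\<bar> \<le> r - l" by (auto simp: l_def r_def)
      thus ?thesis using True g2[of u] lr unfolding inner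
        by (auto simp: abs_mult intro!: mult_mono)
    qed (auto simp: inner)
  qed
  also have "\<dots> = C * (s - x)\<^sup>2" using lr by (simp add: power2_eq_square abs_mult_self_eq algebra_simps)
  finally show ?thesis unfolding eq by simp
qed

text \<open>Substituting \<open>s = x - h * z\<close>, the constant term of \<open>G\<close> reproduces \<open>G x\<close>, the linear term vanishes by the
  mean zero condition on \<open>K\<close>, and the quadratic remainder costs the second moment of \<open>K\<close>.\<close>

lemma kernel_smoothing:
  fixes K G :: "real \<Rightarrow> real"
  assumes K0: "has_bochner_integral lborel K 1"
    and K1: "has_bochner_integral lborel (\<lambda>z. z * K z) 0"
    and K2: "integrable lborel (\<lambda>z. z\<^sup>2 * K z)"
    and Kn: "\<And>z. 0 \<le> K z"
    and G[measurable]: "G \<in> borel_measurable borel"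
    and T: "\<And>s. \<bar>G s - G x - (s - x) * G1\<bar> \<le> C * (s - x)\<^sup>2"
    and h: "0 < h"
  shows "\<bar>(\<integral>s. inverse h * K ((x - s) / h) * G s \<partial>lborel) - G x\<bar>
           \<le> C * h\<^sup>2 * (\<integral>z. z\<^sup>2 * K z \<partial>lborel)"
proof -
  have [measurable]: "K \<in> borel_measurable borel" using K0 by (auto simp: has_bochner_integral_iff)
  have iK: "integrable lborel K" "integrable lborel (\<lambda>z. z * K z)"
    using K0 K1 by (auto simp: has_bochner_integral_iff)
  define R where "R z = K z * (G (x + (-h) * z) - G x - (-h * z) * G1)" for z
  have Rb: "\<bar>R z\<bar> \<le> C * h\<^sup>2 * (z\<^sup>2 * K z)" for z
  proof -
    have "\<bar>R z\<bar> \<le> K z * (C * (-h * z)\<^sup>2)"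
      unfolding R_def using T[of "x + (-h)*z"] Kn[of z]
      by (auto simp: abs_mult intro!: mult_left_mono)
    thus ?thesis by (simp add: power_mult_distrib algebra_simps)
  qed
  have Ri: "integrable lborel R"
  proof (rule Bochner_Integration.integrable_bound)
    show "integrable lborel (\<lambda>z. C * h\<^sup>2 * (z\<^sup>2 * K z))" using K2 by simp
    show "R \<in> borel_measurable lborel" unfolding R_def by measurable
    show "AE z in lborel. norm (R z) \<le> norm (C * h\<^sup>2 * (z\<^sup>2 * K z))"
      using order_trans[OF Rb abs_ge_self] by (intro AE_I2) simp
  qed
  have dec: "K z * G (x + (-h) * z) = R z + G x * K z - h * G1 * (z * K z)" for z
    by (simp add: R_def algebra_simps)
  have tr: "inverse h * K ((x - (x + (-h) * z)) / h) * G (x + (-h) * z)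
      = inverse h * (K z * G (x + (-h) * z))" for z using h by simp
  have "(\<integral>s. inverse h * K ((x - s) / h) * G s \<partial>lborel) =
      \<bar>-h\<bar> *\<^sub>R (\<integral>z. inverse h * (K z * G (x + (-h) * z)) \<partial>lborel)"
    using h by (subst lborel_integral_real_affine[where c="-h" and t=x]) (auto simp only: tr)
  also have "\<dots> = (\<integral>z. K z * G (x + (-h) * z) \<partial>lborel)" using h by simp
  also have "\<dots> = (\<integral>z. R z \<partial>lborel) + G x"
    unfolding dec using Ri iK K0 K1 by (simp add: has_bochner_integral_iff)
  finally have "\<bar>(\<integral>s. inverse h * K ((x - s) / h) * G s \<partial>lborel) - G x\<bar> = norm (\<integral>z. R z \<partial>lborel)" by simp
  also have "\<dots> \<le> (\<integral>z. C * h\<^sup>2 * (z\<^sup>2 * K z) \<partial>lborel)"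
    by (rule Bochner_Integration.integral_norm_bound_integral) (use Ri K2 Rb in auto)
  also have "\<dots> = C * h\<^sup>2 * (\<integral>z. z\<^sup>2 * K z \<partial>lborel)" by simp
  finally show ?thesis .
qed

lemma kernel_total_mass:
  assumes K0: "has_bochner_integral lborel K (1::real)" and h: "0 < h"
  shows "integrable lborel (\<lambda>s. inverse h * K ((x - s) / h))"
    and "(\<integral>s. inverse h * K ((x - s) / h) \<partial>lborel) = (1::real)"
proof -
  have tr: "inverse h * K ((x - (x + (-h) * z)) / h) = inverse h * K z" for z using h by simp
  have K: "integrable lborel K" "(\<integral>z. K z \<partial>lborel) = 1" using K0 by (auto simp: has_bochner_integral_iff)
  show "integrable lborel (\<lambda>s. inverse h * K ((x - s) / h))"
    using lborel_integrable_real_affine_iff[of "-h" "\<lambda>s. inverse h * K ((x - s) / h)" x] h K unfolding tr by simp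
  have "(\<integral>s. inverse h * K ((x - s) / h) \<partial>lborel) = \<bar>-h\<bar> *\<^sub>R (\<integral>z. inverse h * K z \<partial>lborel)"
    using h by (subst lborel_integral_real_affine[where c="-h" and t=x]) (auto simp only: tr)
  thus "(\<integral>s. inverse h * K ((x - s) / h) \<partial>lborel) = 1" using h K by simp
qed

section \<open>Relaxed averages\<close>

text \<open>A relaxed average of the data \<open>u\<close> with weights \<open>w\<close>. The free starting time \<open>m\<close> allows an initial segment of
  the data to be discarded without renumbering the rest.\<close>

primrec relax :: "(nat \<Rightarrow> real) \<Rightarrow> (nat \<Rightarrow> real) \<Rightarrow> nat \<Rightarrow> real \<Rightarrow> nat \<Rightarrow> real" where
  "relax w u m q 0 = q"
| "relax w u m q (Suc n) = (if Suc n \<le> m then q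
     else relax w u m q n + w (Suc n) * (u (Suc n) - relax w u m q n))"

lemma relax_start: "n \<le> m \<Longrightarrow> relax w u m q n = q"
  by (cases n) auto

lemma relax_cong:
  assumes "\<And>k. m < k \<Longrightarrow> k \<le> n \<Longrightarrow> w k = w' k \<and> u k = u' k"
  shows "relax w u m q n = relax w' u' m q n"
  using assms
proof (induction n)
  case (Suc n)
  have "relax w u m q n = relax w' u' m q n" by (rule Suc.IH) (use Suc.prems in auto)
  thus ?case using Suc.prems[of "Suc n"] by auto
qed auto

lemma relax_restart:
  assumes "m \<le> n"
  shows "relax w u 0 q n = relax w u m (relax w u 0 q m) n"
  using assms by (induction n rule: dec_induct) (auto simp: relax_start)

text \<open>Control of the starting values \<open>0\<close> and \<open>1\<close> therefore controls all starting values, including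
  random ones.\<close>

lemma relax_affine:
  "relax w u m q n = relax w u m 0 n + q * (relax w u m 1 n - relax w u m 0 n)"
proof (induction n)
  case (Suc n)
  show ?case
  proof (cases "Suc n \<le> m")
    case False
    have "relax w u m q (Suc n) = (1 - w (Suc n)) * relax w u m q n + w (Suc n) * u (Suc n)"
      using False by (simp add: algebra_simps)
    also have "\<dots> = relax w u m 0 (Suc n) + q * (relax w u m 1 (Suc n) - relax w u m 0 (Suc n))"
      unfolding Suc.IH using False by (simp add: algebra_simps)
    finally show ?thesis .
  qed auto
qed auto

text \<open>Each step is a convex combination.\<close>

lemma relax_abs_le:
  assumes "\<And>k. m < k \<Longrightarrow> k \<le> n \<Longrightarrow> 0 \<le> w k \<and> w k \<le> 1"
    and "\<And>k. m < k \<Longrightarrow> k \<le> n \<Longrightarrow> \<bar>u k\<bar> \<le> b" and "\<bar>q\<bar> \<le> b"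
  shows "\<bar>relax w u m q n\<bar> \<le> b"
  using assms
proof (induction n)
  case (Suc n)
  have IH: "\<bar>relax w u m q n\<bar> \<le> b" by (rule Suc.IH) (use Suc.prems in auto)
  show ?case
  proof (cases "Suc n \<le> m")
    case False
    let ?w = "w (Suc n)" and ?r = "relax w u m q n"
    have w: "0 \<le> ?w" "?w \<le> 1" and u: "\<bar>u (Suc n)\<bar> \<le> b" using Suc.prems(1,2)[of "Suc n"] False by auto
    have "relax w u m q (Suc n) = (1 - ?w) * ?r + ?w * u (Suc n)" using False by (simp add: algebra_simps)
    also have "\<bar>\<dots>\<bar> \<le> \<bar>(1 - ?w) * ?r\<bar> + \<bar>?w * u (Suc n)\<bar>" by (rule abs_triangle_ineq)
    also have "\<dots> = (1 - ?w) * \<bar>?r\<bar> + ?w * \<bar>u (Suc n)\<bar>" using w by (simp add: abs_mult)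
    also have "\<dots> \<le> (1 - ?w) * b + ?w * b" using w u IH by (intro add_mono mult_left_mono) auto
    also have "\<dots> = b" by (simp add: algebra_simps)
    finally show ?thesis .
  qed (use Suc.prems in auto)
qed auto

text \<open>In step \<open>k\<close> the difference of the two averages is multiplied by \<open>1 - w k\<close> and receives \<open>w k - w' k\<close> times
  a difference of two numbers of size at most \<open>b\<close>.\<close>

lemma relax_weights_lipschitz:
  assumes "\<And>k. m < k \<Longrightarrow> k \<le> n \<Longrightarrow> 0 \<le> w k \<and> w k \<le> 1"
    and "\<And>k. m < k \<Longrightarrow> k \<le> n \<Longrightarrow> 0 \<le> w' k \<and> w' k \<le> 1"
    and "\<And>k. m < k \<Longrightarrow> k \<le> n \<Longrightarrow> \<bar>w k - w' k\<bar> \<le> \<delta>" and "0 \<le> \<delta>"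
    and "\<And>k. m < k \<Longrightarrow> k \<le> n \<Longrightarrow> \<bar>u k\<bar> \<le> b" and "\<bar>q\<bar> \<le> b"
  shows "\<bar>relax w u m q n - relax w' u m q n\<bar> \<le> real n * (\<delta> * (2 * b))"
  using assms
proof (induction n)
  case (Suc n)
  have b: "0 \<le> b" using Suc.prems(6) by linarith
  let ?r = "relax w u m q n" and ?r' = "relax w' u m q n"
  have IH: "\<bar>?r - ?r'\<bar> \<le> real n * (\<delta> * (2 * b))" by (rule Suc.IH) (use Suc.prems in auto)
  show ?case
  proof (cases "Suc n \<le> m")
    case False
    have r': "\<bar>?r'\<bar> \<le> b" by (rule relax_abs_le) (use Suc.prems in auto)
    have w: "0 \<le> w (Suc n)" "w (Suc n) \<le> 1" and u: "\<bar>u (Suc n)\<bar> \<le> b"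
      and d: "\<bar>w (Suc n) - w' (Suc n)\<bar> \<le> \<delta>"
      using Suc.prems(1)[of "Suc n"] Suc.prems(3)[of "Suc n"] Suc.prems(5)[of "Suc n"] False by auto
    have "relax w u m q (Suc n) - relax w' u m q (Suc n) =
        (1 - w (Suc n)) * (?r - ?r') + (w (Suc n) - w' (Suc n)) * (u (Suc n) - ?r')"
      using False by (simp add: algebra_simps)
    also have "\<bar>\<dots>\<bar> \<le> \<bar>(1 - w (Suc n)) * (?r - ?r')\<bar> + \<bar>(w (Suc n) - w' (Suc n)) * (u (Suc n) - ?r')\<bar>"
      by (rule abs_triangle_ineq)
    also have "\<dots> \<le> 1 * \<bar>?r - ?r'\<bar> + \<delta> * (2 * b)"
      unfolding abs_mult using w d u r' by (intro add_mono mult_mono) auto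
    also have "\<dots> \<le> real (Suc n) * (\<delta> * (2 * b))" using IH by (simp add: algebra_simps)
    finally show ?thesis .
  qed (use Suc.prems b in auto)
qed auto

section \<open>Exponential moments and independence\<close>

lemma exp_le_quadratic:
  fixes x :: real
  assumes "x \<le> 1"
  shows "exp x \<le> 1 + x + x\<^sup>2"
proof (cases "0 \<le> x")
  case True
  thus ?thesis using exp_bound[of x] assms by simp
next
  case False
  define y where "y = - x"
  have y: "y > 0" using False by (simp add: y_def)
  have "1 + y + y\<^sup>2 / 2 \<le> exp y" using y by (intro exp_lower_Taylor_quadratic) auto
  moreover have pos: "0 < 1 + y + y\<^sup>2 / 2" using y by (simp add: add_pos_nonneg)
  ultimately have "exp x \<le> 1 / (1 + y + y\<^sup>2 / 2)"
    by (simp add: y_def exp_minus field_simps)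
  also have "\<dots> \<le> 1 + x + x\<^sup>2"
  proof -
    have "(1 - y + y\<^sup>2) * (1 + y + y\<^sup>2 / 2) = 1 + y\<^sup>2 / 2 + y ^ 3 / 2 + y ^ 4 / 2"
      by (simp add: field_simps power2_eq_square power3_eq_cube power4_eq_xxxx)
    moreover have "\<dots> \<ge> 1" using y by simp
    ultimately show ?thesis using pos by (simp add: y_def pos_divide_le_eq)
  qed
  finally show ?thesis .
qed

text \<open>One step of the recursion, from the fixed value \<open>\<rho>\<close>, for the estimation of \<open>r\<close>; \<open>\<theta>\<close> and \<open>\<theta>'\<close> are the exponents
  after and before the step. If \<open>\<theta> * \<bar>\<rho> - r\<bar> \<le> T\<close>, the claim holds since a step changes the exponent by
  at most \<open>1\<close>. Otherwise the error keeps its sign during the step, so that \<open>\<bar>\<rho> - r + \<gamma> * V\<bar>\<close> is linear in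
  the increment \<open>V\<close>, and \<open>exp z \<le> 1 + z + z\<^sup>2\<close> reduces the expectation to the mean and the second moment of \<open>V\<close>.
  The inward drift \<open>\<gamma> * \<phi> * \<bar>\<rho> - r\<bar>\<close> pays for three things: a part \<open>\<epsilon>\<close> for the bias and the constant part
  of the second moment (because \<open>T\<close> is large), a part \<open>\<epsilon>\<close> for the part of the second moment that is
  quadratic in the error (because steps are small), and the rest for the growth from \<open>\<theta>'\<close> to \<open>\<theta>\<close>.\<close>

lemma (in prob_space) drift_step:
  fixes Z U :: "'a \<Rightarrow> real"
  assumes [measurable]: "Z \<in> borel_measurable M" "U \<in> borel_measurable M"
    and Z: "\<And>\<omega>. 0 \<le> Z \<omega>" "\<And>\<omega>. Z \<omega> \<le> z" and U: "\<And>\<omega>. \<bar>U \<omega>\<bar> \<le> b"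
    and \<rho>: "\<bar>\<rho>\<bar> \<le> b" and r: "\<bar>r\<bar> \<le> R" "R \<le> b"
    and \<gamma>: "0 \<le> \<gamma>" and \<theta>: "0 < \<theta>"
    and small: "2 * \<theta> * \<gamma> * z * b \<le> 1"
    and mean: "\<phi> \<le> expectation Z" "\<bar>expectation (\<lambda>\<omega>. Z \<omega> * (U \<omega> - r))\<bar> \<le> \<beta>"
    and sec: "expectation (\<lambda>\<omega>. (Z \<omega>)\<^sup>2) \<le> S" "expectation (\<lambda>\<omega>. (Z \<omega> * U \<omega>)\<^sup>2) \<le> S"
    and sm: "8 * \<theta> * \<gamma> * S * b \<le> \<epsilon>"
    and H: "\<theta> * \<beta> + 2 * \<theta>\<^sup>2 * \<gamma> * S * (1 + 2 * R\<^sup>2) \<le> \<epsilon> * T" and T: "1 \<le> T"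
    and contr: "\<theta> * (1 - \<gamma> * (\<phi> - 2 * \<epsilon>)) \<le> \<theta>'"
  shows "expectation (\<lambda>\<omega>. exp (\<theta> * \<bar>\<rho> + \<gamma> * (Z \<omega> * (U \<omega> - \<rho>)) - r\<bar>))
           \<le> exp (\<theta>' * \<bar>\<rho> - r\<bar>) + exp (T + 1)"
proof -
  define e where "e = \<rho> - r"
  define V where "V \<omega> = Z \<omega> * (U \<omega> - \<rho>)" for \<omega>
  have [measurable]: "V \<in> borel_measurable M" unfolding V_def by measurable
  have b0: "0 \<le> b" using \<rho> by linarith
  have z0: "0 \<le> z" using Z[of undefined] by linarith
  have eb: "\<bar>e\<bar> \<le> 2 * b" using \<rho> r by (auto simp: e_def)
  have Vb: "\<bar>V \<omega>\<bar> \<le> z * (2 * b)" for \<omega>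
    unfolding V_def abs_mult using Z[of \<omega>] U[of \<omega>] \<rho> z0 by (intro mult_mono) auto
  have step_small: "\<bar>\<theta> * \<gamma> * V \<omega>\<bar> \<le> 1" for \<omega>
  proof -
    have "\<bar>\<theta> * \<gamma> * V \<omega>\<bar> = \<theta> * \<gamma> * \<bar>V \<omega>\<bar>" using \<theta> \<gamma> by (simp add: abs_mult)
    also have "\<dots> \<le> \<theta> * \<gamma> * (z * (2 * b))" using \<theta> \<gamma> Vb by (intro mult_left_mono) auto
    finally show ?thesis using small by (simp add: algebra_simps)
  qed
  have up: "\<theta> * \<bar>e + \<gamma> * V \<omega>\<bar> \<le> \<theta> * \<bar>e\<bar> + 1" for \<omega>
  proof -
    have "\<theta> * \<bar>e + \<gamma> * V \<omega>\<bar> \<le> \<theta> * (\<bar>e\<bar> + \<bar>\<gamma> * V \<omega>\<bar>)" using \<theta> by (intro mult_left_mono) auto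
    also have "\<dots> = \<theta> * \<bar>e\<bar> + \<bar>\<theta> * \<gamma> * V \<omega>\<bar>" using \<theta> by (simp add: abs_mult algebra_simps)
    finally show ?thesis using step_small[of \<omega>] by linarith
  qed
  have int: "integrable M (\<lambda>\<omega>. exp (\<theta> * \<bar>e + \<gamma> * V \<omega>\<bar>))"
    by (rule integrable_const_bound[where B="exp (\<theta> * \<bar>e\<bar> + 1)"]) (use up in auto)
  have goal_eq: "exp (\<theta> * \<bar>\<rho> + \<gamma> * (Z \<omega> * (U \<omega> - \<rho>)) - r\<bar>) = exp (\<theta> * \<bar>e + \<gamma> * V \<omega>\<bar>)" for \<omega>
    by (simp add: e_def V_def algebra_simps)
  show ?thesis
  proof (cases "\<theta> * \<bar>e\<bar> \<le> T")
    case True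
    have "expectation (\<lambda>\<omega>. exp (\<theta> * \<bar>e + \<gamma> * V \<omega>\<bar>)) \<le> exp (T + 1)"
    proof (rule integral_le_const[OF int])
      show "AE \<omega> in M. exp (\<theta> * \<bar>e + \<gamma> * V \<omega>\<bar>) \<le> exp (T + 1)"
      proof (intro AE_I2)
        fix \<omega> show "exp (\<theta> * \<bar>e + \<gamma> * V \<omega>\<bar>) \<le> exp (T + 1)"
          using up[of \<omega>] True by simp
      qed
    qed
    moreover have "0 \<le> exp (\<theta>' * \<bar>\<rho> - r\<bar>)" by simp
    ultimately show ?thesis unfolding goal_eq by linarith
  next
    case False
    hence big: "T < \<theta> * \<bar>e\<bar>" by simp
    define \<sigma> where "\<sigma> = sgn e"
    have "e \<noteq> 0" using big T by auto
    hence \<sigma>: "\<sigma> * e = \<bar>e\<bar>" "\<bar>\<sigma>\<bar> = 1" "\<sigma>\<^sup>2 = 1" by (auto simp: \<sigma>_def sgn_if)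
    have ZU: "\<bar>Z \<omega> * (U \<omega> - r)\<bar> \<le> z * (2 * b)" for \<omega>
      unfolding abs_mult using Z[of \<omega>] U[of \<omega>] r z0 by (intro mult_mono) auto
    have iZ: "integrable M Z" by (rule integrable_const_bound[where B=z]) (use Z in auto)
    have iZU: "integrable M (\<lambda>\<omega>. Z \<omega> * (U \<omega> - r))"
      by (rule integrable_const_bound[where B="z * (2 * b)"]) (use ZU in auto)
    have iV: "integrable M V" by (rule integrable_const_bound[where B="z * (2 * b)"]) (use Vb in auto)
    have sqb: "x\<^sup>2 \<le> B\<^sup>2" if "\<bar>x\<bar> \<le> B" for x B :: real using that by (metis abs_ge_zero power2_abs power_mono)
    have iV2: "integrable M (\<lambda>\<omega>. (V \<omega>)\<^sup>2)"
      by (rule integrable_const_bound[where B="(z * (2 * b))\<^sup>2"]) (use sqb[OF Vb] in auto)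
    have iZ2: "integrable M (\<lambda>\<omega>. (Z \<omega>)\<^sup>2)"
      by (rule integrable_const_bound[where B="z\<^sup>2"]) (use Z sqb[of _ z] in auto)
    have iZU2: "integrable M (\<lambda>\<omega>. (Z \<omega> * U \<omega>)\<^sup>2)"
    proof (rule integrable_const_bound[where B="(z * b)\<^sup>2"])
      have "\<bar>Z \<omega> * U \<omega>\<bar> \<le> z * b" for \<omega>
        unfolding abs_mult using Z[of \<omega>] U[of \<omega>] z0 by (intro mult_mono) auto
      from sqb[OF this] show "AE \<omega> in M. norm ((Z \<omega> * U \<omega>)\<^sup>2) \<le> (z * b)\<^sup>2" by auto
    qed auto
    have EV: "expectation V = expectation (\<lambda>\<omega>. Z \<omega> * (U \<omega> - r)) - e * expectation Z"
    proof -
      have "expectation V = expectation (\<lambda>\<omega>. Z \<omega> * (U \<omega> - r) - e * Z \<omega>)"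
        by (intro Bochner_Integration.integral_cong) (auto simp: V_def e_def algebra_simps)
      also have "\<dots> = expectation (\<lambda>\<omega>. Z \<omega> * (U \<omega> - r)) - expectation (\<lambda>\<omega>. e * Z \<omega>)"
        by (rule Bochner_Integration.integral_diff[OF iZU integrable_mult_right[OF iZ]])
      finally show ?thesis by simp
    qed
    have sEV: "\<sigma> * expectation V \<le> \<beta> - \<bar>e\<bar> * \<phi>"
    proof -
      have "\<sigma> * expectation (\<lambda>\<omega>. Z \<omega> * (U \<omega> - r)) \<le> \<bar>\<sigma> * expectation (\<lambda>\<omega>. Z \<omega> * (U \<omega> - r))\<bar>" by simp
      also have "\<dots> \<le> \<beta>" using mean(2) \<sigma>(2) by (simp add: abs_mult)
      finally have "\<sigma> * expectation (\<lambda>\<omega>. Z \<omega> * (U \<omega> - r)) \<le> \<beta>" .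
      moreover have "\<bar>e\<bar> * \<phi> \<le> \<bar>e\<bar> * expectation Z" using mean(1) by (intro mult_left_mono) auto
      moreover have "\<sigma> * expectation V = \<sigma> * expectation (\<lambda>\<omega>. Z \<omega> * (U \<omega> - r)) - \<bar>e\<bar> * expectation Z"
        unfolding EV \<sigma>(1)[symmetric] by (simp add: algebra_simps)
      ultimately show ?thesis by linarith
    qed
    have S0: "0 \<le> S" using order_trans[OF _ sec(1)] by simp
    have EV2: "expectation (\<lambda>\<omega>. (V \<omega>)\<^sup>2) \<le> 2 * S * (1 + 2 * R\<^sup>2) + 4 * S * e\<^sup>2"
    proof -
      have s2: "(x - y)\<^sup>2 \<le> 2 * x\<^sup>2 + 2 * y\<^sup>2" for x y :: real
        using zero_le_power2[of "x + y"] by (simp add: power2_eq_square algebra_simps)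
      have "(V \<omega>)\<^sup>2 \<le> 2 * (Z \<omega> * U \<omega>)\<^sup>2 + 2 * \<rho>\<^sup>2 * (Z \<omega>)\<^sup>2" for \<omega>
        using s2[of "Z \<omega> * U \<omega>" "Z \<omega> * \<rho>"] by (simp add: V_def algebra_simps power_mult_distrib)
      hence "expectation (\<lambda>\<omega>. (V \<omega>)\<^sup>2) \<le> expectation (\<lambda>\<omega>. 2 * (Z \<omega> * U \<omega>)\<^sup>2 + 2 * \<rho>\<^sup>2 * (Z \<omega>)\<^sup>2)"
        using iV2 iZ2 iZU2 by (intro integral_mono) auto
      also have "\<dots> = 2 * expectation (\<lambda>\<omega>. (Z \<omega> * U \<omega>)\<^sup>2) + 2 * \<rho>\<^sup>2 * expectation (\<lambda>\<omega>. (Z \<omega>)\<^sup>2)"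
        using iZ2 iZU2 by simp
      also have "\<dots> \<le> 2 * S + 2 * \<rho>\<^sup>2 * S" using sec by (intro add_mono mult_left_mono) auto
      also have "\<dots> \<le> 2 * S + 2 * (2 * e\<^sup>2 + 2 * R\<^sup>2) * S"
      proof -
        have "\<rho>\<^sup>2 \<le> 2 * e\<^sup>2 + 2 * r\<^sup>2" using s2[of e "- r"] by (simp add: e_def)
        also have "\<dots> \<le> 2 * e\<^sup>2 + 2 * R\<^sup>2" using sqb[OF r(1)] by simp
        finally show ?thesis using S0 by (intro add_mono mult_right_mono mult_left_mono) auto
      qed
      finally show ?thesis by (simp add: algebra_simps)
    qed
    define c where "c = \<theta> * \<gamma>"
    have c0: "0 \<le> c" using \<theta> \<gamma> by (simp add: c_def)
    have ptw: "exp (\<theta> * \<bar>e + \<gamma> * V \<omega>\<bar>) \<le> exp (\<theta> * \<bar>e\<bar>) * (1 + c * \<sigma> * V \<omega> + c\<^sup>2 * (V \<omega>)\<^sup>2)" for \<omega>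
    proof -
      have sV: "\<bar>c * \<sigma> * V \<omega>\<bar> \<le> 1" using step_small[of \<omega>] \<sigma>(2) by (simp add: c_def abs_mult)
      have "\<theta> * (\<sigma> * (e + \<gamma> * V \<omega>)) = \<theta> * \<bar>e\<bar> + c * \<sigma> * V \<omega>"
        unfolding \<sigma>(1)[symmetric] by (simp add: c_def algebra_simps)
      moreover have "\<dots> \<ge> 0" using sV big T by linarith
      ultimately have "0 \<le> \<sigma> * (e + \<gamma> * V \<omega>)" using \<theta> by (metis zero_le_mult_iff not_le)
      hence "\<sigma> * (e + \<gamma> * V \<omega>) = \<bar>e + \<gamma> * V \<omega>\<bar>" using \<sigma>(2) by (metis abs_mult abs_of_nonneg mult_1)
      hence "\<theta> * \<bar>e + \<gamma> * V \<omega>\<bar> = \<theta> * \<bar>e\<bar> + c * \<sigma> * V \<omega>"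
        using \<open>\<theta> * (\<sigma> * (e + \<gamma> * V \<omega>)) = \<theta> * \<bar>e\<bar> + c * \<sigma> * V \<omega>\<close> by simp
      hence "exp (\<theta> * \<bar>e + \<gamma> * V \<omega>\<bar>) = exp (\<theta> * \<bar>e\<bar>) * exp (c * \<sigma> * V \<omega>)" by (simp add: exp_add)
      also have "\<dots> \<le> exp (\<theta> * \<bar>e\<bar>) * (1 + c * \<sigma> * V \<omega> + (c * \<sigma> * V \<omega>)\<^sup>2)"
        using sV by (intro mult_left_mono exp_le_quadratic) auto
      finally show ?thesis using \<sigma>(3) by (simp add: power_mult_distrib)
    qed
    have "expectation (\<lambda>\<omega>. exp (\<theta> * \<bar>e + \<gamma> * V \<omega>\<bar>))
        \<le> expectation (\<lambda>\<omega>. exp (\<theta> * \<bar>e\<bar>) * (1 + c * \<sigma> * V \<omega> + c\<^sup>2 * (V \<omega>)\<^sup>2))"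
      using int iV iV2 ptw by (intro integral_mono) auto
    also have "\<dots> = exp (\<theta> * \<bar>e\<bar>) * (1 + (c * (\<sigma> * expectation V) + c\<^sup>2 * expectation (\<lambda>\<omega>. (V \<omega>)\<^sup>2)))"
      using iV iV2 by (simp add: prob_space)
    also have "\<dots> \<le> exp (\<theta> * \<bar>e\<bar>) * exp (c * (\<sigma> * expectation V) + c\<^sup>2 * expectation (\<lambda>\<omega>. (V \<omega>)\<^sup>2))"
      by (intro mult_left_mono exp_ge_add_one_self) auto
    also have "\<dots> = exp (\<theta> * \<bar>e\<bar> + (c * (\<sigma> * expectation V) + c\<^sup>2 * expectation (\<lambda>\<omega>. (V \<omega>)\<^sup>2)))"
      by (simp add: exp_add)
    also have "\<dots> \<le> exp (\<theta>' * \<bar>e\<bar>)"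
    proof (subst exp_le_cancel_iff)
      have "c * (\<sigma> * expectation V) \<le> c * (\<beta> - \<bar>e\<bar> * \<phi>)"
        using sEV c0 by (rule mult_left_mono)
      moreover have "c\<^sup>2 * expectation (\<lambda>\<omega>. (V \<omega>)\<^sup>2) \<le> c\<^sup>2 * (2 * S * (1 + 2 * R\<^sup>2) + 4 * S * e\<^sup>2)"
        using EV2 by (rule mult_left_mono) simp
      moreover have "c * (\<beta> - \<bar>e\<bar> * \<phi>) + c\<^sup>2 * (2 * S * (1 + 2 * R\<^sup>2) + 4 * S * e\<^sup>2) =
          \<gamma> * (\<theta> * \<beta> + 2 * \<theta>\<^sup>2 * \<gamma> * S * (1 + 2 * R\<^sup>2)) - c * \<bar>e\<bar> * \<phi> + c * \<bar>e\<bar> * (4 * c * S * \<bar>e\<bar>)"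
        by (simp add: c_def power2_eq_square algebra_simps)
      moreover have "\<gamma> * (\<theta> * \<beta> + 2 * \<theta>\<^sup>2 * \<gamma> * S * (1 + 2 * R\<^sup>2)) \<le> c * \<bar>e\<bar> * \<epsilon>"
      proof -
        have \<epsilon>0: "0 \<le> \<epsilon>"
          using order_trans[OF _ sm] \<theta> \<gamma> S0 b0 by simp
        have "\<gamma> * (\<theta> * \<beta> + 2 * \<theta>\<^sup>2 * \<gamma> * S * (1 + 2 * R\<^sup>2)) \<le> \<gamma> * (\<epsilon> * T)"
          using H \<gamma> by (intro mult_left_mono) auto
        also have "\<dots> \<le> \<gamma> * (\<epsilon> * (\<theta> * \<bar>e\<bar>))"
          using big \<gamma> \<epsilon>0 by (intro mult_left_mono) auto
        finally show ?thesis by (simp add: c_def algebra_simps)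
      qed
      moreover have "c * \<bar>e\<bar> * (4 * c * S * \<bar>e\<bar>) \<le> c * \<bar>e\<bar> * \<epsilon>"
      proof (intro mult_left_mono)
        have "4 * c * S * \<bar>e\<bar> \<le> 4 * c * S * (2 * b)" using eb c0 S0 by (intro mult_left_mono) auto
        thus "4 * c * S * \<bar>e\<bar> \<le> \<epsilon>" using sm by (simp add: c_def algebra_simps)
      qed (use c0 in auto)
      moreover have "\<theta> * \<bar>e\<bar> + 2 * (c * \<bar>e\<bar> * \<epsilon>) - c * \<bar>e\<bar> * \<phi> \<le> \<theta>' * \<bar>e\<bar>"
        using mult_right_mono[OF contr, of "\<bar>e\<bar>"] by (simp add: c_def algebra_simps)
      ultimately show "\<theta> * \<bar>e\<bar> + (c * (\<sigma> * expectation V) + c\<^sup>2 * expectation (\<lambda>\<omega>. (V \<omega>)\<^sup>2)) \<le> \<theta>' * \<bar>e\<bar>"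
        by linarith
    qed
    finally show ?thesis unfolding goal_eq e_def[symmetric] using add_increasing2[of "exp (T+1)"] by simp
  qed
qed

text \<open>Conditioning on \<open>A\<close> without conditional expectations: an independent copy of \<open>B\<close> is integrated out first.\<close>

lemma (in prob_space) indep_var_nn_integral_le:
  assumes ind: "indep_var S A T B"
    and F: "case_prod F \<in> borel_measurable (S \<Otimes>\<^sub>M T)"
    and le: "\<And>\<omega>. \<omega> \<in> space M \<Longrightarrow> (\<integral>\<^sup>+\<omega>'. F (A \<omega>) (B \<omega>') \<partial>M) \<le> G \<omega>"
  shows "(\<integral>\<^sup>+\<omega>. F (A \<omega>) (B \<omega>) \<partial>M) \<le> (\<integral>\<^sup>+\<omega>. G \<omega> \<partial>M)"
proof -
  have A[measurable]: "A \<in> measurable M S" and B[measurable]: "B \<in> measurable M T"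
    using ind by (auto dest: indep_var_rv1 indep_var_rv2)
  have AB: "(\<lambda>\<omega>. (A \<omega>, B \<omega>)) \<in> measurable M (S \<Otimes>\<^sub>M T)" by measurable
  interpret D1: prob_space "distr M S A" by (rule prob_space_distr[OF A])
  interpret D2: prob_space "distr M T B" by (rule prob_space_distr[OF B])
  interpret P: pair_sigma_finite "distr M S A" "distr M T B" ..
  have F': "case_prod F \<in> borel_measurable (distr M S A \<Otimes>\<^sub>M distr M T B)" using F by simp
  have Fx: "F (A \<omega>) \<in> borel_measurable T" if "\<omega> \<in> space M" for \<omega>
    using measurable_Pair2[OF F measurable_space[OF A that]] by simp
  have "(\<integral>\<^sup>+\<omega>. F (A \<omega>) (B \<omega>) \<partial>M) = (\<integral>\<^sup>+p. case_prod F p \<partial>distr M (S \<Otimes>\<^sub>M T) (\<lambda>\<omega>. (A \<omega>, B \<omega>)))"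
    using F AB by (subst nn_integral_distr) auto
  also have "\<dots> = (\<integral>\<^sup>+p. case_prod F p \<partial>(distr M S A \<Otimes>\<^sub>M distr M T B))"
    using ind by (simp add: indep_var_distribution_eq)
  also have "\<dots> = (\<integral>\<^sup>+a. \<integral>\<^sup>+b. F a b \<partial>distr M T B \<partial>distr M S A)"
    using D2.nn_integral_fst[OF F'] by simp
  also have "\<dots> = (\<integral>\<^sup>+\<omega>. (\<integral>\<^sup>+b. F (A \<omega>) b \<partial>distr M T B) \<partial>M)"
    by (rule nn_integral_distr[OF A]) (use D2.borel_measurable_nn_integral_fst[OF F'] in simp)
  also have "\<dots> = (\<integral>\<^sup>+\<omega>. (\<integral>\<^sup>+\<omega>'. F (A \<omega>) (B \<omega>') \<partial>M) \<partial>M)"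
    using Fx by (intro nn_integral_cong nn_integral_distr[OF B]) auto
  also have "\<dots> \<le> (\<integral>\<^sup>+\<omega>. G \<omega> \<partial>M)" by (rule nn_integral_mono) (rule le)
  finally show ?thesis .
qed

lemma (in prob_space) exponential_Markov:
  fixes f :: "'a \<Rightarrow> real"
  assumes [measurable]: "f \<in> borel_measurable M"
    and le: "(\<integral>\<^sup>+\<omega>. ennreal (exp (f \<omega>)) \<partial>M) \<le> ennreal b" and b: "0 \<le> b"
  shows "prob {\<omega> \<in> space M. a \<le> f \<omega>} \<le> exp (- a) * b"
proof -
  have "emeasure M {\<omega> \<in> space M. a \<le> f \<omega>} \<le>
      emeasure M {\<omega> \<in> space M. 1 \<le> ennreal (exp (- a)) * ennreal (exp (f \<omega>))}"
    by (intro emeasure_mono) (auto simp: ennreal_mult[symmetric] exp_add[symmetric])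
  also have "\<dots> \<le> ennreal (exp (- a)) * (\<integral>\<^sup>+\<omega>. ennreal (exp (f \<omega>)) * indicator (space M) \<omega> \<partial>M)"
    by (intro nn_integral_Markov_inequality) auto
  also have "(\<integral>\<^sup>+\<omega>. ennreal (exp (f \<omega>)) * indicator (space M) \<omega> \<partial>M) = (\<integral>\<^sup>+\<omega>. ennreal (exp (f \<omega>)) \<partial>M)"
    by (intro nn_integral_cong) auto
  also have "ennreal (exp (- a)) * \<dots> \<le> ennreal (exp (- a)) * ennreal b"
    by (intro mult_left_mono le) auto
  also have "\<dots> = ennreal (exp (- a) * b)" using b by (simp add: ennreal_mult)
  finally show ?thesis using b by (simp add: emeasure_eq_measure)
qed

section \<open>The truncated recursion\<close>

definition trunc :: "real \<Rightarrow> real \<Rightarrow> real" where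
  "trunc b y = (if \<bar>y\<bar> \<le> b then y else 0)"

lemma trunc_abs_le: "0 \<le> b \<Longrightarrow> \<bar>trunc b y\<bar> \<le> b"
  and trunc_abs_le_abs: "\<bar>trunc b y\<bar> \<le> \<bar>y\<bar>"
  by (auto simp: trunc_def)

lemma trunc_measurable[measurable]: "trunc b \<in> borel_measurable borel"
  unfolding trunc_def by measurable

text \<open>Half of the exponential moment turns into the small factor \<open>exp (- t * b / 2)\<close>.\<close>

lemma trunc_error_le_exp:
  assumes "0 < t"
  shows "\<bar>y - trunc b y\<bar> \<le> 2 / t * exp (- t * b / 2) * exp (t * \<bar>y\<bar>)"
proof (cases "\<bar>y\<bar> \<le> b")
  case False
  have "t * \<bar>y\<bar> / 2 \<le> exp (t * \<bar>y\<bar> / 2)" using exp_ge_add_one_self[of "t * \<bar>y\<bar> / 2"] by linarith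
  hence "\<bar>y\<bar> \<le> 2 / t * exp (t * \<bar>y\<bar> / 2)" using assms by (simp add: field_simps)
  also have "\<dots> \<le> 2 / t * (exp (- t * b / 2) * exp (t * \<bar>y\<bar>))"
  proof (rule mult_left_mono)
    have "exp (t * \<bar>y\<bar> / 2) \<le> exp (- t * b / 2 + t * \<bar>y\<bar>)"
      using False assms by (simp add: field_simps)
    thus "exp (t * \<bar>y\<bar> / 2) \<le> exp (- t * b / 2) * exp (t * \<bar>y\<bar>)" by (simp only: exp_add)
  qed (use assms in auto)
  finally show ?thesis using False by (simp add: trunc_def mult.assoc)
qed (use assms in \<open>auto simp: trunc_def\<close>)

lemma fst_snd_borel[measurable]:
  "fst \<in> borel_measurable (borel :: (real \<times> real) measure)"
  "snd \<in> borel_measurable (borel :: (real \<times> real) measure)"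
  by (intro borel_measurable_continuous_onI continuous_intros)+

text \<open>What the almost sure bound needs of the model: the first two moments of the kernel weights up to order \<open>h\<^sup>2\<close>,
  and a rate \<open>v\<close> that dominates both bias and noise and is compatible with the contraction.
  \<open>Kb\<close> and \<open>KL\<close> are an upper bound and a Lipschitz constant of the kernel, \<open>R\<close> and \<open>Lr\<close> those of the
  regression function on the interval; \<open>E1\<close> bounds the exponential moments of the responses.\<close>

locale revesz_rate = prob_space M for M :: "'w measure" +
  fixes X Y :: "nat \<Rightarrow> 'w \<Rightarrow> real" and K r :: "real \<Rightarrow> real" and \<gamma> h v :: "nat \<Rightarrow> real"
    and c d Kb KL R Lr t E1 C \<phi> \<phi>2 c0 \<epsilon>h :: real
  assumes indep: "indep_vars (\<lambda>_. borel) (\<lambda>n \<omega>. (X n \<omega>, Y n \<omega>)) UNIV"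
    and K_meas[measurable]: "K \<in> borel_measurable borel"
    and K_nonneg: "\<And>z. 0 \<le> K z"
    and K_le: "\<And>z. K z \<le> Kb"
    and K_lip: "\<And>y z. \<bar>K y - K z\<bar> \<le> KL * \<bar>y - z\<bar>"
    and \<gamma>_pos: "\<And>n. 1 \<le> n \<Longrightarrow> 0 < \<gamma> n"
    and h_pos: "\<And>n. 1 \<le> n \<Longrightarrow> 0 < h n"
    and cd: "c < d"
    and r_le: "\<And>x. x \<in> {c<..<d} \<Longrightarrow> \<bar>r x\<bar> \<le> R"
    and r_lip: "\<And>x y. x \<in> {c<..<d} \<Longrightarrow> y \<in> {c<..<d} \<Longrightarrow> \<bar>r x - r y\<bar> \<le> Lr * \<bar>x - y\<bar>"
    and t_pos: "0 < t"
    and Y_exp: "\<And>n. integrable M (\<lambda>\<omega>. exp (t * \<bar>Y n \<omega>\<bar>))"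
    and Y_exp_le: "\<And>n. expectation (\<lambda>\<omega>. exp (t * \<bar>Y n \<omega>\<bar>)) \<le> E1"
    and mean_Z: "\<And>n x. 1 \<le> n \<Longrightarrow> x \<in> {c<..<d} \<Longrightarrow>
      \<phi> - C * (h n)\<^sup>2 \<le> expectation (\<lambda>\<omega>. Zk K h X n \<omega> x)"
    and mean_bias: "\<And>n x. 1 \<le> n \<Longrightarrow> x \<in> {c<..<d} \<Longrightarrow>
      \<bar>expectation (\<lambda>\<omega>. Zk K h X n \<omega> x * (Y n \<omega> - r x))\<bar> \<le> C * (h n)\<^sup>2"
    and sec_Z: "\<And>n x. 1 \<le> n \<Longrightarrow> x \<in> {c<..<d} \<Longrightarrow>
      expectation (\<lambda>\<omega>. (Zk K h X n \<omega> x)\<^sup>2) \<le> C / h n"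
    and sec_ZY: "\<And>n x. 1 \<le> n \<Longrightarrow> x \<in> {c<..<d} \<Longrightarrow>
      expectation (\<lambda>\<omega>. (Zk K h X n \<omega> x * Y n \<omega>)\<^sup>2) \<le> C / h n"
    and C_pos: "0 < C"
    and \<phi>2: "\<phi>2 < \<phi>"
    and h_zero: "h \<longlonglongrightarrow> 0"
    and \<gamma>_zero: "\<gamma> \<longlonglongrightarrow> 0"
    and \<epsilon>h: "0 < \<epsilon>h" "\<forall>\<^sub>F n in sequentially. \<epsilon>h / real n \<le> h n"
    and noise_zero: "(\<lambda>n. sqrt (\<gamma> n / h n) * ln (real n)) \<longlonglongrightarrow> 0"
    and v_pos: "\<forall>\<^sub>F n in sequentially. 0 < v n"
    and c0: "0 < c0"
    and v_h: "\<forall>\<^sub>F n in sequentially. c0 * (h n)\<^sup>2 \<le> v n"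
    and v_noise: "\<forall>\<^sub>F n in sequentially. c0 * (sqrt (\<gamma> n / h n) * ln (real n)) \<le> v n"
    and contraction: "\<forall>\<^sub>F n in sequentially.
      ln (ln (real n) / v n) - ln (ln (real (n - 1)) / v (n - 1)) \<le> \<phi>2 * \<gamma> n"
begin

abbreviation "I \<equiv> {c<..<d}"

text \<open>The factor \<open>8 / t\<close> makes the truncation error \<open>exp (- t * lev n / 2)\<close> equal to \<open>n\<close> to the power \<open>-4\<close>,
  which is of smaller order than \<open>(h n) ^ 3\<close>.\<close>

definition lev :: "nat \<Rightarrow> real" where "lev n = 8 / t * ln (real n)"
definition U :: "nat \<Rightarrow> 'w \<Rightarrow> real" where "U n \<omega> = trunc (lev n) (Y n \<omega>)"
definition \<theta> :: "nat \<Rightarrow> real" where "\<theta> n = ln (real n) / v n"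
text \<open>The constant starting value makes this a Lipschitz function of \<open>x\<close>, which the estimator itself need not be.\<close>

definition trec :: "nat \<Rightarrow> real \<Rightarrow> nat \<Rightarrow> real \<Rightarrow> 'w \<Rightarrow> real" where
  "trec m q n x \<omega> = relax (\<lambda>k. \<gamma> k * Zk K h X k \<omega> x) (\<lambda>k. U k \<omega>) m q n"

lemma XY_meas: "(\<lambda>\<omega>. (X n \<omega>, Y n \<omega>)) \<in> borel_measurable M"
  using indep by (auto simp: indep_vars_def)

lemma X_meas[measurable]: "X n \<in> borel_measurable M"
  and Y_meas[measurable]: "Y n \<in> borel_measurable M"
  using measurable_compose[OF XY_meas fst_snd_borel(1)] measurable_compose[OF XY_meas fst_snd_borel(2)]
  by auto

lemma U_meas[measurable]: "U n \<in> borel_measurable M"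
  unfolding U_def by measurable

lemma Zk_meas[measurable]: "(\<lambda>\<omega>. Zk K h X n \<omega> x) \<in> borel_measurable M"
  unfolding Zk_def by measurable

lemma Kb_nonneg: "0 \<le> Kb" using K_nonneg[of 0] K_le[of 0] by linarith

lemma Zk_bounds: "1 \<le> n \<Longrightarrow> 0 \<le> Zk K h X n \<omega> x" "1 \<le> n \<Longrightarrow> Zk K h X n \<omega> x \<le> Kb / h n"
  unfolding Zk_def using K_nonneg K_le h_pos[of n]
  by (auto simp: divide_inverse mult.commute intro!: mult_left_mono)

lemma Y_tail_factor: "exp (- t * lev n / 2) = real n powr (-4)" if "1 \<le> n"
  using that t_pos by (simp add: lev_def powr_def)

lemma trunc_bias:
  assumes "1 \<le> n" "x \<in> I"
  shows "\<bar>expectation (\<lambda>\<omega>. Zk K h X n \<omega> x * (U n \<omega> - r x))\<bar>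
           \<le> C * (h n)\<^sup>2 + Kb / h n * (2 / t * real n powr (-4) * E1)"
proof -
  let ?Z = "\<lambda>\<omega>. Zk K h X n \<omega> x"
  have Zb: "0 \<le> ?Z \<omega>" "?Z \<omega> \<le> Kb / h n" for \<omega> using Zk_bounds assms by auto
  have z0: "0 \<le> Kb / h n" using Zb order_trans by blast
  have err: "\<bar>Y n \<omega> - U n \<omega>\<bar> \<le> 2 / t * real n powr (-4) * exp (t * \<bar>Y n \<omega>\<bar>)" for \<omega>
    using trunc_error_le_exp[OF t_pos, of "Y n \<omega>" "lev n"] Y_tail_factor[OF assms(1)]
    unfolding U_def by simp
  have iE: "integrable M (\<lambda>\<omega>. Kb / h n * (2 / t * real n powr (-4) * exp (t * \<bar>Y n \<omega>\<bar>)))"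
    using Y_exp[of n] by simp
  have le: "\<bar>?Z \<omega> * (Y n \<omega> - U n \<omega>)\<bar> \<le> Kb / h n * (2 / t * real n powr (-4) * exp (t * \<bar>Y n \<omega>\<bar>))" for \<omega>
    unfolding abs_mult using Zb[of \<omega>] z0 by (intro mult_mono err) auto
  have i1: "integrable M (\<lambda>\<omega>. ?Z \<omega> * (Y n \<omega> - U n \<omega>))"
    by (rule Bochner_Integration.integrable_bound[OF iE])
       (use order_trans[OF le abs_ge_self] in \<open>auto intro!: AE_I2\<close>)
  have lev0: "0 \<le> lev n" using assms t_pos by (simp add: lev_def)
  have Ub: "\<bar>U n \<omega>\<bar> \<le> lev n" for \<omega> unfolding U_def by (rule trunc_abs_le[OF lev0])
  have i2: "integrable M (\<lambda>\<omega>. ?Z \<omega> * (U n \<omega> - r x))"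
  proof (rule integrable_const_bound[where B="Kb / h n * (lev n + \<bar>r x\<bar>)"])
    have "\<bar>?Z \<omega> * (U n \<omega> - r x)\<bar> \<le> Kb / h n * (lev n + \<bar>r x\<bar>)" for \<omega>
      unfolding abs_mult using Zb[of \<omega>] z0 Ub[of \<omega>] by (intro mult_mono) auto
    thus "AE \<omega> in M. norm (?Z \<omega> * (U n \<omega> - r x)) \<le> Kb / h n * (lev n + \<bar>r x\<bar>)" by auto
  qed measurable
  have "expectation (\<lambda>\<omega>. ?Z \<omega> * (Y n \<omega> - r x))
      = expectation (\<lambda>\<omega>. ?Z \<omega> * (U n \<omega> - r x) + ?Z \<omega> * (Y n \<omega> - U n \<omega>))"
    by (intro Bochner_Integration.integral_cong) (auto simp: algebra_simps)
  also have "\<dots> = expectation (\<lambda>\<omega>. ?Z \<omega> * (U n \<omega> - r x)) + expectation (\<lambda>\<omega>. ?Z \<omega> * (Y n \<omega> - U n \<omega>))"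
    by (rule Bochner_Integration.integral_add[OF i2 i1])
  finally have split: "expectation (\<lambda>\<omega>. ?Z \<omega> * (U n \<omega> - r x)) =
    expectation (\<lambda>\<omega>. ?Z \<omega> * (Y n \<omega> - r x)) - expectation (\<lambda>\<omega>. ?Z \<omega> * (Y n \<omega> - U n \<omega>))" by simp
  have "norm (expectation (\<lambda>\<omega>. ?Z \<omega> * (Y n \<omega> - U n \<omega>)))
      \<le> expectation (\<lambda>\<omega>. Kb / h n * (2 / t * real n powr (-4) * exp (t * \<bar>Y n \<omega>\<bar>)))"
    by (rule order_trans[OF Bochner_Integration.integral_norm_bound integral_mono]) (use i1 iE le in auto)
  also have "\<dots> = Kb / h n * (2 / t * real n powr (-4) * expectation (\<lambda>\<omega>. exp (t * \<bar>Y n \<omega>\<bar>)))" by simp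
  also have "\<dots> \<le> Kb / h n * (2 / t * real n powr (-4) * E1)"
    using z0 t_pos Y_exp_le by (intro mult_left_mono) auto
  finally show ?thesis using mean_bias[OF assms] unfolding split by simp
qed

lemma sec_ZU:
  assumes "1 \<le> n" "x \<in> I"
  shows "expectation (\<lambda>\<omega>. (Zk K h X n \<omega> x * U n \<omega>)\<^sup>2) \<le> C / h n"
proof -
  let ?Z = "\<lambda>\<omega>. Zk K h X n \<omega> x"
  have Zb: "0 \<le> ?Z \<omega>" "?Z \<omega> \<le> Kb / h n" for \<omega> using Zk_bounds assms by auto
  have le: "\<bar>(?Z \<omega> * Y n \<omega>)\<^sup>2\<bar> \<le> (Kb / h n)\<^sup>2 * (2 / t\<^sup>2 * exp (t * \<bar>Y n \<omega>\<bar>))" for \<omega>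
  proof -
    have "(t * \<bar>Y n \<omega>\<bar>)\<^sup>2 / 2 \<le> exp (t * \<bar>Y n \<omega>\<bar>)"
      using exp_lower_Taylor_quadratic[of "t * \<bar>Y n \<omega>\<bar>"] t_pos
      by (smt (verit) abs_ge_zero mult_nonneg_nonneg)
    hence "(Y n \<omega>)\<^sup>2 \<le> 2 / t\<^sup>2 * exp (t * \<bar>Y n \<omega>\<bar>)"
      using t_pos by (simp add: power_mult_distrib field_simps)
    moreover have "(?Z \<omega>)\<^sup>2 \<le> (Kb / h n)\<^sup>2" using Zb[of \<omega>] by (intro power_mono) auto
    ultimately have "(?Z \<omega>)\<^sup>2 * (Y n \<omega>)\<^sup>2 \<le> (Kb / h n)\<^sup>2 * (2 / t\<^sup>2 * exp (t * \<bar>Y n \<omega>\<bar>))"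
      by (intro mult_mono) auto
    thus ?thesis by (simp only: power_mult_distrib abs_mult abs_power2)
  qed
  have iZY: "integrable M (\<lambda>\<omega>. (?Z \<omega> * Y n \<omega>)\<^sup>2)"
  proof (rule Bochner_Integration.integrable_bound)
    show "integrable M (\<lambda>\<omega>. (Kb / h n)\<^sup>2 * (2 / t\<^sup>2 * exp (t * \<bar>Y n \<omega>\<bar>)))" using Y_exp[of n] by simp
    show "AE \<omega> in M. norm ((?Z \<omega> * Y n \<omega>)\<^sup>2) \<le> norm ((Kb / h n)\<^sup>2 * (2 / t\<^sup>2 * exp (t * \<bar>Y n \<omega>\<bar>)))"
      using order_trans[OF le abs_ge_self] by (intro AE_I2) auto
  qed measurable
  have "(?Z \<omega> * U n \<omega>)\<^sup>2 \<le> (?Z \<omega> * Y n \<omega>)\<^sup>2" for \<omega>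
    unfolding abs_le_square_iff[symmetric] abs_mult U_def
    by (intro mult_left_mono trunc_abs_le_abs) auto
  moreover from this have "integrable M (\<lambda>\<omega>. (?Z \<omega> * U n \<omega>)\<^sup>2)"
    by (intro Bochner_Integration.integrable_bound[OF iZY]) (auto intro!: AE_I2)
  ultimately have "expectation (\<lambda>\<omega>. (?Z \<omega> * U n \<omega>)\<^sup>2) \<le> expectation (\<lambda>\<omega>. (?Z \<omega> * Y n \<omega>)\<^sup>2)"
    using iZY by (intro integral_mono) auto
  thus ?thesis using sec_ZY[OF assms] by simp
qed

lemma eventually_ln_ge_1: "\<forall>\<^sub>F n in sequentially. 1 \<le> ln (real n)"
  by real_asymp

text \<open>The consequences of the two lower bounds on \<open>v\<close> for the exponent \<open>\<theta> n = ln n / v n\<close>: small jumps,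
  bounded variance per unit of \<open>\<gamma> n\<close>, and bias of order \<open>ln n\<close>.\<close>

lemma noise_div_facts:
  assumes n: "1 \<le> n" "1 \<le> ln (real n)" "0 < v n"
    and vn: "c0 * (sqrt (\<gamma> n / h n) * ln (real n)) \<le> v n"
    and vh: "c0 * (h n)\<^sup>2 \<le> v n"
  shows "\<theta> n * \<gamma> n / h n * ln (real n) \<le> sqrt (\<gamma> n / h n) * ln (real n) / c0"
    and "(\<theta> n)\<^sup>2 * \<gamma> n / h n \<le> 1 / c0\<^sup>2"
    and "\<theta> n * (h n)\<^sup>2 \<le> ln (real n) / c0"
    and "0 < \<theta> n"
proof -
  define s where "s = sqrt (\<gamma> n / h n)"
  have s: "0 < s" "s\<^sup>2 = \<gamma> n / h n" using \<gamma>_pos[of n] h_pos[of n] n by (auto simp: s_def)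
  show \<theta>0: "0 < \<theta> n" unfolding \<theta>_def using n(2,3) by (intro divide_pos_pos) linarith+
  have "c0 * s * \<theta> n \<le> 1"
    using vn n by (simp add: \<theta>_def s_def field_simps)
  hence \<theta>s: "s * \<theta> n \<le> 1 / c0" using c0 by (simp add: field_simps)
  have "\<theta> n * \<gamma> n / h n * ln (real n) = (s * \<theta> n) * (s * ln (real n))"
  proof -
    have "\<theta> n * \<gamma> n / h n * ln (real n) = \<theta> n * (\<gamma> n / h n) * ln (real n)" by simp
    also have "\<dots> = \<theta> n * (s * s) * ln (real n)" using s(2) by (simp add: power2_eq_square)
    finally show ?thesis by simp
  qed
  also have "\<dots> \<le> 1 / c0 * (s * ln (real n))" using \<theta>s s n by (intro mult_right_mono) auto
  finally show "\<theta> n * \<gamma> n / h n * ln (real n) \<le> sqrt (\<gamma> n / h n) * ln (real n) / c0"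
    by (simp add: s_def)
  have "(\<theta> n)\<^sup>2 * \<gamma> n / h n = (s * \<theta> n)\<^sup>2" using s(2) by (simp add: power_mult_distrib)
  also have "\<dots> \<le> (1 / c0)\<^sup>2" using \<theta>s s \<theta>0 by (intro power_mono) auto
  finally show "(\<theta> n)\<^sup>2 * \<gamma> n / h n \<le> 1 / c0\<^sup>2" by (simp add: power_divide)
  show "\<theta> n * (h n)\<^sup>2 \<le> ln (real n) / c0"
    using vh n c0 mult_left_mono[OF vh, of "ln (real n)"] by (simp add: \<theta>_def field_simps)
qed

text \<open>The hypotheses of \<open>drift_step\<close> hold for all large \<open>n\<close>, uniformly in \<open>x\<close>, with threshold
  \<open>T = B * ln n\<close>.\<close>

lemma eventually_drift:
  "\<exists>B\<ge>1. \<forall>\<^sub>F n in sequentially. \<forall>x\<in>I. \<forall>\<rho>. \<bar>\<rho>\<bar> \<le> lev n \<longrightarrow>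
     expectation (\<lambda>\<omega>. exp (\<theta> n * \<bar>\<rho> + \<gamma> n * (Zk K h X n \<omega> x * (U n \<omega> - \<rho>)) - r x\<bar>))
       \<le> exp (\<theta> (n - 1) * \<bar>\<rho> - r x\<bar>) + exp (B * ln (real n) + 1)"
proof -
  \<comment> \<open>One quarter of the gap is lost to \<open>expectation Z \<ge> \<phi> - \<epsilon>\<close>, two more inside \<open>drift_step\<close>.\<close>
  define \<epsilon> where "\<epsilon> = (\<phi> - \<phi>2) / 4"
  have \<epsilon>: "0 < \<epsilon>" using \<phi>2 by (simp add: \<epsilon>_def)
  define H where "H = (C + 1) / c0 + 2 * C * (1 + 2 * R\<^sup>2) / c0\<^sup>2"
  define B where "B = max 1 (H / \<epsilon>)"
  have "\<epsilon> * (H / \<epsilon>) \<le> \<epsilon> * B" using \<epsilon> by (intro mult_left_mono) (auto simp: B_def)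
  hence B: "1 \<le> B" "H \<le> \<epsilon> * B" using \<epsilon> by (auto simp: B_def)
  have sm: "\<forall>\<^sub>F n in sequentially. A * (sqrt (\<gamma> n / h n) * ln (real n)) < \<delta>" if "\<delta> > 0" for A \<delta>
    using order_tendstoD(2)[OF tendsto_mult_right_zero[OF noise_zero, of A] that] by (simp add: mult.commute)
  have h2: "\<forall>\<^sub>F n in sequentially. C * (h n)\<^sup>2 < \<epsilon>"
  proof -
    have "(\<lambda>n. C * (h n)\<^sup>2) \<longlonglongrightarrow> C * 0\<^sup>2" by (intro tendsto_intros h_zero)
    from order_tendstoD(2)[OF this, of \<epsilon>] \<epsilon> show ?thesis by simp
  qed
  have tb: "\<forall>\<^sub>F n in sequentially. 2 * Kb * E1 / t / real n < \<epsilon>h ^ 3"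
    using \<epsilon>h(1) by real_asymp
  have lv: "\<forall>\<^sub>F n in sequentially. max R 0 < lev n"
    unfolding lev_def using t_pos by real_asymp
  have "\<forall>\<^sub>F n in sequentially. \<forall>x\<in>I. \<forall>\<rho>. \<bar>\<rho>\<bar> \<le> lev n \<longrightarrow>
     expectation (\<lambda>\<omega>. exp (\<theta> n * \<bar>\<rho> + \<gamma> n * (Zk K h X n \<omega> x * (U n \<omega> - \<rho>)) - r x\<bar>))
       \<le> exp (\<theta> (n - 1) * \<bar>\<rho> - r x\<bar>) + exp (B * ln (real n) + 1)"
    using eventually_ge_at_top[of 1] eventually_ln_ge_1 eventually_shift_pred[OF eventually_ln_ge_1]
      v_pos eventually_shift_pred[OF v_pos] v_h v_noise contraction
      sm[of 1 "2 * Kb * (8 / t) / c0", OF zero_less_one] sm[OF \<epsilon>, of "8 * C * (8 / t) / c0"] h2 \<epsilon>h(2) tb lv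
  proof eventually_elim
    case (elim n)
    have n: "1 \<le> n" and L: "1 \<le> ln (real n)" by fact+
    have hn: "0 < h n" and \<gamma>n: "0 < \<gamma> n" using h_pos \<gamma>_pos n by auto
    note nf = noise_div_facts[OF n L \<open>0 < v n\<close> elim(7) elim(6)]
    have \<theta>': "0 < \<theta> (n - 1)" using elim(3,5) by (simp add: \<theta>_def)
    show ?case
    proof (intro ballI allI impI)
      fix x \<rho> assume x: "x \<in> I" and \<rho>: "\<bar>\<rho>\<bar> \<le> lev n"
      show "expectation (\<lambda>\<omega>. exp (\<theta> n * \<bar>\<rho> + \<gamma> n * (Zk K h X n \<omega> x * (U n \<omega> - \<rho>)) - r x\<bar>))
       \<le> exp (\<theta> (n - 1) * \<bar>\<rho> - r x\<bar>) + exp (B * ln (real n) + 1)"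
      proof (rule drift_step[where z="Kb / h n" and b="lev n" and R=R and \<phi>="\<phi> - \<epsilon>"
             and \<beta>="(C + 1) * (h n)\<^sup>2" and S="C / h n" and \<epsilon>=\<epsilon>])
        show "\<bar>U n \<omega>\<bar> \<le> lev n" for \<omega> using \<rho> unfolding U_def by (intro trunc_abs_le) linarith
        show "\<bar>r x\<bar> \<le> R" by (rule r_le[OF x])
        show "R \<le> lev n" using elim by simp
        show "0 \<le> \<gamma> n" using \<gamma>n by simp
        show "0 < \<theta> n" by (rule nf)
        have "2 * \<theta> n * \<gamma> n * (Kb / h n) * lev n = 2 * Kb * (8 / t) * (\<theta> n * \<gamma> n / h n * ln (real n))"
          by (simp add: lev_def mult_ac)
        also have "\<dots> \<le> 2 * Kb * (8 / t) * (sqrt (\<gamma> n / h n) * ln (real n) / c0)"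
          using nf(1) Kb_nonneg t_pos by (intro mult_left_mono) auto
        also have "\<dots> \<le> 1" using elim by simp
        finally show "2 * \<theta> n * \<gamma> n * (Kb / h n) * lev n \<le> 1" .
        show "\<phi> - \<epsilon> \<le> expectation (\<lambda>\<omega>. Zk K h X n \<omega> x)" using mean_Z[OF n x] elim by linarith
        have "8 * \<theta> n * \<gamma> n * (C / h n) * lev n = 8 * C * (8 / t) * (\<theta> n * \<gamma> n / h n * ln (real n))"
          by (simp add: lev_def mult_ac)
        also have "\<dots> \<le> 8 * C * (8 / t) * (sqrt (\<gamma> n / h n) * ln (real n) / c0)"
          using nf(1) C_pos t_pos by (intro mult_left_mono) auto
        also have "\<dots> \<le> \<epsilon>" using elim by simp
        finally show "8 * \<theta> n * \<gamma> n * (C / h n) * lev n \<le> \<epsilon>" .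
        show "\<bar>expectation (\<lambda>\<omega>. Zk K h X n \<omega> x * (U n \<omega> - r x))\<bar> \<le> (C + 1) * (h n)\<^sup>2"
        proof -
          have p: "real n powr (-4) = 1 / real n ^ 4"
            using n by (simp add: powr_minus_divide)
          have "2 * Kb * E1 / t / real n / real n ^ 3 \<le> \<epsilon>h ^ 3 / real n ^ 3"
            using elim by (intro divide_right_mono) auto
          also have "\<dots> = (\<epsilon>h / real n) ^ 3" by (simp add: power_divide)
          also have "\<dots> \<le> h n ^ 3" using elim \<epsilon>h by (intro power_mono) auto
          finally have "Kb * (2 / t * real n powr (-4) * E1) \<le> h n ^ 3"
            unfolding p by (simp add: field_simps power4_eq_xxxx power3_eq_cube)
          hence "Kb * (2 / t * real n powr (-4) * E1) / h n \<le> h n ^ 3 / h n"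
            using hn by (intro divide_right_mono) auto
          also have "h n ^ 3 / h n = (h n)\<^sup>2" using hn by (simp add: power3_eq_cube power2_eq_square)
          finally show ?thesis using trunc_bias[OF n x] by (simp add: algebra_simps)
        qed
        have "\<theta> n * ((C + 1) * (h n)\<^sup>2) + 2 * (\<theta> n)\<^sup>2 * \<gamma> n * (C / h n) * (1 + 2 * R\<^sup>2)
            = (C + 1) * (\<theta> n * (h n)\<^sup>2) + 2 * C * (1 + 2 * R\<^sup>2) * ((\<theta> n)\<^sup>2 * \<gamma> n / h n)" by simp
        also have "\<dots> \<le> (C + 1) * (ln (real n) / c0) + 2 * C * (1 + 2 * R\<^sup>2) * (1 / c0\<^sup>2)"
          using nf C_pos by (intro add_mono mult_left_mono) auto
        also have "\<dots> \<le> (C + 1) * (ln (real n) / c0) + 2 * C * (1 + 2 * R\<^sup>2) * (1 / c0\<^sup>2) * ln (real n)"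
          using mult_left_mono[OF L, of "2 * C * (1 + 2 * R\<^sup>2) * (1 / c0\<^sup>2)"] C_pos by simp
        also have "\<dots> = H * ln (real n)" by (simp add: H_def algebra_simps add_divide_distrib)
        also have "\<dots> \<le> \<epsilon> * B * ln (real n)" using B L by (intro mult_right_mono) auto
        finally show "\<theta> n * ((C + 1) * (h n)\<^sup>2) + 2 * (\<theta> n)\<^sup>2 * \<gamma> n * (C / h n) * (1 + 2 * R\<^sup>2)
            \<le> \<epsilon> * (B * ln (real n))" by (simp add: mult.assoc)
        show "1 \<le> B * ln (real n)" using B L mult_mono[of 1 B 1 "ln (real n)"] by simp
        \<comment> \<open>The contraction condition bounds the increment of \<open>ln \<theta>\<close> by \<open>\<phi>2 * \<gamma> n\<close>.\<close>
        have "\<phi>2 \<le> \<phi> - \<epsilon> - 2 * \<epsilon>" using \<phi>2 by (simp add: \<epsilon>_def field_simps)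
        hence "\<gamma> n * \<phi>2 \<le> \<gamma> n * (\<phi> - \<epsilon> - 2 * \<epsilon>)" using \<gamma>n by (intro mult_left_mono) auto
        hence "1 - \<gamma> n * (\<phi> - \<epsilon> - 2 * \<epsilon>) \<le> 1 + - (\<phi>2 * \<gamma> n)"
          by (simp add: mult.commute[of "\<phi>2"])
        also have "\<dots> \<le> exp (- (\<phi>2 * \<gamma> n))" by (rule exp_ge_add_one_self)
        also have "\<dots> \<le> exp (ln (\<theta> (n - 1)) - ln (\<theta> n))" using elim by (simp add: \<theta>_def)
        also have "\<dots> = \<theta> (n - 1) / \<theta> n" using nf(4) \<theta>' by (simp add: exp_diff)
        finally show "\<theta> n * (1 - \<gamma> n * (\<phi> - \<epsilon> - 2 * \<epsilon>)) \<le> \<theta> (n - 1)"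
          using nf(4) by (simp add: field_simps)
        show "expectation (\<lambda>\<omega>. (Zk K h X n \<omega> x)\<^sup>2) \<le> C / h n" by (rule sec_Z[OF n x])
        show "expectation (\<lambda>\<omega>. (Zk K h X n \<omega> x * U n \<omega>)\<^sup>2) \<le> C / h n" by (rule sec_ZU[OF n x])
      qed (use Zk_bounds[OF n] \<rho> in auto)
    qed
  qed
  thus ?thesis using B(1) by blast
qed

text \<open>The same recursion as a function of the sequence of observations. In this form its measurability
  with respect to the observations up to time \<open>n\<close> can be stated, and with it the independence of the next one.\<close>

definition path_relax :: "nat \<Rightarrow> real \<Rightarrow> nat \<Rightarrow> real \<Rightarrow> (nat \<Rightarrow> real \<times> real) \<Rightarrow> real" where
  "path_relax m q n x p = relax (\<lambda>k. \<gamma> k * (inverse (h k) * K ((x - fst (p k)) / h k)))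
     (\<lambda>k. trunc (lev k) (snd (p k))) m q n"

lemma path_relax_measurable:
  "n \<le> N \<Longrightarrow> path_relax m q n x \<in> borel_measurable (PiM {..N} (\<lambda>_. borel))"
proof (induction n)
  case 0
  thus ?case by (simp add: path_relax_def)
next
  case (Suc n)
  note IH[measurable] = Suc.IH[OF Suc_leD[OF Suc.prems]]
  have comp: "(\<lambda>p. p (Suc n)) \<in> measurable (PiM {..N} (\<lambda>_. borel)) (borel :: (real \<times> real) measure)"
    using Suc.prems by (intro measurable_component_singleton) auto
  note [measurable] = measurable_compose[OF comp fst_snd_borel(1)] measurable_compose[OF comp fst_snd_borel(2)]
  have "path_relax m q (Suc n) x = (\<lambda>p. if Suc n \<le> m then q else path_relax m q n x p +
     \<gamma> (Suc n) * (inverse (h (Suc n)) * K ((x - fst (p (Suc n))) / h (Suc n))) *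
       (trunc (lev (Suc n)) (snd (p (Suc n))) - path_relax m q n x p))"
    by (auto simp: path_relax_def fun_eq_iff)
  also have "\<dots> \<in> borel_measurable (PiM {..N} (\<lambda>_. borel))" by measurable
  finally show ?case .
qed

lemma trec_eq_path_relax:
  "trec m q n x \<omega> = path_relax m q n x (restrict (\<lambda>i. (X i \<omega>, Y i \<omega>)) {..n})"
  unfolding trec_def path_relax_def by (rule relax_cong) (auto simp: Zk_def U_def)

lemma trec_measurable[measurable]: "trec m q n x \<in> borel_measurable M"
proof (induction n)
  case (Suc n)
  note [measurable] = Suc.IH
  have "trec m q (Suc n) x = (\<lambda>\<omega>. if Suc n \<le> m then q else trec m q n x \<omega> +
      \<gamma> (Suc n) * Zk K h X (Suc n) \<omega> x * (U (Suc n) \<omega> - trec m q n x \<omega>))"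
    by (auto simp: trec_def fun_eq_iff)
  also have "\<dots> \<in> borel_measurable M" by measurable
  finally show ?case .
qed (simp add: trec_def)

lemma trec_step:
  "m \<le> n \<Longrightarrow> trec m q (Suc n) x \<omega> = trec m q n x \<omega> +
      \<gamma> (Suc n) * (Zk K h X (Suc n) \<omega> x * (U (Suc n) \<omega> - trec m q n x \<omega>))"
  by (simp add: trec_def)

text \<open>From here on the weights lie in \<open>[0, 1]\<close> and the bounds of the locale that hold eventually are available.\<close>

definition regular_from :: "nat \<Rightarrow> bool" where
  "regular_from N \<longleftrightarrow> 1 \<le> N \<and> (\<forall>n\<ge>N. 1 \<le> lev n \<and> \<gamma> n * Kb / h n \<le> 1 \<and> \<gamma> n \<le> 1 \<and> 1 \<le> ln (real n)
     \<and> \<epsilon>h / real n \<le> h n \<and> 0 < v n \<and> c0 * (h n)\<^sup>2 \<le> v n)"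

lemma regular_from_mono: "regular_from N \<Longrightarrow> N \<le> m \<Longrightarrow> regular_from m"
  by (auto simp: regular_from_def)

lemma eventually_regular: "\<forall>\<^sub>F N in sequentially. regular_from N"
proof -
  have q: "(\<lambda>n. sqrt (\<gamma> n / h n) * ln (real n) * (sqrt (\<gamma> n / h n) * ln (real n))) \<longlonglongrightarrow> 0 * 0"
    by (intro tendsto_mult noise_zero)
  have "(\<lambda>n. Kb * (sqrt (\<gamma> n / h n) * ln (real n) * (sqrt (\<gamma> n / h n) * ln (real n)))) \<longlonglongrightarrow> 0"
    using tendsto_mult_right_zero[of _ _ Kb, OF q[unfolded mult_zero_left]] by simp
  hence e1: "\<forall>\<^sub>F n in sequentially. Kb * (sqrt (\<gamma> n / h n) * ln (real n) * (sqrt (\<gamma> n / h n) * ln (real n))) < 1"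
    by (rule order_tendstoD) simp
  have e2: "\<forall>\<^sub>F n in sequentially. 1 \<le> lev n" unfolding lev_def using t_pos by real_asymp
  have e3: "\<forall>\<^sub>F n in sequentially. \<gamma> n < 1" using \<gamma>_zero by (rule order_tendstoD) simp
  have "\<forall>\<^sub>F n in sequentially. 1 \<le> n \<and> 1 \<le> lev n \<and> \<gamma> n * Kb / h n \<le> 1 \<and> \<gamma> n \<le> 1 \<and> 1 \<le> ln (real n)
     \<and> \<epsilon>h / real n \<le> h n \<and> 0 < v n \<and> c0 * (h n)\<^sup>2 \<le> v n"
    using e1 e2 e3 eventually_ln_ge_1 eventually_ge_at_top[of 1] \<epsilon>h(2) v_pos v_h
  proof eventually_elim
    case (elim n)
    have "\<gamma> n * Kb / h n = Kb * (\<gamma> n / h n)" by simp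
    also have "\<dots> \<le> Kb * ((\<gamma> n / h n) * (ln (real n))\<^sup>2)"
    proof (rule mult_left_mono)
      have "0 \<le> \<gamma> n / h n" using \<gamma>_pos[of n] h_pos[of n] elim by auto
      thus "\<gamma> n / h n \<le> (\<gamma> n / h n) * (ln (real n))\<^sup>2"
        using elim mult_left_mono[of 1 "(ln (real n))\<^sup>2" "\<gamma> n / h n"] one_le_power[of "ln (real n)" 2] by simp
    qed (rule Kb_nonneg)
    also have "\<dots> = Kb * (sqrt (\<gamma> n / h n) * ln (real n) * (sqrt (\<gamma> n / h n) * ln (real n)))"
    proof -
      have "0 \<le> \<gamma> n / h n" using \<gamma>_pos[of n] h_pos[of n] elim by auto
      hence "\<gamma> n / h n = (sqrt (\<gamma> n / h n))\<^sup>2" by (rule real_sqrt_pow2[symmetric])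
      hence "(\<gamma> n / h n) * (ln (real n))\<^sup>2 = (sqrt (\<gamma> n / h n))\<^sup>2 * (ln (real n))\<^sup>2" by (rule arg_cong)
      thus ?thesis by (simp only: power2_eq_square mult_ac)
    qed
    finally show ?case using elim by auto
  qed
  then obtain N where N: "\<forall>n\<ge>N. 1 \<le> n \<and> 1 \<le> lev n \<and> \<gamma> n * Kb / h n \<le> 1 \<and> \<gamma> n \<le> 1 \<and> 1 \<le> ln (real n)
     \<and> \<epsilon>h / real n \<le> h n \<and> 0 < v n \<and> c0 * (h n)\<^sup>2 \<le> v n"
    by (auto simp: eventually_sequentially)
  hence "regular_from n" if "n \<ge> N" for n using that by (auto simp: regular_from_def)
  thus ?thesis by (auto simp: eventually_sequentially)
qed

lemma regular_weights:
  assumes "regular_from m" "m \<le> k"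
  shows "0 \<le> \<gamma> k * Zk K h X k \<omega> x \<and> \<gamma> k * Zk K h X k \<omega> x \<le> 1"
proof -
  have k: "1 \<le> k" using assms by (auto simp: regular_from_def)
  have "\<gamma> k * Zk K h X k \<omega> x \<le> \<gamma> k * (Kb / h k)"
    using Zk_bounds[OF k] \<gamma>_pos[OF k] by (intro mult_left_mono) auto
  thus ?thesis using assms Zk_bounds[OF k] \<gamma>_pos[OF k] by (fastforce simp: regular_from_def)
qed

lemma U_le_lev: "regular_from m \<Longrightarrow> m \<le> k \<Longrightarrow> k \<le> n \<Longrightarrow> \<bar>U k \<omega>\<bar> \<le> lev n"
proof -
  assume a: "regular_from m" "m \<le> k" "k \<le> n"
  hence "1 \<le> k" "1 \<le> lev k" by (auto simp: regular_from_def)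
  hence "\<bar>U k \<omega>\<bar> \<le> lev k" unfolding U_def by (intro trunc_abs_le) auto
  also have "lev k \<le> lev n" using a \<open>1 \<le> k\<close> t_pos by (auto simp: lev_def intro!: divide_right_mono)
  finally show ?thesis .
qed

lemma trec_le_lev:
  assumes "regular_from m" "m \<le> n" "\<bar>q\<bar> \<le> 1"
  shows "\<bar>trec m q n x \<omega>\<bar> \<le> lev n"
  unfolding trec_def
proof (rule relax_abs_le)
  show "\<bar>q\<bar> \<le> lev n" using assms by (fastforce simp: regular_from_def)
qed (use regular_weights[OF assms(1)] U_le_lev[OF assms(1)] in auto)

text \<open>By \<open>eventually_drift\<close> and independence of the next observation, step \<open>n\<close> adds at most
  \<open>exp (B * ln n + 1)\<close> to the exponential moment. Summation costs one more power of \<open>n\<close>.\<close>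

lemma exp_moment:
  "\<exists>B\<ge>1. \<exists>N. regular_from N \<and> (\<forall>m\<ge>N. \<forall>q\<in>{0,1}. \<exists>A\<ge>0. \<forall>x\<in>I. \<forall>n\<ge>m.
     (\<integral>\<^sup>+\<omega>. ennreal (exp (\<theta> n * \<bar>trec m q n x \<omega> - r x\<bar>)) \<partial>M)
       \<le> ennreal (A + real n * exp (B * ln (real n) + 1)))"
proof -
  obtain B where B: "B \<ge> 1" and ev: "\<forall>\<^sub>F n in sequentially. \<forall>x\<in>I. \<forall>\<rho>. \<bar>\<rho>\<bar> \<le> lev n \<longrightarrow>
     expectation (\<lambda>\<omega>. exp (\<theta> n * \<bar>\<rho> + \<gamma> n * (Zk K h X n \<omega> x * (U n \<omega> - \<rho>)) - r x\<bar>))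
       \<le> exp (\<theta> (n - 1) * \<bar>\<rho> - r x\<bar>) + exp (B * ln (real n) + 1)"
    using eventually_drift by blast
  from eventually_conj[OF ev eventually_regular] obtain N where N: "\<And>n. n \<ge> N \<Longrightarrow> regular_from n \<and> (\<forall>x\<in>I. \<forall>\<rho>. \<bar>\<rho>\<bar> \<le> lev n \<longrightarrow>
     expectation (\<lambda>\<omega>. exp (\<theta> n * \<bar>\<rho> + \<gamma> n * (Zk K h X n \<omega> x * (U n \<omega> - \<rho>)) - r x\<bar>))
       \<le> exp (\<theta> (n - 1) * \<bar>\<rho> - r x\<bar>) + exp (B * ln (real n) + 1))"
    by (auto simp: eventually_sequentially)
  have main: "(\<integral>\<^sup>+\<omega>. ennreal (exp (\<theta> n * \<bar>trec m q n x \<omega> - r x\<bar>)) \<partial>M)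
       \<le> ennreal (exp (\<theta> m * (1 + R)) + real n * exp (B * ln (real n) + 1))"
    if m: "m \<ge> N" and q: "q \<in> {0,1}" and x: "x \<in> I" and n: "n \<ge> m" for m n q x
    using n
  proof (induction n rule: dec_induct)
    case base
    have reg: "regular_from m" using N m by auto
    have "0 \<le> \<theta> m" using reg by (auto simp: regular_from_def \<theta>_def)
    moreover have "\<bar>q - r x\<bar> \<le> 1 + R" using q r_le[OF x] by auto
    ultimately have "exp (\<theta> m * \<bar>q - r x\<bar>) \<le> exp (\<theta> m * (1 + R))" by (simp add: mult_left_mono)
    hence "exp (\<theta> m * \<bar>q - r x\<bar>) \<le> exp (\<theta> m * (1 + R)) + real m * exp (B * ln (real m) + 1)"
      using add_increasing2[of "real m * exp (B * ln (real m) + 1)"] by simp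
    thus ?case by (simp add: trec_def relax_start emeasure_space_1 ennreal_leI del: ennreal_plus)
  next
    case (step n)
    let ?S = "PiM {..n} (\<lambda>_::nat. borel :: (real \<times> real) measure)"
    let ?T = "PiM {Suc n} (\<lambda>_::nat. borel :: (real \<times> real) measure)"
    let ?A = "\<lambda>\<omega>. restrict (\<lambda>i. (X i \<omega>, Y i \<omega>)) {..n}"
    let ?B = "\<lambda>\<omega>. restrict (\<lambda>i. (X i \<omega>, Y i \<omega>)) {Suc n}"
    have reg: "regular_from m" "regular_from (Suc n)" using N m step by auto
    \<comment> \<open>The new error, as a function of the new observation \<open>p\<close> and the old value \<open>\<rho>\<close>.\<close>
    define W where "W p \<rho> = \<rho> + \<gamma> (Suc n) * (inverse (h (Suc n)) * K ((x - fst p) / h (Suc n)) *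
        (trunc (lev (Suc n)) (snd p) - \<rho>)) - r x" for p and \<rho> :: real
    define F where "F a b = ennreal (exp (\<theta> (Suc n) * \<bar>W (b (Suc n)) (path_relax m q n x a)\<bar>))"
      for a b :: "nat \<Rightarrow> real \<times> real"
    have W_eq: "W (X (Suc n) \<omega>, Y (Suc n) \<omega>) \<rho> =
        \<rho> + \<gamma> (Suc n) * (Zk K h X (Suc n) \<omega> x * (U (Suc n) \<omega> - \<rho>)) - r x" for \<omega> \<rho>
      by (simp add: W_def Zk_def U_def)
    have ind: "indep_var ?S ?A ?T ?B"
      by (rule indep_var_restrict[OF indep]) auto
    have comp: "(\<lambda>b. b (Suc n)) \<in> measurable ?T borel" by (intro measurable_component_singleton) auto
    note [measurable] = path_relax_measurable[OF order_refl, of m q n x]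
      measurable_compose[OF comp fst_snd_borel(1)] measurable_compose[OF comp fst_snd_borel(2)]
    have F_meas: "case_prod F \<in> borel_measurable (?S \<Otimes>\<^sub>M ?T)"
      unfolding F_def W_def by measurable
    have "(\<integral>\<^sup>+\<omega>. ennreal (exp (\<theta> (Suc n) * \<bar>trec m q (Suc n) x \<omega> - r x\<bar>)) \<partial>M)
        = (\<integral>\<^sup>+\<omega>. F (?A \<omega>) (?B \<omega>) \<partial>M)"
      using step by (simp add: F_def W_eq trec_step flip: trec_eq_path_relax)
    also have "\<dots> \<le> (\<integral>\<^sup>+\<omega>. ennreal (exp (\<theta> n * \<bar>trec m q n x \<omega> - r x\<bar>)) +
        ennreal (exp (B * ln (real (Suc n)) + 1)) \<partial>M)"
    proof (rule indep_var_nn_integral_le[OF ind F_meas])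
      fix \<omega> assume "\<omega> \<in> space M"
      define \<rho> where "\<rho> = trec m q n x \<omega>"
      have "\<bar>\<rho>\<bar> \<le> lev n" unfolding \<rho>_def using trec_le_lev[OF reg(1)] step q by auto
      also have "\<dots> \<le> lev (Suc n)" using reg(1) step t_pos
        by (auto simp: lev_def regular_from_def intro!: divide_right_mono)
      finally have \<rho>: "\<bar>\<rho>\<bar> \<le> lev (Suc n)" .
      let ?f = "\<lambda>\<omega>'. exp (\<theta> (Suc n) * \<bar>\<rho> + \<gamma> (Suc n) * (Zk K h X (Suc n) \<omega>' x * (U (Suc n) \<omega>' - \<rho>)) - r x\<bar>)"
      have "integrable M ?f"
      proof (rule integrable_const_bound)
        have "\<bar>\<rho> + \<gamma> (Suc n) * (Zk K h X (Suc n) \<omega>' x * (U (Suc n) \<omega>' - \<rho>)) - r x\<bar>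
           \<le> lev (Suc n) + 1 * (2 * lev (Suc n)) + R" for \<omega>'
        proof -
          have "\<bar>\<gamma> (Suc n) * Zk K h X (Suc n) \<omega>' x * (U (Suc n) \<omega>' - \<rho>)\<bar> \<le> 1 * (2 * lev (Suc n))"
            unfolding abs_mult[of _ "U (Suc n) \<omega>' - \<rho>"]
            using regular_weights[OF reg(2), of "Suc n" \<omega>' x] U_le_lev[OF reg(2), of "Suc n" "Suc n" \<omega>'] \<rho>
            by (intro mult_mono) auto
          thus ?thesis using \<rho> r_le[OF x] by (simp add: mult.assoc)
        qed
        moreover have "0 \<le> \<theta> (Suc n)" using reg(2) by (auto simp: regular_from_def \<theta>_def)
        ultimately show "AE \<omega>' in M. norm (?f \<omega>') \<le> exp (\<theta> (Suc n) * (lev (Suc n) + 1 * (2 * lev (Suc n)) + R))"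
          by (intro AE_I2) (simp add: mult_left_mono)
      qed measurable
      hence "(\<integral>\<^sup>+\<omega>'. F (?A \<omega>) (?B \<omega>') \<partial>M) = ennreal (expectation ?f)"
        unfolding F_def by (simp add: W_eq nn_integral_eq_integral \<rho>_def flip: trec_eq_path_relax)
      also have "\<dots> \<le> ennreal (exp (\<theta> n * \<bar>\<rho> - r x\<bar>) + exp (B * ln (real (Suc n)) + 1))"
        using N[of "Suc n"] m step x \<rho> by (intro ennreal_leI) fastforce
      finally show "(\<integral>\<^sup>+\<omega>'. F (?A \<omega>) (?B \<omega>') \<partial>M) \<le> ennreal (exp (\<theta> n * \<bar>trec m q n x \<omega> - r x\<bar>)) +
        ennreal (exp (B * ln (real (Suc n)) + 1))" by (simp add: \<rho>_def)
    qed
    also have "\<dots> = (\<integral>\<^sup>+\<omega>. ennreal (exp (\<theta> n * \<bar>trec m q n x \<omega> - r x\<bar>)) \<partial>M) + ennreal (exp (B * ln (real (Suc n)) + 1))"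
      by (subst nn_integral_add) (auto simp: emeasure_space_1)
    also have "\<dots> \<le> ennreal (exp (\<theta> m * (1 + R)) + real n * exp (B * ln (real n) + 1)) + ennreal (exp (B * ln (real (Suc n)) + 1))"
      by (intro add_mono step.IH order_refl)
    also have "\<dots> = ennreal (exp (\<theta> m * (1 + R)) + real n * exp (B * ln (real n) + 1) + exp (B * ln (real (Suc n)) + 1))"
      by simp
    also have "\<dots> \<le> ennreal (exp (\<theta> m * (1 + R)) + real (Suc n) * exp (B * ln (real (Suc n)) + 1))"
    proof (rule ennreal_leI)
      have "1 \<le> n" using reg(1) step by (auto simp: regular_from_def)
      hence "exp (B * ln (real n) + 1) \<le> exp (B * ln (real (Suc n)) + 1)" using B by simp
      hence "real n * exp (B * ln (real n) + 1) \<le> real n * exp (B * ln (real (Suc n)) + 1)"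
        by (rule mult_left_mono) simp
      thus "exp (\<theta> m * (1 + R)) + real n * exp (B * ln (real n) + 1) + exp (B * ln (real (Suc n)) + 1)
        \<le> exp (\<theta> m * (1 + R)) + real (Suc n) * exp (B * ln (real (Suc n)) + 1)"
        by (simp add: algebra_simps)
    qed
    finally show ?case .
  qed
  have "\<exists>A\<ge>0. \<forall>x\<in>I. \<forall>n\<ge>m. (\<integral>\<^sup>+\<omega>. ennreal (exp (\<theta> n * \<bar>trec m q n x \<omega> - r x\<bar>)) \<partial>M)
       \<le> ennreal (A + real n * exp (B * ln (real n) + 1))" if "N \<le> m" "q \<in> {0, 1}" for m q
    using main[OF that] by (intro exI[of _ "exp (\<theta> m * (1 + R))"]) auto
  thus ?thesis using B N[of N] by blast
qed

end

section \<open>The uniform almost sure bound\<close>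

text \<open>The endpoints are excluded since the grid has to lie in an open interval.\<close>

lemma unit_grid_point:
  fixes u :: real
  assumes u: "0 < u" "u < 1" and k: "2 \<le> (k::nat)"
  shows "\<exists>j\<in>{1..<k}. \<bar>u - real j / real k\<bar> \<le> 1 / real k"
proof -
  define f where "f = nat \<lfloor>u * real k\<rfloor>"
  define j where "j = max 1 f"
  have uk: "0 \<le> u * real k" "u * real k < real k" using u k by auto
  have "f < k" using uk unfolding f_def by linarith
  hence j: "j \<in> {1..<k}" using k by (auto simp: j_def)
  have "real f = of_int \<lfloor>u * real k\<rfloor>" using uk unfolding f_def by simp
  hence fl: "real f \<le> u * real k" "u * real k < real f + 1" by linarith+
  have "\<bar>u * real k - real j\<bar> \<le> 1"
    using fl uk by (cases "f = 0") (auto simp: j_def max_def)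
  moreover have "u - real j / real k = (u * real k - real j) / real k" using k by (simp add: field_simps)
  ultimately have "\<bar>u - real j / real k\<bar> \<le> 1 / real k" using k by (simp add: abs_divide divide_right_mono)
  thus ?thesis using j by blast
qed

context revesz_rate begin

lemma KL_nonneg: "0 \<le> KL"
  using order_trans[OF abs_ge_zero K_lip[of 0 1]] by simp

lemma trec_lipschitz:
  assumes reg: "regular_from m" and mn: "m \<le> n" and q: "\<bar>q\<bar> \<le> 1"
  shows "\<bar>trec m q n x \<omega> - trec m q n y \<omega>\<bar> \<le> real n * (KL * \<bar>x - y\<bar> * (real n / \<epsilon>h)\<^sup>2 * (2 * lev n))"
  unfolding trec_def
proof (rule relax_weights_lipschitz)
  fix k assume k: "m < k" "k \<le> n"
  show "0 \<le> \<gamma> k * Zk K h X k \<omega> x \<and> \<gamma> k * Zk K h X k \<omega> x \<le> 1"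
    and "0 \<le> \<gamma> k * Zk K h X k \<omega> y \<and> \<gamma> k * Zk K h X k \<omega> y \<le> 1"
    using regular_weights[OF reg] k by auto
  show "\<bar>U k \<omega>\<bar> \<le> lev n" using U_le_lev[OF reg] k by auto
  have k1: "1 \<le> k" and \<gamma>1: "\<gamma> k \<le> 1" and hk: "\<epsilon>h / real k \<le> h k"
    using reg k by (auto simp: regular_from_def)
  have hp: "0 < h k" and \<gamma>p: "0 < \<gamma> k" using h_pos \<gamma>_pos k1 by auto
  have inv: "inverse (h k) \<le> real n / \<epsilon>h"
  proof -
    have "inverse (h k) \<le> inverse (\<epsilon>h / real k)" using hk \<epsilon>h k1 by (intro le_imp_inverse_le) auto
    also have "\<dots> \<le> real n / \<epsilon>h" using k \<epsilon>h by (simp add: divide_right_mono)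
    finally show ?thesis .
  qed
  have "\<bar>\<gamma> k * Zk K h X k \<omega> x - \<gamma> k * Zk K h X k \<omega> y\<bar>
      = \<gamma> k * inverse (h k) * \<bar>K ((x - X k \<omega>) / h k) - K ((y - X k \<omega>) / h k)\<bar>"
    using hp \<gamma>p by (simp add: Zk_def abs_mult mult.assoc flip: right_diff_distrib)
  also have "\<dots> \<le> 1 * inverse (h k) * (KL * \<bar>(x - X k \<omega>) / h k - (y - X k \<omega>) / h k\<bar>)"
    using \<gamma>1 \<gamma>p hp KL_nonneg by (intro mult_mono K_lip) auto
  also have "(x - X k \<omega>) / h k - (y - X k \<omega>) / h k = (x - y) * inverse (h k)"
    using hp by (simp add: field_simps)
  also have "1 * inverse (h k) * (KL * \<bar>(x - y) * inverse (h k)\<bar>) = KL * \<bar>x - y\<bar> * (inverse (h k))\<^sup>2"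
    using hp by (simp add: abs_mult power2_eq_square)
  also have "\<dots> \<le> KL * \<bar>x - y\<bar> * (real n / \<epsilon>h)\<^sup>2"
    using inv hp KL_nonneg by (intro mult_left_mono power_mono) auto
  finally show "\<bar>\<gamma> k * Zk K h X k \<omega> x - \<gamma> k * Zk K h X k \<omega> y\<bar> \<le> KL * \<bar>x - y\<bar> * (real n / \<epsilon>h)\<^sup>2" .
next
  show "0 \<le> KL * \<bar>x - y\<bar> * (real n / \<epsilon>h)\<^sup>2" using KL_nonneg by simp
  show "\<bar>q\<bar> \<le> lev n" using reg mn q by (fastforce simp: regular_from_def)
qed

text \<open>The Lipschitz constant of \<open>x \<mapsto> trec m q n x \<omega>\<close> is \<open>O(n ^ 4)\<close>, so that a mesh of order \<open>n\<close> to the power \<open>-6\<close>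
  leaves an error of order \<open>1 / n\<^sup>2 = O((h n)\<^sup>2)\<close>.\<close>

definition grid :: "nat \<Rightarrow> nat \<Rightarrow> real" where
  "grid n j = c + (d - c) * (real j / real (n ^ 6))"

lemma grid_in_I: "j \<in> {1..<n ^ 6} \<Longrightarrow> grid n j \<in> I"
proof -
  assume j: "j \<in> {1..<n ^ 6}"
  have "0 < real j / real k" "real j / real k < 1" if "j \<in> {1..<k}" for k :: nat
    using that by auto
  note u = this[OF j]
  have "0 < (d - c) * (real j / real (n ^ 6))" using cd u(1) by (intro mult_pos_pos) auto
  moreover have "(d - c) * (real j / real (n ^ 6)) < (d - c) * 1" using cd u(2) by (intro mult_strict_left_mono) auto
  ultimately show ?thesis unfolding grid_def by simp
qed

lemma grid_near:
  assumes x: "x \<in> I" and n: "2 \<le> n"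
  shows "\<exists>j\<in>{1..<n ^ 6}. \<bar>x - grid n j\<bar> \<le> (d - c) / real n ^ 6"
proof -
  have "(2::nat) ^ 1 \<le> n ^ 1" using n by simp
  also have "n ^ 1 \<le> n ^ 6" using n by (intro power_increasing) auto
  finally have k: "2 \<le> n ^ 6" by simp
  have "0 < (x - c) / (d - c)" "(x - c) / (d - c) < 1" using x cd by auto
  from unit_grid_point[OF this k] obtain j where j: "j \<in> {1..<n ^ 6}"
    "\<bar>(x - c) / (d - c) - real j / real (n ^ 6)\<bar> \<le> 1 / real (n ^ 6)" by blast
  have "\<bar>x - grid n j\<bar> = (d - c) * \<bar>(x - c) / (d - c) - real j / real (n ^ 6)\<bar>"
  proof -
    have "x - grid n j = (d - c) * ((x - c) / (d - c) - real j / real (n ^ 6))"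
    proof -
      have "(d - c) * ((x - c) / (d - c)) = x - c" using cd by simp
      thus ?thesis unfolding right_diff_distrib grid_def by simp
    qed
    thus ?thesis using cd by (simp add: abs_mult)
  qed
  also have "\<dots> \<le> (d - c) * (1 / real (n ^ 6))" using j cd by (intro mult_left_mono) auto
  finally show ?thesis using j by auto
qed

text \<open>A polynomial bound on the mean of \<open>exp (\<theta> n * \<bar>e\<bar>)\<close> makes \<open>\<theta> n * \<bar>e\<bar> > D * ln n\<close>, that is \<open>\<bar>e\<bar> > D * v n\<close>, so unlikely that
  a union bound over polynomially many grid points is summable.\<close>

lemma trec_sup_of_moment:
  assumes reg: "regular_from m" and q: "q \<in> {0, 1}" and A: "0 \<le> A" and B: "1 \<le> B"
    and mom: "\<And>x n. x \<in> I \<Longrightarrow> m \<le> n \<Longrightarrow>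
      (\<integral>\<^sup>+\<omega>. ennreal (exp (\<theta> n * \<bar>trec m q n x \<omega> - r x\<bar>)) \<partial>M)
       \<le> ennreal (A + real n * exp (B * ln (real n) + 1))"
  shows "\<exists>D. AE \<omega> in M. \<forall>\<^sub>F n in sequentially. \<forall>x\<in>I. \<bar>trec m q n x \<omega> - r x\<bar> \<le> D * v n"
proof -
  \<comment> \<open>Grid size \<open>6\<close>, moment exponent \<open>B + 1\<close>, and \<open>3\<close> for summability.\<close>
  define D where "D = B + 10"
  define bad where "bad n = (\<Union>j\<in>{1..<n ^ 6}. {\<omega> \<in> space M. D * ln (real n) \<le>
      \<theta> n * \<bar>trec m q n (grid n j) \<omega> - r (grid n j)\<bar>})" for n
  have [measurable]: "bad n \<in> sets M" for n unfolding bad_def by measurable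
  have bad_le: "prob (bad n) \<le> (A + exp 1) * real n powr (-3)" if n: "m \<le> n" for n
  proof -
    have n1: "1 \<le> n" using reg n by (auto simp: regular_from_def)
    have b0: "0 \<le> A + real n * exp (B * ln (real n) + 1)" using A by simp
    have "prob (bad n) \<le> (\<Sum>j\<in>{1..<n ^ 6}. prob {\<omega> \<in> space M. D * ln (real n) \<le>
      \<theta> n * \<bar>trec m q n (grid n j) \<omega> - r (grid n j)\<bar>})"
      unfolding bad_def by (intro finite_measure_subadditive_finite) auto
    also have "\<dots> \<le> (\<Sum>j\<in>{1..<n ^ 6}. exp (- (D * ln (real n))) * (A + real n * exp (B * ln (real n) + 1)))"
      by (intro sum_mono exponential_Markov mom grid_in_I n b0) auto
    also have "\<dots> \<le> real n ^ 6 * (exp (- (D * ln (real n))) * (A + real n * exp (B * ln (real n) + 1)))"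
      using b0 by (auto intro!: mult_right_mono simp: of_nat_diff)
    also have "\<dots> \<le> real n ^ 6 * (exp (- (D * ln (real n))) * ((A + exp 1) * real n powr (B + 1)))"
    proof (intro mult_left_mono)
      have "A \<le> A * real n powr (B + 1)" using A n1 B ge_one_powr_ge_zero[of "real n" "B + 1"] by (simp add: mult_le_cancel_left1)
      moreover have "real n * exp (B * ln (real n) + 1) = exp 1 * real n powr (B + 1)"
        using n1 by (simp add: powr_def exp_add algebra_simps)
      ultimately show "A + real n * exp (B * ln (real n) + 1) \<le> (A + exp 1) * real n powr (B + 1)"
        by (simp add: algebra_simps)
    qed auto
    also have "\<dots> = (A + exp 1) * (real n powr 6 * real n powr (- D) * real n powr (B + 1))"
      using n1 by (simp add: powr_def[of _ "- D"] powr_numeral)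
    also have "real n powr 6 * real n powr (- D) * real n powr (B + 1) = real n powr (-3)"
      unfolding powr_add[symmetric] by (simp add: D_def)
    finally show ?thesis .
  qed
  have "summable (\<lambda>n. prob (bad n))"
  proof (rule summable_comparison_test_ev)
    show "\<forall>\<^sub>F n in sequentially. norm (prob (bad n)) \<le> (A + exp 1) * real n powr (-3)"
      using eventually_ge_at_top[of m] by eventually_elim (use bad_le in auto)
    show "summable (\<lambda>n. (A + exp 1) * real n powr (-3))"
      by (intro summable_mult) (simp add: summable_real_powr_iff)
  qed
  hence not_bad: "AE \<omega> in M. \<forall>\<^sub>F n in sequentially. \<omega> \<in> space M - bad n"
    by (intro borel_cantelli_AE1) (auto simp: emeasure_eq_measure)
  define D' where "D' = D + (16 * KL * (d - c) / (t * \<epsilon>h\<^sup>2) + \<bar>Lr\<bar> * (d - c)) / (c0 * \<epsilon>h\<^sup>2)"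
  have sup: "\<forall>\<^sub>F n in sequentially. \<forall>x\<in>I. \<bar>trec m q n x \<omega> - r x\<bar> \<le> D' * v n"
    if "\<forall>\<^sub>F n in sequentially. \<omega> \<in> space M - bad n" for \<omega>
    using that eventually_ge_at_top[of m] eventually_ge_at_top[of 2]
  proof eventually_elim
    case (elim n)
    have vn: "0 < v n" and L: "1 \<le> ln (real n)" and hn: "\<epsilon>h / real n \<le> h n" and vh: "c0 * (h n)\<^sup>2 \<le> v n"
      using reg elim by (auto simp: regular_from_def)
    have q1: "\<bar>q\<bar> \<le> 1" using q by auto
    show ?case
    proof
      fix x assume x: "x \<in> I"
      obtain j where j: "j \<in> {1..<n ^ 6}" and xj: "\<bar>x - grid n j\<bar> \<le> (d - c) / real n ^ 6"
        using grid_near[OF x elim(3)] by blast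
      let ?p = "grid n j"
      have p: "?p \<in> I" by (rule grid_in_I[OF j])
      have "\<theta> n * \<bar>trec m q n ?p \<omega> - r ?p\<bar> < D * ln (real n)"
        using elim(1) j by (auto simp: bad_def not_le)
      hence 1: "\<bar>trec m q n ?p \<omega> - r ?p\<bar> \<le> D * v n"
        using vn L by (simp add: \<theta>_def field_simps)
      have n6: "(d - c) / real n ^ 6 \<le> (d - c) / (real n)\<^sup>2"
        using cd elim(3) by (intro divide_left_mono power_increasing) auto
      have 2: "\<bar>trec m q n x \<omega> - trec m q n ?p \<omega>\<bar> \<le> 16 * KL * (d - c) / (t * \<epsilon>h\<^sup>2) / (real n)\<^sup>2"
      proof -
        have "\<bar>trec m q n x \<omega> - trec m q n ?p \<omega>\<bar>
            \<le> real n * (KL * \<bar>x - ?p\<bar> * (real n / \<epsilon>h)\<^sup>2 * (2 * lev n))"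
          by (rule trec_lipschitz[OF reg elim(2) q1])
        also have "\<dots> \<le> real n * (KL * ((d - c) / real n ^ 6) * (real n / \<epsilon>h)\<^sup>2 * (2 * (8 / t * real n)))"
          using xj KL_nonneg t_pos L elim(3) ln_le_minus_one[of "real n"] cd unfolding lev_def
          by (intro mult_left_mono mult_mono) auto
        also have "\<dots> = 16 * KL * (d - c) / (t * \<epsilon>h\<^sup>2) / (real n)\<^sup>2"
        proof -
          have "real n * (KL * (\<delta> / real n ^ 6) * (real n / \<epsilon>h)\<^sup>2 * (2 * (8 / t * real n)))
              = 16 * KL * \<delta> / (t * \<epsilon>h\<^sup>2) / (real n)\<^sup>2" for \<delta>
            using elim(3) by (simp add: power_divide power2_eq_square power_numeral_reduce mult_ac)
          thus ?thesis .
        qed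
        finally show ?thesis .
      qed
      have 3: "\<bar>r x - r ?p\<bar> \<le> \<bar>Lr\<bar> * (d - c) / (real n)\<^sup>2"
      proof -
        have "\<bar>r x - r ?p\<bar> \<le> \<bar>Lr\<bar> * \<bar>x - ?p\<bar>"
          using r_lip[OF x p] by (rule order_trans) (intro mult_right_mono, auto)
        also have "\<dots> \<le> \<bar>Lr\<bar> * ((d - c) / (real n)\<^sup>2)"
          using xj n6 by (intro mult_left_mono) auto
        finally show ?thesis by simp
      qed
      have h2: "1 / (real n)\<^sup>2 \<le> v n / (c0 * \<epsilon>h\<^sup>2)"
      proof -
        have "(\<epsilon>h / real n)\<^sup>2 \<le> (h n)\<^sup>2" using hn \<epsilon>h by (intro power_mono) auto
        hence "c0 * (\<epsilon>h / real n)\<^sup>2 \<le> v n" using vh c0 mult_left_mono[of "(\<epsilon>h / real n)\<^sup>2" "(h n)\<^sup>2" c0] by linarith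
        thus ?thesis using c0 \<epsilon>h elim(3) by (simp add: power_divide field_simps)
      qed
      have "\<bar>trec m q n x \<omega> - r x\<bar> \<le>
          \<bar>trec m q n x \<omega> - trec m q n ?p \<omega>\<bar> + \<bar>trec m q n ?p \<omega> - r ?p\<bar> + \<bar>r x - r ?p\<bar>" by linarith
      also have "\<dots> \<le> 16 * KL * (d - c) / (t * \<epsilon>h\<^sup>2) / (real n)\<^sup>2 + D * v n + \<bar>Lr\<bar> * (d - c) / (real n)\<^sup>2"
        by (intro add_mono 1 2 3)
      also have "\<dots> = D * v n + (16 * KL * (d - c) / (t * \<epsilon>h\<^sup>2) + \<bar>Lr\<bar> * (d - c)) * (1 / (real n)\<^sup>2)"
      proof -
        have "a / s + b + e / s = b + (a + e) * (1 / s)" for a b e s :: real by (simp add: add_divide_distrib)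
        thus ?thesis .
      qed
      also have "\<dots> \<le> D * v n + (16 * KL * (d - c) / (t * \<epsilon>h\<^sup>2) + \<bar>Lr\<bar> * (d - c)) * (v n / (c0 * \<epsilon>h\<^sup>2))"
        using h2 KL_nonneg cd t_pos \<epsilon>h by (intro add_left_mono mult_left_mono) auto
      also have "\<dots> = D' * v n" by (simp add: D'_def distrib_right)
      finally show "\<bar>trec m q n x \<omega> - r x\<bar> \<le> D' * v n" .
    qed
  qed
  have "AE \<omega> in M. \<forall>\<^sub>F n in sequentially. \<forall>x\<in>I. \<bar>trec m q n x \<omega> - r x\<bar> \<le> D' * v n"
    by (rule AE_mp[OF not_bad]) (intro AE_I2 impI sup)
  thus ?thesis by blast
qed

lemma trec_sup:
  "\<exists>N. regular_from N \<and> (AE \<omega> in M. \<forall>m\<ge>N. \<forall>q\<in>{0,1}. \<exists>D. \<forall>\<^sub>F n in sequentially.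
     \<forall>x\<in>I. \<bar>trec m q n x \<omega> - r x\<bar> \<le> D * v n)"
proof -
  obtain B N where B: "1 \<le> B" and N: "regular_from N"
    and mom: "\<forall>m\<ge>N. \<forall>q\<in>{0,1}. \<exists>A\<ge>0. \<forall>x\<in>I. \<forall>n\<ge>m.
     (\<integral>\<^sup>+\<omega>. ennreal (exp (\<theta> n * \<bar>trec m q n x \<omega> - r x\<bar>)) \<partial>M)
       \<le> ennreal (A + real n * exp (B * ln (real n) + 1))"
    using exp_moment by blast
  have 1: "AE \<omega> in M. \<exists>D. \<forall>\<^sub>F n in sequentially. \<forall>x\<in>I. \<bar>trec m q n x \<omega> - r x\<bar> \<le> D * v n"
    if mq: "N \<le> m" "q \<in> {0, 1}" for m q
  proof -
    obtain A where A: "0 \<le> A" "\<forall>x\<in>I. \<forall>n\<ge>m. (\<integral>\<^sup>+\<omega>. ennreal (exp (\<theta> n * \<bar>trec m q n x \<omega> - r x\<bar>)) \<partial>M)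
       \<le> ennreal (A + real n * exp (B * ln (real n) + 1))"
      using mom mq by blast
    have "\<exists>D. AE \<omega> in M. \<forall>\<^sub>F n in sequentially. \<forall>x\<in>I. \<bar>trec m q n x \<omega> - r x\<bar> \<le> D * v n"
      by (rule trec_sup_of_moment[OF regular_from_mono[OF N mq(1)] mq(2) A(1) B]) (use A in auto)
    then obtain D where "AE \<omega> in M. \<forall>\<^sub>F n in sequentially. \<forall>x\<in>I. \<bar>trec m q n x \<omega> - r x\<bar> \<le> D * v n" by blast
    thus ?thesis by (rule AE_mp) (auto intro!: AE_I2)
  qed
  have "AE \<omega> in M. \<forall>m. N \<le> m \<longrightarrow>
      (\<exists>D. \<forall>\<^sub>F n in sequentially. \<forall>x\<in>I. \<bar>trec m 0 n x \<omega> - r x\<bar> \<le> D * v n) \<and>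
      (\<exists>D. \<forall>\<^sub>F n in sequentially. \<forall>x\<in>I. \<bar>trec m 1 n x \<omega> - r x\<bar> \<le> D * v n)"
    unfolding AE_all_countable
  proof
    fix m
    show "AE \<omega> in M. N \<le> m \<longrightarrow>
      (\<exists>D. \<forall>\<^sub>F n in sequentially. \<forall>x\<in>I. \<bar>trec m 0 n x \<omega> - r x\<bar> \<le> D * v n) \<and>
      (\<exists>D. \<forall>\<^sub>F n in sequentially. \<forall>x\<in>I. \<bar>trec m 1 n x \<omega> - r x\<bar> \<le> D * v n)"
    proof (cases "N \<le> m")
      case True
      thus ?thesis using AE_conjI[OF 1[OF True, of 0] 1[OF True, of 1]] by simp
    qed simp
  qed
  hence "AE \<omega> in M. \<forall>m\<ge>N. \<forall>q\<in>{0,1}. \<exists>D. \<forall>\<^sub>F n in sequentially.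
     \<forall>x\<in>I. \<bar>trec m q n x \<omega> - r x\<bar> \<le> D * v n"
    by (rule AE_mp) (auto intro!: AE_I2)
  thus ?thesis using N by blast
qed

lemma Y_eventually_le_lev: "AE \<omega> in M. \<forall>\<^sub>F n in sequentially. \<bar>Y n \<omega>\<bar> \<le> lev n"
proof -
  define bad where "bad n = {\<omega> \<in> space M. t * lev n \<le> t * \<bar>Y n \<omega>\<bar>}" for n
  have [measurable]: "bad n \<in> sets M" for n unfolding bad_def by measurable
  have bad_le: "prob (bad n) \<le> E1 * real n powr (-8)" if n: "1 \<le> n" for n
  proof -
    have E0: "0 \<le> E1" using order_trans[OF _ Y_exp_le[of 0]] by simp
    have "prob (bad n) \<le> exp (- (t * lev n)) * E1"
      unfolding bad_def
    proof (rule exponential_Markov)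
      show "(\<integral>\<^sup>+\<omega>. ennreal (exp (t * \<bar>Y n \<omega>\<bar>)) \<partial>M) \<le> ennreal E1"
        using Y_exp[of n] Y_exp_le[of n] by (subst nn_integral_eq_integral) (auto intro: ennreal_leI)
    qed (use E0 in auto)
    also have "exp (- (t * lev n)) = real n powr (-8)" using n t_pos by (simp add: lev_def powr_def)
    finally show ?thesis by (simp add: mult.commute)
  qed
  have "summable (\<lambda>n. prob (bad n))"
  proof (rule summable_comparison_test_ev)
    show "\<forall>\<^sub>F n in sequentially. norm (prob (bad n)) \<le> E1 * real n powr (-8)"
      using eventually_ge_at_top[of 1] by eventually_elim (use bad_le in auto)
    show "summable (\<lambda>n. E1 * real n powr (-8))"
      by (intro summable_mult) (simp add: summable_real_powr_iff)
  qed
  hence "AE \<omega> in M. \<forall>\<^sub>F n in sequentially. \<omega> \<in> space M - bad n"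
    by (intro borel_cantelli_AE1) (auto simp: emeasure_eq_measure)
  thus ?thesis
    by (rule AE_mp) (use t_pos in \<open>auto intro!: AE_I2 elim!: eventually_mono simp: bad_def\<close>)
qed

lemma revesz_eq_relax:
  "revesz K \<gamma> h X Y r0 n \<omega> x = relax (\<lambda>k. \<gamma> k * Zk K h X k \<omega> x) (\<lambda>k. Y k \<omega>) 0 (r0 x) n"
  by (induction n) (auto simp: Wk_def Zk_def algebra_simps)

lemma revesz_bounded:
  assumes "\<And>x. x \<in> I \<Longrightarrow> \<bar>r0 x\<bar> \<le> R0"
  shows "\<exists>b. \<forall>x\<in>I. \<bar>revesz K \<gamma> h X Y r0 n \<omega> x\<bar> \<le> b"
proof (induction n)
  case 0
  show ?case using assms by (intro exI[of _ R0]) simp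
next
  case (Suc n)
  then obtain b where b: "\<And>x. x \<in> I \<Longrightarrow> \<bar>revesz K \<gamma> h X Y r0 n \<omega> x\<bar> \<le> b" by blast
  let ?n = "Suc n"
  have "\<bar>revesz K \<gamma> h X Y r0 ?n \<omega> x\<bar> \<le> b + \<gamma> ?n * (Kb / h ?n) * (\<bar>Y ?n \<omega>\<bar> + b)" if x: "x \<in> I" for x
  proof -
    have "revesz K \<gamma> h X Y r0 ?n \<omega> x = revesz K \<gamma> h X Y r0 n \<omega> x +
        \<gamma> ?n * Zk K h X ?n \<omega> x * (Y ?n \<omega> - revesz K \<gamma> h X Y r0 n \<omega> x)"
      by (simp add: Wk_def Zk_def algebra_simps)
    moreover have "\<bar>\<gamma> ?n * Zk K h X ?n \<omega> x * (Y ?n \<omega> - revesz K \<gamma> h X Y r0 n \<omega> x)\<bar>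
        \<le> \<gamma> ?n * (Kb / h ?n) * (\<bar>Y ?n \<omega>\<bar> + b)"
      unfolding abs_mult using Zk_bounds[of ?n \<omega> x] \<gamma>_pos[of ?n] h_pos[of ?n] Kb_nonneg b[OF x]
      by (intro mult_mono) auto
    ultimately show ?thesis using b[OF x] by linarith
  qed
  thus ?case by blast
qed

text \<open>Almost surely truncation has no effect after some index \<open>m\<close>. From \<open>m\<close> on the estimator is the affine combination
  of the truncated recursions started from \<open>0\<close> and from \<open>1\<close> whose coefficient is the value of the estimator at time \<open>m\<close>.
  This coefficient depends on the path and on \<open>x\<close> without any regularity, but it is bounded on the interval.\<close>

theorem revesz_as_sup_bigo:
  assumes r0: "\<And>x. x \<in> I \<Longrightarrow> \<bar>r0 x\<bar> \<le> R0"
  shows "as_sup_bigo M I (\<lambda>n \<omega> x. revesz K \<gamma> h X Y r0 n \<omega> x - r x) v"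
proof -
  let ?e = "\<lambda>n \<omega> x. revesz K \<gamma> h X Y r0 n \<omega> x - r x"
  obtain N where N: "regular_from N" and sup: "AE \<omega> in M. \<forall>m\<ge>N. \<forall>q\<in>{0,1}. \<exists>D. \<forall>\<^sub>F n in sequentially.
     \<forall>x\<in>I. \<bar>trec m q n x \<omega> - r x\<bar> \<le> D * v n"
    using trec_sup by blast
  have I_ne: "I \<noteq> {}" using cd by simp
  have "bdd_above ((\<lambda>x. \<bar>?e n \<omega> x\<bar>) ` I)" for n \<omega>
  proof -
    obtain b where "\<forall>x\<in>I. \<bar>revesz K \<gamma> h X Y r0 n \<omega> x\<bar> \<le> b" using revesz_bounded[of r0 R0] r0 by blast
    hence "\<bar>?e n \<omega> x\<bar> \<le> b + R" if "x \<in> I" for x using r_le[OF that] that by fastforce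
    thus ?thesis by (intro bdd_aboveI2)
  qed
  moreover have "AE \<omega> in M. (\<lambda>n. SUP x\<in>I. \<bar>?e n \<omega> x\<bar>) \<in> O(v)"
    using sup Y_eventually_le_lev
  proof eventually_elim
    case (elim \<omega>)
    obtain m0 where m0: "\<And>n. n \<ge> m0 \<Longrightarrow> \<bar>Y n \<omega>\<bar> \<le> lev n"
      using elim(2) by (auto simp: eventually_sequentially)
    define m where "m = max N m0"
    have Nm: "N \<le> m" by (simp add: m_def)
    obtain D0 where D0: "\<forall>\<^sub>F n in sequentially. \<forall>x\<in>I. \<bar>trec m 0 n x \<omega> - r x\<bar> \<le> D0 * v n"
      using spec[OF elim(1), of m] Nm by auto
    obtain D1 where D1: "\<forall>\<^sub>F n in sequentially. \<forall>x\<in>I. \<bar>trec m 1 n x \<omega> - r x\<bar> \<le> D1 * v n"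
      using spec[OF elim(1), of m] Nm by auto
    obtain b where b: "\<And>x. x \<in> I \<Longrightarrow> \<bar>revesz K \<gamma> h X Y r0 m \<omega> x\<bar> \<le> b"
      using revesz_bounded[of r0 R0] r0 by blast
    have split: "revesz K \<gamma> h X Y r0 n \<omega> x = trec m 0 n x \<omega> +
        revesz K \<gamma> h X Y r0 m \<omega> x * (trec m 1 n x \<omega> - trec m 0 n x \<omega>)" if "m \<le> n" for n x
    proof -
      let ?w = "\<lambda>k. \<gamma> k * Zk K h X k \<omega> x" and ?q = "revesz K \<gamma> h X Y r0 m \<omega> x"
      have "revesz K \<gamma> h X Y r0 n \<omega> x = relax ?w (\<lambda>k. Y k \<omega>) m ?q n"
        unfolding revesz_eq_relax by (rule relax_restart[OF that])
      also have "\<dots> = relax ?w (\<lambda>k. U k \<omega>) m ?q n"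
        by (rule relax_cong) (use m0 in \<open>auto simp: m_def U_def trunc_def\<close>)
      also have "\<dots> = trec m 0 n x \<omega> + ?q * (trec m 1 n x \<omega> - trec m 0 n x \<omega>)"
        unfolding trec_def by (rule relax_affine)
      finally show ?thesis .
    qed
    define D where "D = D0 + b * (D0 + D1)"
    have "\<forall>\<^sub>F n in sequentially. \<forall>x\<in>I. \<bar>?e n \<omega> x\<bar> \<le> D * v n"
      using D0 D1 eventually_ge_at_top[of m]
    proof eventually_elim
      case (elim n)
      show ?case
      proof
        fix x assume x: "x \<in> I"
        have "\<bar>trec m 1 n x \<omega> - trec m 0 n x \<omega>\<bar> \<le> (D0 + D1) * v n"
          using elim(1,2) x by (fastforce simp: distrib_right)
        hence "\<bar>revesz K \<gamma> h X Y r0 m \<omega> x * (trec m 1 n x \<omega> - trec m 0 n x \<omega>)\<bar> \<le> b * ((D0 + D1) * v n)"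
          unfolding abs_mult using b[OF x] by (intro mult_mono) auto
        moreover have "\<bar>trec m 0 n x \<omega> - r x\<bar> \<le> D0 * v n" using elim(1) x by auto
        ultimately show "\<bar>?e n \<omega> x\<bar> \<le> D * v n"
          unfolding split[OF elim(3)] D_def by (simp add: algebra_simps)
      qed
    qed
    hence "\<forall>\<^sub>F n in sequentially. norm (SUP x\<in>I. \<bar>?e n \<omega> x\<bar>) \<le> D * norm (v n)"
      using v_pos
    proof eventually_elim
      case (elim n)
      have x0: "(c + d) / 2 \<in> I" using cd by auto
      have "0 \<le> (SUP x\<in>I. \<bar>?e n \<omega> x\<bar>)"
        by (rule cSUP_upper2[OF _ x0]) (use \<open>\<And>n \<omega>. bdd_above ((\<lambda>x. \<bar>?e n \<omega> x\<bar>) ` I)\<close> in auto)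
      moreover have "(SUP x\<in>I. \<bar>?e n \<omega> x\<bar>) \<le> D * v n"
        using elim(1) I_ne by (intro cSUP_least) auto
      ultimately show ?case using elim(2) by simp
    qed
    thus ?case by (rule bigoI)
  qed
  ultimately show ?thesis unfolding as_sup_bigo_def by simp
qed

end

section \<open>Moments of the kernel weights from the joint density\<close>

lemma power_le_exp:
  assumes t: "0 < (t::real)" and q: "q \<in> {0, 1, 2::nat}"
  shows "\<bar>y ^ q\<bar> \<le> (1 + 1 / t + 2 / t\<^sup>2) * exp (t * \<bar>y\<bar>)"
proof -
  let ?E = "exp (t * \<bar>y\<bar>)"
  have E: "1 + t * \<bar>y\<bar> + (t * \<bar>y\<bar>)\<^sup>2 / 2 \<le> ?E"
    using exp_lower_Taylor_quadratic[of "t * \<bar>y\<bar>"] t by simp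
  have n: "0 \<le> t * \<bar>y\<bar>" "0 \<le> (t * \<bar>y\<bar>)\<^sup>2 / 2" using t by auto
  have p0: "1 \<le> ?E" using E n by linarith
  have p1: "\<bar>y\<bar> \<le> 1 / t * ?E"
  proof -
    have "t * \<bar>y\<bar> \<le> ?E" using E n by linarith
    thus ?thesis using t by (simp add: field_simps)
  qed
  have p2: "\<bar>y\<^sup>2\<bar> \<le> 2 / t\<^sup>2 * ?E"
  proof -
    have "(t * \<bar>y\<bar>)\<^sup>2 / 2 \<le> ?E" using E n by linarith
    thus ?thesis using t by (simp add: power_mult_distrib field_simps)
  qed
  have nonneg: "0 \<le> 1 / t * ?E" "0 \<le> 2 / t\<^sup>2 * ?E" using t by auto
  consider "q = 0" | "q = 1" | "q = 2" using q by auto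
  hence "\<bar>y ^ q\<bar> \<le> ?E + 1 / t * ?E + 2 / t\<^sup>2 * ?E"
  proof cases
    case 1
    hence "\<bar>y ^ q\<bar> = 1" by simp
    thus ?thesis using p0 nonneg by linarith
  next
    case 2
    hence "\<bar>y ^ q\<bar> = \<bar>y\<bar>" by simp
    thus ?thesis using p0 p1 nonneg by linarith
  next
    case 3
    hence "\<bar>y ^ q\<bar> = \<bar>y\<^sup>2\<bar>" by simp
    thus ?thesis using p0 p2 nonneg by linarith
  qed
  thus ?thesis by (simp only: distrib_right mult_1)
qed

lemma density_measurable:
  assumes dens: "distributed M lborel (\<lambda>\<omega>. (X \<omega>, Y \<omega>)) (\<lambda>(s, t). ennreal (g s t))"
    and g0: "\<And>s t. 0 \<le> g s t"
  shows "case_prod g \<in> borel_measurable (borel :: (real \<times> real) measure)"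
proof -
  have "(\<lambda>(s, t). ennreal (g s t)) \<in> borel_measurable lborel"
    by (rule distributed_borel_measurable[OF dens])
  hence "(\<lambda>p. enn2real ((\<lambda>(s, t). ennreal (g s t)) p)) \<in> borel_measurable lborel" by measurable
  moreover have "(\<lambda>p. enn2real ((\<lambda>(s, t). ennreal (g s t)) p)) = case_prod g" using g0 by auto
  ultimately show ?thesis by simp
qed

lemma expectation_eq_density_integral:
  fixes F :: "real \<times> real \<Rightarrow> real"
  assumes dens: "distributed M lborel (\<lambda>\<omega>. (X \<omega>, Y \<omega>)) (\<lambda>(s, t). ennreal (g s t))"
    and g0: "\<And>s t. 0 \<le> g s t" and F[measurable]: "F \<in> borel_measurable borel"
  shows "(\<integral>\<omega>. F (X \<omega>, Y \<omega>) \<partial>M) = (\<integral>p. case_prod g p * F p \<partial>lborel)"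
    and "integrable M (\<lambda>\<omega>. F (X \<omega>, Y \<omega>)) \<longleftrightarrow> integrable lborel (\<lambda>p. case_prod g p * F p)"
proof -
  have eq: "(\<lambda>(s, t). ennreal (g s t)) = (\<lambda>p. ennreal (case_prod g p))" by auto
  note d = dens[unfolded eq]
  show "(\<integral>\<omega>. F (X \<omega>, Y \<omega>) \<partial>M) = (\<integral>p. case_prod g p * F p \<partial>lborel)"
    using distributed_integral[OF d, of F] g0 by auto
  show "integrable M (\<lambda>\<omega>. F (X \<omega>, Y \<omega>)) \<longleftrightarrow> integrable lborel (\<lambda>p. case_prod g p * F p)"
    using distributed_integrable[OF d, of F] g0 by auto
qed

lemma expectation_weighted_power:
  fixes k :: "real \<Rightarrow> real" and q :: nat
  assumes dens: "distributed M lborel (\<lambda>\<omega>. (X \<omega>, Y \<omega>)) (\<lambda>(s, t). ennreal (g s t))"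
    and g0: "\<And>s t. 0 \<le> g s t" and k[measurable]: "k \<in> borel_measurable borel"
    and int: "integrable M (\<lambda>\<omega>. k (X \<omega>) * Y \<omega> ^ q)"
  shows "(\<integral>\<omega>. k (X \<omega>) * Y \<omega> ^ q \<partial>M) = (\<integral>s. k s * (\<integral>t. t ^ q * g s t \<partial>lborel) \<partial>lborel)"
proof -
  define F where "F = (\<lambda>p::real \<times> real. k (fst p) * snd p ^ q)"
  have F[measurable]: "F \<in> borel_measurable borel" unfolding F_def by measurable
  note e = expectation_eq_density_integral[OF dens g0 F]
  have i: "integrable (lborel \<Otimes>\<^sub>M lborel) (\<lambda>p. case_prod g p * F p)"
    using e(2) int by (simp add: lborel_prod F_def)
  have "(\<integral>\<omega>. k (X \<omega>) * Y \<omega> ^ q \<partial>M) = (\<integral>p. case_prod g p * F p \<partial>(lborel \<Otimes>\<^sub>M lborel))"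
    using e(1) by (simp add: lborel_prod F_def)
  also have "\<dots> = (\<integral>s. (\<integral>t. case_prod g (s, t) * F (s, t) \<partial>lborel) \<partial>lborel)"
    by (rule lborel_pair.integral_fst'[OF i, symmetric])
  also have "\<dots> = (\<integral>s. k s * (\<integral>t. t ^ q * g s t \<partial>lborel) \<partial>lborel)"
  proof (rule Bochner_Integration.integral_cong[OF refl])
    fix s
    have "(\<integral>t. case_prod g (s, t) * F (s, t) \<partial>lborel) = (\<integral>t. k s * (t ^ q * g s t) \<partial>lborel)"
      by (intro Bochner_Integration.integral_cong) (auto simp: F_def)
    thus "(\<integral>t. case_prod g (s, t) * F (s, t) \<partial>lborel) = k s * (\<integral>t. t ^ q * g s t \<partial>lborel)" by simp
  qed
  finally show ?thesis .
qed

text \<open>A pointwise limit of difference quotients.\<close>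

lemma D1_measurable_snd:
  assumes g: "twice_cont_diff_fst g" and m: "\<And>s. g s \<in> borel_measurable borel"
  shows "D1 g x \<in> borel_measurable borel"
proof (rule borel_measurable_LIMSEQ_real)
  show "(\<lambda>t. (g (x + 1 / real (Suc n)) t - g x t) / (1 / real (Suc n))) \<in> borel_measurable borel" for n
    using m by measurable
  fix t :: real
  have "((\<lambda>u. g u t) has_real_derivative D1 g x t) (at x)"
    using g unfolding twice_cont_diff_fst_def D1_def by (metis DERIV_deriv_iff_field_differentiable)
  hence lim: "((\<lambda>e. (g (x + e) t - g x t) / e) \<longlongrightarrow> D1 g x t) (at 0)" by (simp add: DERIV_def)
  have "filterlim (\<lambda>n. 1 / real (Suc n)) (at 0) sequentially"
    by (rule filterlim_atI) (use LIMSEQ_inverse_real_of_nat in \<open>auto simp: inverse_eq_divide simp del: of_nat_Suc\<close>)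
  from filterlim_compose[OF lim this]
  show "(\<lambda>n. (g (x + 1 / real (Suc n)) t - g x t) / (1 / real (Suc n))) \<longlonglongrightarrow> D1 g x t" .
qed

text \<open>The hypotheses on the joint density and the kernel, with named constants: \<open>m0 q\<close>, \<open>D0 q\<close> and \<open>C0 q\<close> bound the
  partial moments of order \<open>q\<close> of \<open>g\<close>, \<open>D1 g\<close> and \<open>D2 g\<close>, the second of these with absolute values and only on
  the interval.\<close>

locale revesz_density = prob_space M for M :: "'w measure" +
  fixes X Y :: "nat \<Rightarrow> 'w \<Rightarrow> real" and g :: "real \<Rightarrow> real \<Rightarrow> real" and K :: "real \<Rightarrow> real"
    and h :: "nat \<Rightarrow> real" and c d \<phi> Kb t :: real and C0 D0 m0 :: "nat \<Rightarrow> real"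
  assumes g_nonneg: "\<And>s t. 0 \<le> g s t"
    and density: "\<And>n. distributed M lborel (\<lambda>\<omega>. (X n \<omega>, Y n \<omega>)) (\<lambda>(s, t). ennreal (g s t))"
    and cd: "c < d"
    and \<phi>: "0 < \<phi>" "\<And>x. x \<in> {c<..<d} \<Longrightarrow> \<phi> \<le> dens_X g x"
    and K_nonneg: "\<And>z. 0 \<le> K z" and K_le: "\<And>z. K z \<le> Kb"
    and K_0: "has_bochner_integral lborel K 1"
    and K_1: "has_bochner_integral lborel (\<lambda>z. z * K z) 0"
    and K_2: "integrable lborel (\<lambda>z. z\<^sup>2 * K z)"
    and h_pos: "\<And>n. 1 \<le> n \<Longrightarrow> 0 < h n"
    and g_C2: "twice_cont_diff_fst g"
    and g_int: "\<And>q s. q \<in> {0, 1, 2} \<Longrightarrow> integrable lborel (\<lambda>t. t ^ q * g s t)"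
    and g_bd: "\<And>q s. q \<in> {0, 1, 2} \<Longrightarrow> \<bar>\<integral>t. t ^ q * g s t \<partial>lborel\<bar> \<le> m0 q"
    and g_D1: "\<And>q x. q \<in> {0, 1} \<Longrightarrow> x \<in> {c<..<d} \<Longrightarrow> integrable lborel (\<lambda>t. \<bar>t\<bar> ^ q * \<bar>D1 g x t\<bar>)"
    and g_D1_bd: "\<And>q x. q \<in> {0, 1} \<Longrightarrow> x \<in> {c<..<d} \<Longrightarrow> (\<integral>t. \<bar>t\<bar> ^ q * \<bar>D1 g x t\<bar> \<partial>lborel) \<le> D0 q"
    and g_D2_bd: "\<And>q s. q \<in> {0, 1} \<Longrightarrow> \<bar>\<integral>t. t ^ q * D2 g s t \<partial>lborel\<bar> \<le> C0 q"
    and g_loc: "D2_loc_integrable g"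
    and t_pos: "0 < t" and Y_exp0: "integrable M (\<lambda>\<omega>. exp (t * \<bar>Y 0 \<omega>\<bar>))"
begin

definition mom :: "nat \<Rightarrow> real \<Rightarrow> real" where "mom q s = (\<integral>t. t ^ q * g s t \<partial>lborel)"
definition mom' :: "nat \<Rightarrow> real \<Rightarrow> real" where "mom' q s = (\<integral>t. t ^ q * D1 g s t \<partial>lborel)"

lemma dens_X_mom: "dens_X g = mom 0"
  by (simp add: dens_X_def mom_def fun_eq_iff)

lemma regr_mom: "regr g x = mom 1 x / mom 0 x"
  by (simp add: regr_def dens_X_mom mom_def)

lemma mom0_ge: "x \<in> {c<..<d} \<Longrightarrow> \<phi> \<le> mom 0 x" using \<phi>(2) dens_X_mom by simp

lemma g_meas: "case_prod g \<in> borel_measurable borel"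
  by (rule density_measurable[OF density[of 0] g_nonneg])

lemma g_snd_meas: "g s \<in> borel_measurable borel"
  using borel_measurable_integrable[OF g_int[of 0 s]] by simp

lemma mom_meas[measurable]: "mom q \<in> borel_measurable borel"
proof -
  have "case_prod g \<in> borel_measurable (borel \<Otimes>\<^sub>M borel)" using g_meas by (simp add: borel_prod)
  hence "(\<lambda>(s, t). t ^ q * g s t) \<in> borel_measurable (borel \<Otimes>\<^sub>M lborel)"
    by (simp add: case_prod_beta) measurable
  hence "(\<lambda>s. \<integral>t. t ^ q * g s t \<partial>lborel) \<in> borel_measurable borel"
    by (rule lborel.borel_measurable_lebesgue_integral)
  thus ?thesis unfolding mom_def[abs_def] .
qed

lemma mom'_abs_le:
  assumes "q \<in> {0, 1}" "x \<in> {c<..<d}"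
  shows "integrable lborel (\<lambda>t. t ^ q * D1 g x t)" and "\<bar>mom' q x\<bar> \<le> D0 q"
proof -
  have m: "(\<lambda>t. t ^ q * D1 g x t) \<in> borel_measurable lborel"
    using D1_measurable_snd[OF g_C2 g_snd_meas, of x] by measurable
  have n: "norm (t ^ q * D1 g x t) = \<bar>t\<bar> ^ q * \<bar>D1 g x t\<bar>" for t by (simp add: abs_mult power_abs)
  show i: "integrable lborel (\<lambda>t. t ^ q * D1 g x t)"
    by (rule integrable_norm_cancel[OF _ m]) (use g_D1[OF assms] in \<open>simp only: n\<close>)
  have "\<bar>mom' q x\<bar> \<le> (\<integral>t. norm (t ^ q * D1 g x t) \<partial>lborel)"
    unfolding mom'_def using integral_norm_bound[of lborel "\<lambda>t. t ^ q * D1 g x t"] by simp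
  thus "\<bar>mom' q x\<bar> \<le> D0 q" unfolding n using g_D1_bd[OF assms] by simp
qed

lemma mom_taylor:
  assumes "q \<in> {0, 1}" "x \<in> {c<..<d}"
  shows "\<bar>mom q s - mom q x - (s - x) * mom' q x\<bar> \<le> C0 q * (s - x)\<^sup>2"
  unfolding mom_def mom'_def
  by (rule partial_moment_taylor[OF g_C2 assms(1) _ mom'_abs_le(1)[OF assms] g_D2_bd[OF assms(1)] g_loc])
     (use g_int assms in auto)

lemma C0_nonneg: "q \<in> {0, 1} \<Longrightarrow> 0 \<le> C0 q"
  using order_trans[OF abs_ge_zero g_D2_bd] by blast

lemma D0_nonneg: "q \<in> {0, 1} \<Longrightarrow> 0 \<le> D0 q"
proof -
  assume q: "q \<in> {0, 1}"
  have "(c + d) / 2 \<in> {c<..<d}" using cd by auto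
  from order_trans[OF abs_ge_zero mom'_abs_le(2)[OF q this]] show ?thesis .
qed

lemma m0_nonneg: "q \<in> {0, 1, 2} \<Longrightarrow> 0 \<le> m0 q"
  using order_trans[OF abs_ge_zero g_bd] by blast

text \<open>From the Taylor bound at \<open>y\<close>, on a bounded interval.\<close>

lemma mom_lipschitz:
  assumes q: "q \<in> {0, 1}" and x: "x \<in> {c<..<d}" and y: "y \<in> {c<..<d}"
  shows "\<bar>mom q x - mom q y\<bar> \<le> (D0 q + C0 q * (d - c)) * \<bar>x - y\<bar>"
proof -
  have "\<bar>mom q x - mom q y\<bar> \<le> \<bar>(x - y) * mom' q y\<bar> + C0 q * (x - y)\<^sup>2"
    using mom_taylor[OF q y, of x] by linarith
  also have "\<dots> = \<bar>x - y\<bar> * \<bar>mom' q y\<bar> + C0 q * (\<bar>x - y\<bar> * \<bar>x - y\<bar>)"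
    by (simp add: abs_mult power2_eq_square)
  also have "\<dots> \<le> \<bar>x - y\<bar> * D0 q + C0 q * (\<bar>x - y\<bar> * (d - c))"
    using mom'_abs_le(2)[OF q y] C0_nonneg[OF q] x y by (intro add_mono mult_left_mono) auto
  finally show ?thesis by (simp add: algebra_simps)
qed

lemma regr_abs_le: "x \<in> {c<..<d} \<Longrightarrow> \<bar>regr g x\<bar> \<le> m0 1 / \<phi>"
proof -
  assume x: "x \<in> {c<..<d}"
  have "\<bar>regr g x\<bar> = \<bar>mom 1 x\<bar> / mom 0 x" using mom0_ge[OF x] \<phi>(1) by (simp add: regr_mom abs_divide)
  also have "\<dots> \<le> m0 1 / \<phi>"
    using mom0_ge[OF x] \<phi>(1) g_bd[of 1 x] by (intro frac_le) (auto simp: mom_def)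
  finally show ?thesis .
qed

lemma regr_lipschitz:
  assumes x: "x \<in> {c<..<d}" and y: "y \<in> {c<..<d}"
  shows "\<bar>regr g x - regr g y\<bar> \<le>
    ((D0 1 + C0 1 * (d - c)) + m0 1 / \<phi> * (D0 0 + C0 0 * (d - c))) / \<phi> * \<bar>x - y\<bar>"
proof -
  let ?L1 = "D0 1 + C0 1 * (d - c)" and ?L0 = "D0 0 + C0 0 * (d - c)"
  have p: "0 < mom 0 x" "0 < mom 0 y" using mom0_ge x y \<phi>(1) by (meson less_le_trans)+
  have "regr g x - regr g y = ((mom 1 x - mom 1 y) - regr g y * (mom 0 x - mom 0 y)) / mom 0 x"
    using p by (simp add: regr_mom field_simps)
  hence "\<bar>regr g x - regr g y\<bar> = \<bar>(mom 1 x - mom 1 y) - regr g y * (mom 0 x - mom 0 y)\<bar> / mom 0 x"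
    using p by (simp add: abs_divide)
  also have "\<dots> \<le> (?L1 * \<bar>x - y\<bar> + m0 1 / \<phi> * (?L0 * \<bar>x - y\<bar>)) / \<phi>"
  proof (rule frac_le)
    have "\<bar>(mom 1 x - mom 1 y) - regr g y * (mom 0 x - mom 0 y)\<bar>
        \<le> \<bar>mom 1 x - mom 1 y\<bar> + \<bar>regr g y\<bar> * \<bar>mom 0 x - mom 0 y\<bar>"
      unfolding abs_mult[symmetric] by (rule abs_triangle_ineq4)
    also have "\<dots> \<le> ?L1 * \<bar>x - y\<bar> + m0 1 / \<phi> * (?L0 * \<bar>x - y\<bar>)"
      using m0_nonneg[of 1] \<phi>(1)
      by (intro add_mono mult_mono mom_lipschitz regr_abs_le x y) auto
    finally show "\<bar>(mom 1 x - mom 1 y) - regr g y * (mom 0 x - mom 0 y)\<bar>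
        \<le> ?L1 * \<bar>x - y\<bar> + m0 1 / \<phi> * (?L0 * \<bar>x - y\<bar>)" .
    show "0 \<le> ?L1 * \<bar>x - y\<bar> + m0 1 / \<phi> * (?L0 * \<bar>x - y\<bar>)"
      using m0_nonneg[of 1] \<phi>(1) C0_nonneg[of 0] C0_nonneg[of 1] D0_nonneg[of 0] D0_nonneg[of 1] cd by simp
  qed (use mom0_ge[OF x] \<phi>(1) in auto)
  also have "\<dots> = (?L1 + m0 1 / \<phi> * ?L0) / \<phi> * \<bar>x - y\<bar>" by (simp add: distrib_right)
  finally show ?thesis .
qed

lemma K_meas[measurable]: "K \<in> borel_measurable borel"
  using K_0 by (auto simp: has_bochner_integral_iff)

lemma XY_meas: "(\<lambda>\<omega>. (X n \<omega>, Y n \<omega>)) \<in> borel_measurable M"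
  using distributed_measurable[OF density[of n]] by simp

lemma X_meas[measurable]: "X n \<in> borel_measurable M"
  and Y_meas[measurable]: "Y n \<in> borel_measurable M"
  using measurable_compose[OF XY_meas fst_snd_borel(1)] measurable_compose[OF XY_meas fst_snd_borel(2)]
  by auto

lemma Y_exp: "integrable M (\<lambda>\<omega>. exp (t * \<bar>Y n \<omega>\<bar>))"
  and Y_exp_eq: "expectation (\<lambda>\<omega>. exp (t * \<bar>Y n \<omega>\<bar>)) = expectation (\<lambda>\<omega>. exp (t * \<bar>Y 0 \<omega>\<bar>))"
proof -
  have F: "(\<lambda>p. exp (t * \<bar>snd p\<bar>)) \<in> borel_measurable (borel :: (real \<times> real) measure)" by measurable
  note e = expectation_eq_density_integral[OF density g_nonneg F]
  show "integrable M (\<lambda>\<omega>. exp (t * \<bar>Y n \<omega>\<bar>))" using e(2)[of n] e(2)[of 0] Y_exp0 by simp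
  show "expectation (\<lambda>\<omega>. exp (t * \<bar>Y n \<omega>\<bar>)) = expectation (\<lambda>\<omega>. exp (t * \<bar>Y 0 \<omega>\<bar>))"
    using e(1)[of n] e(1)[of 0] by simp
qed

lemma Z_bounds: "1 \<le> n \<Longrightarrow> 0 \<le> Zk K h X n \<omega> x" "1 \<le> n \<Longrightarrow> Zk K h X n \<omega> x \<le> Kb / h n"
  unfolding Zk_def using K_nonneg K_le h_pos[of n]
  by (auto simp: divide_inverse mult.commute intro!: mult_left_mono)

lemma Z_meas[measurable]: "(\<lambda>\<omega>. Zk K h X n \<omega> x) \<in> borel_measurable M"
  unfolding Zk_def by measurable

lemma ZY_integrable:
  assumes n: "1 \<le> n" and q: "q \<in> {0, 1, 2}"
  shows "integrable M (\<lambda>\<omega>. Zk K h X n \<omega> x * Y n \<omega> ^ q)"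
proof (rule Bochner_Integration.integrable_bound)
  show "integrable M (\<lambda>\<omega>. Kb / h n * ((1 + 1 / t + 2 / t\<^sup>2) * exp (t * \<bar>Y n \<omega>\<bar>)))" using Y_exp[of n] by simp
  have b: "\<bar>Zk K h X n \<omega> x * Y n \<omega> ^ q\<bar> \<le> Kb / h n * ((1 + 1 / t + 2 / t\<^sup>2) * exp (t * \<bar>Y n \<omega>\<bar>))" for \<omega>
    unfolding abs_mult using Z_bounds[OF n, of \<omega> x] power_le_exp[OF t_pos q, of "Y n \<omega>"]
    by (intro mult_mono) auto
  show "AE \<omega> in M. norm (Zk K h X n \<omega> x * Y n \<omega> ^ q)
      \<le> norm (Kb / h n * ((1 + 1 / t + 2 / t\<^sup>2) * exp (t * \<bar>Y n \<omega>\<bar>)))"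
    by (intro AE_I2, unfold real_norm_def) (rule order_trans[OF b abs_ge_self])
qed measurable

lemma ZY_expectation:
  assumes n: "1 \<le> n" and q: "q \<in> {0, 1, 2}"
  shows "expectation (\<lambda>\<omega>. Zk K h X n \<omega> x * Y n \<omega> ^ q)
    = (\<integral>s. inverse (h n) * K ((x - s) / h n) * mom q s \<partial>lborel)"
  unfolding mom_def
  using expectation_weighted_power[OF density[of n] g_nonneg, of "\<lambda>s. inverse (h n) * K ((x - s) / h n)" q]
    ZY_integrable[OF n q, of x] by (simp add: Zk_def)

lemma ZY_expectation_near:
  assumes n: "1 \<le> n" and q: "q \<in> {0, 1}" and x: "x \<in> {c<..<d}"
  shows "\<bar>expectation (\<lambda>\<omega>. Zk K h X n \<omega> x * Y n \<omega> ^ q) - mom q x\<bar>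
      \<le> C0 q * (h n)\<^sup>2 * (\<integral>z. z\<^sup>2 * K z \<partial>lborel)"
proof -
  have q2: "q \<in> {0, 1, 2}" using q by auto
  show ?thesis unfolding ZY_expectation[OF n q2]
    by (rule kernel_smoothing[OF K_0 K_1 K_2 K_nonneg mom_meas mom_taylor[OF q x] h_pos[OF n]])
qed

lemma ZY_expectation_le:
  assumes n: "1 \<le> n" and q: "q \<in> {0, 1, 2}"
  shows "expectation (\<lambda>\<omega>. Zk K h X n \<omega> x * Y n \<omega> ^ q) \<le> m0 q"
proof -
  let ?k = "\<lambda>s. inverse (h n) * K ((x - s) / h n)"
  note k = kernel_total_mass[OF K_0 h_pos[OF n], of x]
  have k0: "0 \<le> ?k s" for s using K_nonneg h_pos[OF n] by simp
  have i: "integrable lborel (\<lambda>s. ?k s * m0 q)" using k(1) by simp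
  have le: "\<bar>?k s * mom q s\<bar> \<le> ?k s * m0 q" for s
  proof -
    have "\<bar>?k s * mom q s\<bar> = ?k s * \<bar>mom q s\<bar>" by (metis abs_mult abs_of_nonneg k0)
    also have "\<dots> \<le> ?k s * m0 q" using g_bd[OF q, of s] k0[of s] unfolding mom_def by (rule mult_left_mono)
    finally show ?thesis .
  qed
  have "(\<integral>s. ?k s * mom q s \<partial>lborel) \<le> (\<integral>s. ?k s * m0 q \<partial>lborel)"
  proof (rule integral_mono)
    show "integrable lborel (\<lambda>s. ?k s * mom q s)"
      by (rule Bochner_Integration.integrable_bound[OF i])
         (use order_trans[OF le abs_ge_self] in \<open>auto intro!: AE_I2\<close>)
  qed (use i le abs_le_D1 in auto)
  also have "\<dots> = m0 q" using k by simp
  finally show ?thesis using ZY_expectation[OF n q] by simp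
qed

definition \<kappa> :: real where "\<kappa> = (\<integral>z. z\<^sup>2 * K z \<partial>lborel)"
definition Cm :: real where
  "Cm = \<kappa> * C0 0 + \<kappa> * (C0 1 + m0 1 / \<phi> * C0 0) + Kb * m0 0 + Kb * m0 2 + 1"

lemma Cm_bounds: "\<kappa> * C0 0 \<le> Cm" "\<kappa> * (C0 1 + m0 1 / \<phi> * C0 0) \<le> Cm" "Kb * m0 0 \<le> Cm" "Kb * m0 2 \<le> Cm" "0 < Cm"
proof -
  have "0 \<le> \<kappa>" unfolding \<kappa>_def using K_nonneg by (intro Bochner_Integration.integral_nonneg) auto
  moreover have "0 \<le> Kb" using K_nonneg[of 0] K_le[of 0] by linarith
  ultimately have "0 \<le> \<kappa> * C0 0" "0 \<le> \<kappa> * (C0 1 + m0 1 / \<phi> * C0 0)" "0 \<le> Kb * m0 0" "0 \<le> Kb * m0 2"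
    using C0_nonneg[of 0] C0_nonneg[of 1] m0_nonneg \<phi>(1) by (auto intro!: mult_nonneg_nonneg add_nonneg_nonneg)
  thus "\<kappa> * C0 0 \<le> Cm" "\<kappa> * (C0 1 + m0 1 / \<phi> * C0 0) \<le> Cm" "Kb * m0 0 \<le> Cm" "Kb * m0 2 \<le> Cm" "0 < Cm"
    unfolding Cm_def by linarith+
qed

lemma Z_mean_ge:
  assumes n: "1 \<le> n" and x: "x \<in> {c<..<d}"
  shows "\<phi> - Cm * (h n)\<^sup>2 \<le> expectation (\<lambda>\<omega>. Zk K h X n \<omega> x)"
proof -
  have "C0 0 * (h n)\<^sup>2 * \<kappa> \<le> Cm * (h n)\<^sup>2"
    using mult_right_mono[OF Cm_bounds(1), of "(h n)\<^sup>2"] by (simp add: mult_ac)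
  thus ?thesis using ZY_expectation_near[OF n _ x, of 0] mom0_ge[OF x] by (simp add: \<kappa>_def[symmetric])
qed

text \<open>The bias is second order because \<open>regr g x * mom 0 x = mom 1 x\<close>: the leading terms of the two smoothed moments cancel.\<close>

lemma Z_bias:
  assumes n: "1 \<le> n" and x: "x \<in> {c<..<d}"
  shows "\<bar>expectation (\<lambda>\<omega>. Zk K h X n \<omega> x * (Y n \<omega> - regr g x))\<bar> \<le> Cm * (h n)\<^sup>2"
proof -
  let ?Z = "\<lambda>\<omega>. Zk K h X n \<omega> x" and ?r = "regr g x"
  have i: "integrable M ?Z" "integrable M (\<lambda>\<omega>. ?Z \<omega> * Y n \<omega>)"
    using ZY_integrable[OF n, of 0 x] ZY_integrable[OF n, of 1 x] by auto
  have near1: "\<bar>expectation (\<lambda>\<omega>. ?Z \<omega> * Y n \<omega>) - mom 1 x\<bar> \<le> C0 1 * (h n)\<^sup>2 * \<kappa>"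
    using ZY_expectation_near[OF n _ x, of 1] by (simp only: \<kappa>_def power_one_right insert_iff simp_thms)
  have near0: "\<bar>expectation ?Z - mom 0 x\<bar> \<le> C0 0 * (h n)\<^sup>2 * \<kappa>"
    using ZY_expectation_near[OF n _ x, of 0] by (simp only: \<kappa>_def power_0 mult_1_right insert_iff simp_thms)
  have m0\<phi>: "0 \<le> m0 1 / \<phi>" using m0_nonneg[of 1] \<phi>(1) by simp
  have r: "mom 1 x = ?r * mom 0 x" using mom0_ge[OF x] \<phi>(1) by (simp add: regr_mom)
  have "expectation (\<lambda>\<omega>. ?Z \<omega> * (Y n \<omega> - ?r)) = expectation (\<lambda>\<omega>. ?Z \<omega> * Y n \<omega> - ?r * ?Z \<omega>)"
    by (intro Bochner_Integration.integral_cong) (auto simp: algebra_simps)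
  also have "\<dots> = expectation (\<lambda>\<omega>. ?Z \<omega> * Y n \<omega>) - ?r * expectation ?Z"
    using i by simp
  also have "\<dots> = (expectation (\<lambda>\<omega>. ?Z \<omega> * Y n \<omega>) - mom 1 x) - ?r * (expectation ?Z - mom 0 x)"
    using r by (simp add: algebra_simps)
  finally have "\<bar>expectation (\<lambda>\<omega>. ?Z \<omega> * (Y n \<omega> - ?r))\<bar>
      \<le> \<bar>expectation (\<lambda>\<omega>. ?Z \<omega> * Y n \<omega>) - mom 1 x\<bar> + \<bar>?r\<bar> * \<bar>expectation ?Z - mom 0 x\<bar>"
    unfolding abs_mult[symmetric] by (simp only: abs_triangle_ineq4)
  also have "\<dots> \<le> C0 1 * (h n)\<^sup>2 * \<kappa> + m0 1 / \<phi> * (C0 0 * (h n)\<^sup>2 * \<kappa>)"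
    by (rule add_mono[OF near1 mult_mono[OF regr_abs_le[OF x] near0 m0\<phi> abs_ge_zero]])
  also have "\<dots> = \<kappa> * (C0 1 + m0 1 / \<phi> * C0 0) * (h n)\<^sup>2" by (simp add: algebra_simps)
  also have "\<dots> \<le> Cm * (h n)\<^sup>2" using Cm_bounds(2) by (intro mult_right_mono) auto
  finally show ?thesis .
qed

text \<open>One of the two factors \<open>Z\<close> is bounded by \<open>Kb / h n\<close>; the other one has a bounded smoothed moment.\<close>

lemma ZY_second_moment:
  assumes n: "1 \<le> n" and q: "q \<in> {0, 1}"
  shows "expectation (\<lambda>\<omega>. (Zk K h X n \<omega> x * Y n \<omega> ^ q)\<^sup>2) \<le> Kb * m0 (2 * q) / h n"
proof -
  let ?Z = "\<lambda>\<omega>. Zk K h X n \<omega> x"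
  have q2: "2 * q \<in> {0, 1, 2}" using q by auto
  have z0: "0 \<le> Kb / h n" using K_nonneg[of 0] K_le[of 0] h_pos[OF n] by simp
  have i: "integrable M (\<lambda>\<omega>. Kb / h n * (?Z \<omega> * Y n \<omega> ^ (2 * q)))"
    using ZY_integrable[OF n q2, of x] by simp
  have le: "(?Z \<omega> * Y n \<omega> ^ q)\<^sup>2 \<le> Kb / h n * (?Z \<omega> * Y n \<omega> ^ (2 * q))" for \<omega>
  proof -
    have "(?Z \<omega> * Y n \<omega> ^ q)\<^sup>2 = ?Z \<omega> * (?Z \<omega> * Y n \<omega> ^ (2 * q))"
      by (simp add: power2_eq_square mult_2 power_add)
    also have "\<dots> \<le> Kb / h n * (?Z \<omega> * Y n \<omega> ^ (2 * q))"
      using Z_bounds[OF n, of \<omega> x] by (intro mult_right_mono) auto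
    finally show ?thesis .
  qed
  have "expectation (\<lambda>\<omega>. (?Z \<omega> * Y n \<omega> ^ q)\<^sup>2) \<le> expectation (\<lambda>\<omega>. Kb / h n * (?Z \<omega> * Y n \<omega> ^ (2 * q)))"
  proof (rule integral_mono[OF _ i le])
    show "integrable M (\<lambda>\<omega>. (?Z \<omega> * Y n \<omega> ^ q)\<^sup>2)"
      by (rule Bochner_Integration.integrable_bound[OF i]) (use order_trans[OF le abs_ge_self] in \<open>auto intro!: AE_I2\<close>)
  qed
  also have "\<dots> = Kb / h n * expectation (\<lambda>\<omega>. ?Z \<omega> * Y n \<omega> ^ (2 * q))" by simp
  also have "\<dots> \<le> Kb / h n * m0 (2 * q)" by (intro mult_left_mono ZY_expectation_le[OF n q2] z0)
  finally show ?thesis by simp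
qed

end

section \<open>Uniform strong convergence rate of the Revesz estimator\<close>

theorem theorem3:
  fixes M :: "'w measure"
    and X Y :: "nat \<Rightarrow> 'w \<Rightarrow> real"
    and g :: "real \<Rightarrow> real \<Rightarrow> real"
    and K r0 :: "real \<Rightarrow> real"
    and \<gamma> h :: "nat \<Rightarrow> real"
    and I :: "real set"
    and c d \<phi> \<alpha> a :: real
  assumes prob: "prob_space M"
    and indep: "prob_space.indep_vars M (\<lambda>_. borel) (\<lambda>n \<omega>. (X n \<omega>, Y n \<omega>)) UNIV"
    and g_nonneg: "\<And>s t. 0 \<le> g s t"
    and density: "\<And>n. distributed M lborel (\<lambda>\<omega>. (X n \<omega>, Y n \<omega>)) (\<lambda>(s, t). ennreal (g s t))"
    and \<gamma>_zero: "\<gamma> \<longlonglongrightarrow> 0"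
    and h_zero: "h \<longlonglongrightarrow> 0"
    and r0_bounded: "bounded (r0 ` I)"
    and I: "I = {c<..<d}" "c < d"
    and \<phi>: "\<phi> = (INF x\<in>I. dens_X g x)" "0 < \<phi>"
    \<comment> \<open>(i)\<close>
    and K_nonneg: "\<And>z. 0 \<le> K z"
    and K_cont: "continuous_on UNIV K"
    and K_bounded: "bounded (range K)"
    and K_0: "has_bochner_integral lborel K 1"
    and K_1: "has_bochner_integral lborel (\<lambda>z. z * K z) 0"
    and K_2: "integrable lborel (\<lambda>z. z\<^sup>2 * K z)"
    \<comment> \<open>(ii)\<close>
    and \<gamma>_GS: "\<gamma> \<in> GS (- \<alpha>)" "\<alpha> \<in> {3/4<..1}"
    and \<gamma>_lim: "convergent (\<lambda>n. inverse (real n * \<gamma> n))"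
    and h_GS: "h \<in> GS (- a)" "a \<in> {(1 - \<alpha>) / 4<..<\<alpha> / 3}"
    \<comment> \<open>(iii)\<close>
    and g_C2: "twice_cont_diff_fst g"
    and g_012: "\<And>q. q \<in> {0, 1, 2::nat} \<Longrightarrow>
        (\<forall>s. integrable lborel (\<lambda>t. t ^ q * g s t)) \<and>
        bounded (range (\<lambda>s. \<integral>t. t ^ q * g s t \<partial>lborel)) \<and>
        (\<forall>x\<in>I. isCont (\<lambda>s. \<integral>t. t ^ q * g s t \<partial>lborel) x)"
    and g_23: "\<And>q. q \<in> {2..3::real} \<Longrightarrow>
        (\<forall>s. integrable lborel (\<lambda>t. \<bar>t\<bar> powr q * g s t)) \<and>
        bounded (range (\<lambda>s. \<integral>t. \<bar>t\<bar> powr q * g s t \<partial>lborel))"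
    and g_D1: "\<And>q x. q \<in> {0, 1::nat} \<Longrightarrow> x \<in> I \<Longrightarrow>
        integrable lborel (\<lambda>t. \<bar>t\<bar> ^ q * \<bar>D1 g x t\<bar>)"
    and g_D2: "\<And>q. q \<in> {0, 1::nat} \<Longrightarrow>
        (\<forall>s. integrable lborel (\<lambda>t. t ^ q * D2 g s t)) \<and>
        bounded (range (\<lambda>s. \<integral>t. t ^ q * D2 g s t \<partial>lborel)) \<and>
        (\<forall>x\<in>I. isCont (\<lambda>s. \<integral>t. t ^ q * D2 g s t \<partial>lborel) x)"
    and g_D2_loc: "D2_loc_integrable g"
    \<comment> \<open>(iv)\<close>
    and K_lipschitz: "\<exists>C. C-lipschitz_on UNIV K"
    and Y_exp: "\<exists>tstar>0. integrable M (\<lambda>\<omega>. exp (tstar * \<bar>Y 0 \<omega>\<bar>))"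
    and a_range: "a \<in> {1 - \<alpha><..<\<alpha> - 2/3}"
    and g_D1_bounded: "\<And>q. q \<in> {0, 1::nat} \<Longrightarrow>
        (\<forall>x\<in>{x. 0 < dens_X g x}. integrable lborel (\<lambda>t. \<bar>t\<bar> ^ q * \<bar>D1 g x t\<bar>)) \<and>
        bounded ((\<lambda>x. \<integral>t. \<bar>t\<bar> ^ q * \<bar>D1 g x t\<bar> \<partial>lborel) ` {x. 0 < dens_X g x})"
  shows
    "(Bseq (\<lambda>n. inverse (\<gamma> n) * h n ^ 5 / (ln (real n))\<^sup>2) \<and>
      (\<exists>L. (\<lambda>n. ereal (real n * \<gamma> n)) \<longlonglongrightarrow> L \<and> ereal ((1 - a) / (2 * \<phi>)) < L)
      \<longrightarrow> as_sup_bigo M I (\<lambda>n \<omega> x. revesz K \<gamma> h X Y r0 n \<omega> x - regr g x)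
            (\<lambda>n. sqrt (\<gamma> n * inverse (h n)) * ln (real n))) \<and>
     (filterlim (\<lambda>n. inverse (\<gamma> n) * h n ^ 5 / (ln (real n))\<^sup>2) at_top sequentially \<and>
      (\<exists>L. (\<lambda>n. ereal (real n * \<gamma> n)) \<longlonglongrightarrow> L \<and> ereal (2 * a / \<phi>) < L)
      \<longrightarrow> as_sup_bigo M I (\<lambda>n \<omega> x. revesz K \<gamma> h X Y r0 n \<omega> x - regr g x)
            (\<lambda>n. (h n)\<^sup>2))"
proof -
  interpret prob_space M by (rule prob)
  have \<gamma>_pos: "0 < \<gamma> n" if "1 \<le> n" for n using \<gamma>_GS(1) that by (auto simp: GS_def)
  have h_pos: "0 < h n" if "1 \<le> n" for n using h_GS(1) that by (auto simp: GS_def)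
  have ar: "1 - \<alpha> < a" "a < \<alpha> - 2/3" "\<alpha> \<le> 1" using a_range \<gamma>_GS(2) by auto
  obtain Kb where Kb: "\<And>z. K z \<le> Kb"
  proof -
    obtain B where "\<And>z. norm (K z) \<le> B" using K_bounded unfolding bounded_iff by blast
    hence "K z \<le> B" for z using abs_ge_self[of "K z"] by (metis order_trans real_norm_def)
    thus ?thesis using that by blast
  qed
  obtain KL where KL: "\<And>y z. \<bar>K y - K z\<bar> \<le> KL * \<bar>y - z\<bar>"
  proof -
    obtain L where "L-lipschitz_on UNIV K" using K_lipschitz by blast
    from lipschitz_onD[OF this] have "\<bar>K y - K z\<bar> \<le> L * \<bar>y - z\<bar>" for y z by (simp add: dist_real_def)
    thus ?thesis using that by blast
  qed
  obtain R0 where R0: "\<And>x. x \<in> I \<Longrightarrow> \<bar>r0 x\<bar> \<le> R0"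
    using r0_bounded unfolding bounded_iff by auto
  obtain t where t: "0 < t" "integrable M (\<lambda>\<omega>. exp (t * \<bar>Y 0 \<omega>\<bar>))" using Y_exp by blast
  have \<phi>_le: "\<phi> \<le> dens_X g x" if "x \<in> {c<..<d}" for x
  proof -
    have "0 \<le> dens_X g s" for s unfolding dens_X_def using g_nonneg by (intro Bochner_Integration.integral_nonneg) auto
    hence "bdd_below (dens_X g ` I)" by (intro bdd_belowI2[where m=0]) auto
    thus ?thesis using that unfolding \<phi>(1) I(1) by (intro cINF_lower) auto
  qed
  have "\<forall>q\<in>{0,1,2::nat}. \<exists>B. \<forall>s. \<bar>\<integral>t. t ^ q * g s t \<partial>lborel\<bar> \<le> B"
    using g_012 unfolding bounded_iff by fastforce
  from bchoice[OF this] obtain m0 where m0: "\<And>q s. q \<in> {0,1,2::nat} \<Longrightarrow> \<bar>\<integral>t. t ^ q * g s t \<partial>lborel\<bar> \<le> m0 q"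
    by blast
  have "\<forall>q\<in>{0,1::nat}. \<exists>B. \<forall>s. \<bar>\<integral>t. t ^ q * D2 g s t \<partial>lborel\<bar> \<le> B"
    using g_D2 unfolding bounded_iff by fastforce
  from bchoice[OF this] obtain C0 where C0: "\<And>q s. q \<in> {0,1::nat} \<Longrightarrow> \<bar>\<integral>t. t ^ q * D2 g s t \<partial>lborel\<bar> \<le> C0 q"
    by blast
  have "\<exists>B. \<forall>x\<in>I. (\<integral>t. \<bar>t\<bar> ^ q * \<bar>D1 g x t\<bar> \<partial>lborel) \<le> B" if q: "q \<in> {0,1::nat}" for q
  proof -
    obtain B where B: "\<And>x. 0 < dens_X g x \<Longrightarrow> norm (\<integral>t. \<bar>t\<bar> ^ q * \<bar>D1 g x t\<bar> \<partial>lborel) \<le> B"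
      using g_D1_bounded[OF q] unfolding bounded_iff by auto
    have "(\<integral>t. \<bar>t\<bar> ^ q * \<bar>D1 g x t\<bar> \<partial>lborel) \<le> B" if "x \<in> I" for x
      using B[of x] \<phi>_le[of x] \<phi>(2) that I(1) abs_ge_self order_trans by (metis less_le_trans real_norm_def)
    thus ?thesis by blast
  qed
  hence "\<forall>q\<in>{0,1::nat}. \<exists>B. \<forall>x\<in>I. (\<integral>t. \<bar>t\<bar> ^ q * \<bar>D1 g x t\<bar> \<partial>lborel) \<le> B" by blast
  from bchoice[OF this] obtain D0 where D0: "\<And>q x. q \<in> {0,1::nat} \<Longrightarrow> x \<in> I \<Longrightarrow>
      (\<integral>t. \<bar>t\<bar> ^ q * \<bar>D1 g x t\<bar> \<partial>lborel) \<le> D0 q"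
    by blast
  interpret D: revesz_density M X Y g K h c d \<phi> Kb t C0 D0 m0
  proof unfold_locales
    show "integrable lborel (\<lambda>t. t ^ q * g s t)" if "q \<in> {0, 1, 2}" for q s using g_012[OF that] by blast
    show "integrable lborel (\<lambda>t. \<bar>t\<bar> ^ q * \<bar>D1 g x t\<bar>)" if "q \<in> {0, 1}" "x \<in> {c<..<d}" for q x
      using g_D1[OF that(1)] that(2) I(1) by blast
    show "(\<integral>t. \<bar>t\<bar> ^ q * \<bar>D1 g x t\<bar> \<partial>lborel) \<le> D0 q" if "q \<in> {0, 1}" "x \<in> {c<..<d}" for q x
      using D0[OF that(1)] that(2) I(1) by blast
  qed (fact g_nonneg density I(2) \<phi>(2) \<phi>_le K_nonneg Kb K_0 K_1 K_2 h_pos g_C2 m0 C0 g_D2_loc t)+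

  define s where "s n = sqrt (\<gamma> n / h n)" for n
  have s_pos: "0 < s n" if "1 \<le> n" for n using \<gamma>_pos h_pos that by (simp add: s_def)
  have rate_\<gamma>: "log_rate (-\<alpha>) \<gamma>" and rate_h: "log_rate (-a) h"
    using GS_imp_log_rate \<gamma>_GS(1) h_GS(1) by auto
  have ev1: "\<forall>\<^sub>F n in sequentially. (1::nat) \<le> n" by (rule eventually_ge_at_top)
  have ln_pos: "\<forall>\<^sub>F n in sequentially. 0 < ln (real n)" by real_asymp
  have rate_s: "log_rate ((1/2) * (-\<alpha>) + (-1/2) * (-a)) s"
  proof (rule log_rate_combine[OF rate_\<gamma> rate_h])
    show "\<forall>\<^sub>F n in sequentially. 0 < s n \<and> ln (s n) = 1/2 * ln (\<gamma> n) + -1/2 * ln (h n)"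
      using ev1
    proof eventually_elim
      case (elim n)
      thus ?case using \<gamma>_pos[of n] h_pos[of n] s_pos[of n]
        by (simp add: s_def ln_sqrt ln_div field_simps)
    qed
  qed
  have noise_zero: "(\<lambda>n. sqrt (\<gamma> n / h n) * ln (real n)) \<longlonglongrightarrow> 0"
  proof -
    have "log_rate (1 * ((1/2) * (-\<alpha>) + (-1/2) * (-a)) + 1 * 0) (\<lambda>n. s n * ln (real n))"
    proof (rule log_rate_combine[OF rate_s log_rate_ln])
      show "\<forall>\<^sub>F n in sequentially. 0 < s n * ln (real n) \<and>
          ln (s n * ln (real n)) = 1 * ln (s n) + 1 * ln (ln (real n))"
        using ev1 ln_pos
        proof eventually_elim
          case (elim n)
          thus ?case using s_pos[of n] by (simp add: ln_mult)
        qed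
    qed
    hence "(\<lambda>n. s n * ln (real n)) \<longlonglongrightarrow> 0"
      by (rule log_rate_neg_tendsto_0) (use ar in auto)
    thus ?thesis by (simp add: s_def)
  qed
  obtain \<epsilon>h where \<epsilon>h: "0 < \<epsilon>h" "\<forall>\<^sub>F n in sequentially. \<epsilon>h / real n \<le> h n"
  proof -
    have "log_rate (1 * 1 + 1 * (-a)) (\<lambda>n. real n * h n)"
    proof (rule log_rate_combine[OF log_rate_real rate_h])
      show "\<forall>\<^sub>F n in sequentially. 0 < real n * h n \<and> ln (real n * h n) = 1 * ln (real n) + 1 * ln (h n)"
        using ev1
        proof eventually_elim
          case (elim n)
          thus ?case using h_pos[of n] by (simp add: ln_mult)
        qed
    qed
    then obtain \<epsilon> where \<epsilon>: "0 < \<epsilon>" "\<forall>\<^sub>F n in sequentially. \<epsilon> \<le> real n * h n"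
      using log_rate_pos_bounded_below[of "1 * 1 + 1 * (-a)" "\<lambda>n. real n * h n"] ar by auto
    have "\<forall>\<^sub>F n in sequentially. \<epsilon> / real n \<le> h n"
      using \<epsilon>(2) ev1 by eventually_elim (auto simp: field_simps)
    thus ?thesis using that \<epsilon>(1) by blast
  qed

  \<comment> \<open>Both claims are instances; \<open>\<sigma>\<close> is the decay exponent of \<open>v\<close> up to slowly varying factors.\<close>
  have main: "as_sup_bigo M I (\<lambda>n \<omega> x. revesz K \<gamma> h X Y r0 n \<omega> x - regr g x) v"
    if v_pos: "\<forall>\<^sub>F n in sequentially. 0 < v n" and c0: "0 < c0"
      and v_h: "\<forall>\<^sub>F n in sequentially. c0 * (h n)\<^sup>2 \<le> v n"
      and v_noise: "\<forall>\<^sub>F n in sequentially. c0 * (s n * ln (real n)) \<le> v n"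
      and rate: "log_rate \<sigma> (\<lambda>n. ln (real n) / v n)" "0 < \<sigma>"
      and L: "(\<lambda>n. ereal (real n * \<gamma> n)) \<longlonglongrightarrow> L" "ereal (\<sigma> / \<phi>) < L"
    for v c0 \<sigma> L
  proof -
    obtain \<phi>2 where \<phi>2: "\<phi>2 < \<phi>" "\<forall>\<^sub>F n in sequentially.
        ln (ln (real n) / v n) - ln (ln (real (n - 1)) / v (n - 1)) \<le> \<phi>2 * \<gamma> n"
      using gain_beats_decay[OF rate \<phi>(2) L] by blast
    interpret E: revesz_rate M X Y K "regr g" \<gamma> h v c d Kb KL "m0 1 / \<phi>"
      "((D0 1 + C0 1 * (d - c)) + m0 1 / \<phi> * (D0 0 + C0 0 * (d - c))) / \<phi>"
      t "expectation (\<lambda>\<omega>. exp (t * \<bar>Y 0 \<omega>\<bar>))" D.Cm \<phi> \<phi>2 c0 \<epsilon>h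
    proof unfold_locales
      show "expectation (\<lambda>\<omega>. exp (t * \<bar>Y n \<omega>\<bar>)) \<le> expectation (\<lambda>\<omega>. exp (t * \<bar>Y 0 \<omega>\<bar>))" for n
        by (rule D.Y_exp_eq[THEN eq_refl])
      show "expectation (\<lambda>\<omega>. (Zk K h X n \<omega> x)\<^sup>2) \<le> D.Cm / h n" if "1 \<le> n" for n x
        using D.ZY_second_moment[OF that, of 0 x] divide_right_mono[OF D.Cm_bounds(3), of "h n"] h_pos[OF that] by simp
      show "expectation (\<lambda>\<omega>. (Zk K h X n \<omega> x * Y n \<omega>)\<^sup>2) \<le> D.Cm / h n" if "1 \<le> n" for n x
        using D.ZY_second_moment[OF that, of 1 x] divide_right_mono[OF D.Cm_bounds(4), of "h n"] h_pos[OF that] by simp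
      show "\<forall>\<^sub>F n in sequentially. c0 * (sqrt (\<gamma> n / h n) * ln (real n)) \<le> v n"
        using v_noise by (simp add: s_def)
    qed (fact indep D.K_meas K_nonneg Kb KL \<gamma>_pos h_pos I(2) D.regr_abs_le D.regr_lipschitz t(1) D.Y_exp
      D.Z_mean_ge D.Z_bias D.Cm_bounds(5) \<phi>2 h_zero \<gamma>_zero \<epsilon>h noise_zero v_pos c0 v_h)+
    show ?thesis unfolding I(1)
      by (rule E.revesz_as_sup_bigo[of r0 R0]) (use R0 I(1) in auto)
  qed

  \<comment> \<open>The ratio in the case distinction is the square of the ratio of \<open>(h n)\<^sup>2\<close> and \<open>s n * ln n\<close>.\<close>
  have h4: "(h n)\<^sup>2 * (h n)\<^sup>2 = (inverse (\<gamma> n) * h n ^ 5 / (ln (real n))\<^sup>2) * (s n * ln (real n))\<^sup>2"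
    if "1 \<le> n" "0 < ln (real n)" for n
  proof -
    have "(s n)\<^sup>2 = \<gamma> n / h n" using \<gamma>_pos[of n] h_pos[of n] that by (simp add: s_def)
    hence "(inverse (\<gamma> n) * h n ^ 5 / (ln (real n))\<^sup>2) * (s n * ln (real n))\<^sup>2
        = inverse (\<gamma> n) * h n ^ 5 * (\<gamma> n / h n)"
      using that by (simp add: power_mult_distrib)
    also have "\<dots> = h n ^ 4"
      using \<gamma>_pos[OF that(1)] h_pos[OF that(1)] by (simp add: field_simps power_numeral_reduce)
    finally show ?thesis by (simp add: power_numeral_reduce)
  qed

  show ?thesis
  proof (intro conjI impI; elim conjE exE)
    fix L
    assume B: "Bseq (\<lambda>n. inverse (\<gamma> n) * h n ^ 5 / (ln (real n))\<^sup>2)"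
      and L: "(\<lambda>n. ereal (real n * \<gamma> n)) \<longlonglongrightarrow> L" "ereal ((1 - a) / (2 * \<phi>)) < L"
    obtain B0 where B0: "0 < B0" "\<And>n. norm (inverse (\<gamma> n) * h n ^ 5 / (ln (real n))\<^sup>2) \<le> B0"
      using B unfolding Bseq_def by blast
    define c0 where "c0 = min 1 (1 / sqrt B0)"
    have c0: "0 < c0" "c0 \<le> 1" "c0 * sqrt B0 \<le> 1" using B0(1) by (auto simp: c0_def min_def field_simps)
    have "as_sup_bigo M I (\<lambda>n \<omega> x. revesz K \<gamma> h X Y r0 n \<omega> x - regr g x) (\<lambda>n. s n * ln (real n))"
    proof (rule main[OF _ c0(1)])
      show "\<forall>\<^sub>F n in sequentially. 0 < s n * ln (real n)"
        using ev1 ln_pos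
        proof eventually_elim
          case (elim n)
          thus ?case using s_pos[of n] by simp
        qed
      show "\<forall>\<^sub>F n in sequentially. c0 * (h n)\<^sup>2 \<le> s n * ln (real n)"
        using ev1 ln_pos
      proof eventually_elim
        case (elim n)
        have p: "0 < s n * ln (real n)" using s_pos elim by simp
        have "((h n)\<^sup>2)\<^sup>2 \<le> B0 * (s n * ln (real n))\<^sup>2"
        proof -
          have "inverse (\<gamma> n) * h n ^ 5 / (ln (real n))\<^sup>2 \<le> B0"
            using B0(2)[of n] abs_ge_self order_trans unfolding real_norm_def by blast
          from mult_right_mono[OF this zero_le_power2[of "s n * ln (real n)"]] show ?thesis
            unfolding power2_eq_square[of "(h n)\<^sup>2"] h4[OF elim] .
        qed
        also have "\<dots> = (sqrt B0 * (s n * ln (real n)))\<^sup>2" using B0(1) by (simp add: power_mult_distrib)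
        finally have "(h n)\<^sup>2 \<le> sqrt B0 * (s n * ln (real n))"
          by (rule power2_le_imp_le) (use B0(1) p in auto)
        hence "c0 * (h n)\<^sup>2 \<le> c0 * (sqrt B0 * (s n * ln (real n)))" using c0 by (intro mult_left_mono) auto
        also have "\<dots> = (c0 * sqrt B0) * (s n * ln (real n))" by simp
        also have "\<dots> \<le> 1 * (s n * ln (real n))" using c0 p by (intro mult_right_mono) auto
        finally show ?case by simp
      qed
      show "\<forall>\<^sub>F n in sequentially. c0 * (s n * ln (real n)) \<le> s n * ln (real n)"
        using ev1 ln_pos
      proof eventually_elim
        case (elim n)
        have "0 < s n * ln (real n)" using s_pos elim by simp
        from mult_right_mono[OF c0(2) less_imp_le[OF this]] show ?case by simp
      qed
      have "log_rate ((-1) * ((1/2) * (-\<alpha>) + (-1/2) * (-a)) + 0 * 0) (\<lambda>n. ln (real n) / (s n * ln (real n)))"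
      proof (rule log_rate_combine[OF rate_s log_rate_ln])
        show "\<forall>\<^sub>F n in sequentially. 0 < ln (real n) / (s n * ln (real n)) \<and>
            ln (ln (real n) / (s n * ln (real n))) = -1 * ln (s n) + 0 * ln (ln (real n))"
          using ev1 ln_pos
          proof eventually_elim
            case (elim n)
            thus ?case using s_pos[of n] by (simp add: ln_div)
          qed
      qed
      thus "log_rate ((\<alpha> - a) / 2) (\<lambda>n. ln (real n) / (s n * ln (real n)))"
        by (simp add: diff_divide_distrib)
      show "0 < (\<alpha> - a) / 2" using ar by simp
      show "(\<lambda>n. ereal (real n * \<gamma> n)) \<longlonglongrightarrow> L" by (rule L(1))
      \<comment> \<open>The exponent of the rate is \<open>(\<alpha> - a) / 2\<close>; the stated condition covers it since \<open>\<alpha> \<le> 1\<close>.\<close>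
      have "(\<alpha> - a) / 2 / \<phi> \<le> (1 - a) / (2 * \<phi>)"
        using ar \<phi>(2) by (simp add: divide_right_mono)
      thus "ereal ((\<alpha> - a) / 2 / \<phi>) < L" using L(2) by (meson ereal_less_eq(3) le_less_trans)
    qed
    thus "as_sup_bigo M I (\<lambda>n \<omega> x. revesz K \<gamma> h X Y r0 n \<omega> x - regr g x)
        (\<lambda>n. sqrt (\<gamma> n * inverse (h n)) * ln (real n))"
      by (simp add: s_def[abs_def] divide_inverse)
  next
    fix L
    assume F: "filterlim (\<lambda>n. inverse (\<gamma> n) * h n ^ 5 / (ln (real n))\<^sup>2) at_top sequentially"
      and L: "(\<lambda>n. ereal (real n * \<gamma> n)) \<longlonglongrightarrow> L" "ereal (2 * a / \<phi>) < L"
    show "as_sup_bigo M I (\<lambda>n \<omega> x. revesz K \<gamma> h X Y r0 n \<omega> x - regr g x) (\<lambda>n. (h n)\<^sup>2)"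
    proof (rule main[OF _ zero_less_one])
      show "\<forall>\<^sub>F n in sequentially. 0 < (h n)\<^sup>2"
        using ev1
        proof eventually_elim
          case (elim n)
          thus ?case using h_pos[of n] by simp
        qed
      show "\<forall>\<^sub>F n in sequentially. 1 * (h n)\<^sup>2 \<le> (h n)\<^sup>2" by simp
      have "\<forall>\<^sub>F n in sequentially. 1 \<le> inverse (\<gamma> n) * h n ^ 5 / (ln (real n))\<^sup>2"
        using F unfolding filterlim_at_top by blast
      thus "\<forall>\<^sub>F n in sequentially. 1 * (s n * ln (real n)) \<le> (h n)\<^sup>2"
        using ev1 ln_pos
      proof eventually_elim
        case (elim n)
        have "1 * (s n * ln (real n))\<^sup>2 \<le> (inverse (\<gamma> n) * h n ^ 5 / (ln (real n))\<^sup>2) * (s n * ln (real n))\<^sup>2"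
          using elim(1) by (rule mult_right_mono) simp
        also have "\<dots> = ((h n)\<^sup>2)\<^sup>2" using h4[OF elim(2,3)] by (simp only: power2_eq_square[of "(h n)\<^sup>2"])
        finally have "(s n * ln (real n))\<^sup>2 \<le> ((h n)\<^sup>2)\<^sup>2" by (simp only: mult_1)
        hence "s n * ln (real n) \<le> (h n)\<^sup>2" by (rule power2_le_imp_le) simp
        thus ?case by simp
      qed
      have "log_rate ((-2) * (-a) + 1 * 0) (\<lambda>n. ln (real n) / (h n)\<^sup>2)"
      proof (rule log_rate_combine[OF rate_h log_rate_ln])
        show "\<forall>\<^sub>F n in sequentially. 0 < ln (real n) / (h n)\<^sup>2 \<and>
            ln (ln (real n) / (h n)\<^sup>2) = -2 * ln (h n) + 1 * ln (ln (real n))"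
          using ev1 ln_pos
        proof eventually_elim
          case (elim n)
          thus ?case using h_pos[of n] by (simp add: ln_div ln_realpow)
        qed
      qed
      thus "log_rate (2 * a) (\<lambda>n. ln (real n) / (h n)\<^sup>2)" by simp
      show "0 < 2 * a" using ar by simp
    qed (fact L)+
  qed
qed

end
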